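(* Suppose that: (i) the target density on $\mathbb{R}^d$ is of the product form $\pi(x)=\prod_{i=1}^d C_i\,g(C_ix_i)$, where $g$ is a one-dimensional probability density and $C_1,\dots,C_d>0$ are (unknown) constants; (ii) $g$ has finite second moment, i.e. $\mathrm{Var}_g Z<\infty$; (iii) the one-dimensional random walk Metropolis algorithm with $N(x,1)$ proposal distributions and target density $g$ is uniformly ergodic. Let $a_1,\dots,a_d$ be real numbers with $a_i\neq0$ for all $i$. Then the HST-algorithm and the RR-algorithm (with weights $a_1,\dots,a_d$, defined in the context) are ergodic: for $\pi$-almost every starting state $x_0$ and all initial selection probabilities, the distribution of $X_n$ converges to $\pi$ in total variation as $n\to\infty$.
   Context: Both algorithms are adaptive random scan adaptive Metropolis-within-Gibbs samplers on $\mathbb{R}^d$ with Gaussian random walk proposals, motivated by estimating the expectation of $f(x)=a_0+\sum_{i=1}^d a_ix_i$. At step $n$, given the past: choose a coordinate $i\in\{1,\dots,d\}$ with probability $\alpha_{n,i}$; propose $Y\sim N(X_{n-1,i},\sigma^2_{n,i})$ for coordinate $i$; accept (replace $X_{n-1,i}$ by $Y$, other coordinates unchanged) with probability $\min\{1,\ g(C_iY)/g(C_iX_{n-1,i})\}$, otherwise set $X_n=X_{n-1}$. In both cases the selection probabilities are $$\alpha_{n,i}=\frac{(\sigma^2_{n,i}a_i^2)^{1/2}}{\sum_{k=1}^d(\sigma^2_{n,k}a_k^2)^{1/2}}.$$ HST-algorithm: $\sigma^2_{n,i}=(2.4)^2(s^2_{n,i}+0.05)$, where $s^2_{n,i}$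 is the sample variance of $X_{0,i},\dots,X_{n-1,i}$. RR-algorithm: $\sigma^2_{n,i}=e^{ls_i}$, where $ls_i$ is updated after every batch of 50 iterations by adding or subtracting $\delta(n)=O(n^{-1/2})$: it is increased by $\delta(n)$ if the fraction of acceptances of proposals for variable $i$ in the last batch was more than $0.44$, and decreased by $\delta(n)$ if it was less, with the additional restriction that $ls_i$ stays in $[-M,M]$ for some fixed large $M<\infty$. A Markov kernel $P$ with stationary distribution $\mu$ is uniformly ergodic if there are $K<\infty$, $\rho<1$ with $\|P^n(x,\cdot)-\mu\|_{TV}\le K\rho^n$ for all states $x$ and all $n$; in (iii) the state space of the Metropolis chain is the support $\{g>0\}$. *)

theory Defs
  imports "HOL-Probability.Probability" "HOL-Library.Landau_Symbols"
begin

section \<open>Uniform ergodicity of the one-dimensional chain\<close>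

definition tv_dist :: "'a measure \<Rightarrow> 'a measure \<Rightarrow> real" where
  "tv_dist M N = (SUP A\<in>sets M. \<bar>measure M A - measure N A\<bar>)"

primrec kernel_power :: "'a measure \<Rightarrow> ('a \<Rightarrow> 'a measure) \<Rightarrow> nat \<Rightarrow> 'a \<Rightarrow> 'a measure" where
  "kernel_power M P 0 x = return M x"
| "kernel_power M P (Suc n) x = kernel_power M P n x \<bind> P"

text \<open>The state space \<open>S\<close> may be a proper subset of the space of \<open>\<mu>\<close>: below the kernel is
  written down on all of \<open>\<real>\<close>, but the chain lives on \<open>{x. g x > 0}\<close>.\<close>

definition uniformly_ergodic :: "'a set \<Rightarrow> ('a \<Rightarrow> 'a measure) \<Rightarrow> 'a measure \<Rightarrow> bool" where
  "uniformly_ergodic S P \<mu> \<longleftrightarrow>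
     \<mu> \<bind> P = \<mu> \<and>
     (\<exists>K \<rho>. 0 \<le> \<rho> \<and> \<rho> < 1 \<and> (\<forall>x\<in>S. \<forall>n. tv_dist (kernel_power \<mu> P n x) \<mu> \<le> K * \<rho> ^ n))"

text \<open>The acceptance probability is only relevant at points \<open>x\<close> with \<open>g x > 0\<close>. Proposals \<open>y\<close> with
  \<open>g y = 0\<close> are then rejected, so the support is never left. Note that the second argument of
  \<^const>\<open>normal_density\<close> is the standard deviation.\<close>

definition rwm_kernel :: "(real \<Rightarrow> real) \<Rightarrow> real \<Rightarrow> real measure" where
  "rwm_kernel g x = do {
     y \<leftarrow> density lborel (normal_density x 1);
     acc \<leftarrow> measure_pmf (bernoulli_pmf (min 1 (g y / g x)));
     return borel (if acc then y else x)
   }"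

section \<open>Adaptive random scan Metropolis-within-Gibbs\<close>

definition product_target :: "(real \<Rightarrow> real) \<Rightarrow> ('d::finite \<Rightarrow> real) \<Rightarrow> (real^'d) measure" where
  "product_target g C = density lborel (\<lambda>x. ennreal (\<Prod>i\<in>UNIV. C i * g (C i * x $ i)))"

text \<open>The record of iteration \<open>n\<close> is the triple of the new state \<open>X\<^sub>n\<close>, the selected coordinate, and
  whether the proposal was accepted. A history assigns such a record to each iteration; only
  the state component of the record with index 0 is ever used.\<close>

type_synonym 'd mwg_record = "(real^'d) \<times> 'd \<times> bool"
type_synonym 'd history = "nat \<Rightarrow> 'd mwg_record"

abbreviation state_of :: "'d mwg_record \<Rightarrow> real^'d" where "state_of z \<equiv> fst z"
abbreviation coord_of :: "'d mwg_record \<Rightarrow> 'd" where "coord_of z \<equiv> fst (snd z)"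
abbreviation accepted :: "'d mwg_record \<Rightarrow> bool" where "accepted z \<equiv> snd (snd z)"

definition record_space :: "('d::finite) mwg_record measure" where
  "record_space = borel \<Otimes>\<^sub>M (count_space UNIV \<Otimes>\<^sub>M count_space UNIV)"

definition mwg_step ::
  "(real \<Rightarrow> real) \<Rightarrow> ('d::finite \<Rightarrow> real) \<Rightarrow> ('d \<Rightarrow> real) \<Rightarrow> ('d \<Rightarrow> real) \<Rightarrow> real^'d \<Rightarrow> 'd mwg_record measure"
where
  "mwg_step g C \<alpha> \<sigma>2 x = do {
     i \<leftarrow> point_measure UNIV (\<lambda>i. ennreal (\<alpha> i));
     y \<leftarrow> density lborel (normal_density (x $ i) (sqrt (\<sigma>2 i)));
     acc \<leftarrow> measure_pmf (bernoulli_pmf (min 1 (g (C i * y) / g (C i * x $ i))));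
     return record_space (if acc then (\<chi> k. if k = i then y else x $ k) else x, i, acc)
   }"

definition selection_prob :: "('d::finite \<Rightarrow> real) \<Rightarrow> ('d \<Rightarrow> real) \<Rightarrow> 'd \<Rightarrow> real" where
  "selection_prob a \<sigma>2 i = sqrt (\<sigma>2 i * (a i)\<^sup>2) / (\<Sum>k\<in>UNIV. sqrt (\<sigma>2 k * (a k)\<^sup>2))"

definition prob_vector :: "('d::finite \<Rightarrow> real) \<Rightarrow> bool" where
  "prob_vector \<alpha> \<longleftrightarrow> (\<forall>i. 0 \<le> \<alpha> i) \<and> (\<Sum>i\<in>UNIV. \<alpha> i) = 1"

text \<open>An adaptation rule \<open>V n h\<close> gives the proposal variances of iteration \<open>n \<ge> 1\<close> as a function of the
  records with index below \<open>n\<close>. The first iteration uses the initial selection probabilities \<open>\<alpha>0\<close>,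
  every later one those computed from the variances. Under both rules below the variances of
  iteration 1 are deterministic (lemmas \<open>hst_variance_first\<close> and \<open>rr_variance_first\<close>), so the variant
  that uses the formula in iteration 1 too is the instance where \<open>\<alpha>0\<close> is the value of the formula.\<close>

definition adaptive_mwg ::
  "(real \<Rightarrow> real) \<Rightarrow> ('d::finite \<Rightarrow> real) \<Rightarrow> ('d \<Rightarrow> real) \<Rightarrow> (nat \<Rightarrow> 'd history \<Rightarrow> 'd \<Rightarrow> real)
    \<Rightarrow> ('d \<Rightarrow> real) \<Rightarrow> real^'d \<Rightarrow> nat \<Rightarrow> 'd history \<Rightarrow> 'd mwg_record measure"
where
  "adaptive_mwg g C a V \<alpha>0 x0 n h =
     (if n = 0 then return record_space (x0, undefined, False)
      else mwg_step g C (if n = 1 then \<alpha>0 else selection_prob a (V n h)) (V n h)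
             (state_of (h (n - 1))))"

text \<open>\<open>Ionescu_Tulcea.C K M 0 (Suc n)\<close> is the joint law of the records with indices \<open>0, \<dots>, n\<close> when the
  conditional law of each record given the preceding ones is given by \<open>K\<close>.\<close>

definition law_at ::
  "(nat \<Rightarrow> ('d::finite) history \<Rightarrow> 'd mwg_record measure) \<Rightarrow> nat \<Rightarrow> (real^'d) measure"
where
  "law_at K n =
     distr (Ionescu_Tulcea.C K (\<lambda>_. record_space) 0 (Suc n) (\<lambda>_. undefined)) borel (\<lambda>h. state_of (h n))"

subsection \<open>The HST rule\<close>

text \<open>The sample variance has the divisor \<open>n - 1\<close>; the sample variance of a single observation is 0,
  because of the convention \<open>0 / 0 = 0\<close>.\<close>

definition sample_variance :: "nat \<Rightarrow> (nat \<Rightarrow> real) \<Rightarrow> real" where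
  "sample_variance n x = (\<Sum>j<n. (x j - (\<Sum>k<n. x k) / real n)\<^sup>2) / (real n - 1)"

definition hst_variance :: "nat \<Rightarrow> ('d::finite) history \<Rightarrow> 'd \<Rightarrow> real" where
  "hst_variance n h i = (2.4)\<^sup>2 * (sample_variance n (\<lambda>j. state_of (h j) $ i) + 0.05)"

definition HST_kernel where
  "HST_kernel g C a \<alpha>0 x0 = adaptive_mwg g C a hst_variance \<alpha>0 x0"

subsection \<open>The RR rule\<close>

text \<open>Batch \<open>b \<ge> 1\<close> consists of the iterations \<open>50 * (b - 1) + 1, \<dots>, 50 * b\<close>, and \<open>\<delta> b\<close> is the amount by
  which the log variances change after it.\<close>

definition batch :: "nat \<Rightarrow> nat set" where
  "batch b = {50 * (b - 1)<..50 * b}"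

definition n_proposals :: "('d::finite) history \<Rightarrow> 'd \<Rightarrow> nat \<Rightarrow> nat" where
  "n_proposals h i b = card {n \<in> batch b. coord_of (h n) = i}"

definition n_accepted :: "('d::finite) history \<Rightarrow> 'd \<Rightarrow> nat \<Rightarrow> nat" where
  "n_accepted h i b = card {n \<in> batch b. coord_of (h n) = i \<and> accepted (h n)}"

definition acceptance_rate :: "('d::finite) history \<Rightarrow> 'd \<Rightarrow> nat \<Rightarrow> real" where
  "acceptance_rate h i b = real (n_accepted h i b) / real (n_proposals h i b)"

text \<open>\<open>rr_log_variance \<delta> M ls0 h b i\<close> is \<open>ls\<^sub>i\<close> after \<open>b\<close> batches. It is left unchanged when coordinate \<open>i\<close>
  was never selected in the batch (the fraction is undefined) or the fraction is exactly 0.44.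
  An update that would leave \<open>[-M, M]\<close> is truncated.\<close>

primrec rr_log_variance ::
  "(nat \<Rightarrow> real) \<Rightarrow> real \<Rightarrow> ('d::finite \<Rightarrow> real) \<Rightarrow> 'd history \<Rightarrow> nat \<Rightarrow> 'd \<Rightarrow> real"
where
  "rr_log_variance \<delta> M ls0 h 0 i = ls0 i"
| "rr_log_variance \<delta> M ls0 h (Suc b) i =
     (let ls = rr_log_variance \<delta> M ls0 h b i;
          r = acceptance_rate h i (Suc b)
      in max (- M) (min M
           (if n_proposals h i (Suc b) = 0 then ls
            else if r > 0.44 then ls + \<delta> (Suc b)
            else if r < 0.44 then ls - \<delta> (Suc b)
            else ls)))"

definition rr_variance ::
  "(nat \<Rightarrow> real) \<Rightarrow> real \<Rightarrow> ('d::finite \<Rightarrow> real) \<Rightarrow> nat \<Rightarrow> 'd history \<Rightarrow> 'd \<Rightarrow> real"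
where
  "rr_variance \<delta> M ls0 n h i = exp (rr_log_variance \<delta> M ls0 h ((n - 1) div 50) i)"

definition RR_kernel where
  "RR_kernel g C a \<delta> M ls0 \<alpha>0 x0 = adaptive_mwg g C a (rr_variance \<delta> M ls0) \<alpha>0 x0"

subsection \<open>The first iteration\<close>

lemma hst_variance_first: "hst_variance 1 h i = (2.4)\<^sup>2 * 0.05"
  by (simp add: hst_variance_def sample_variance_def)

lemma rr_variance_first: "rr_variance \<delta> M ls0 1 h i = exp (ls0 i)"
  by (simp add: rr_variance_def)

lemma prob_vector_selection_prob:
  assumes "\<And>i. a i \<noteq> 0" "\<And>i. \<sigma>2 i > 0"
  shows "prob_vector (selection_prob a \<sigma>2)"
proof -
  have pos: "sqrt (\<sigma>2 i * (a i)\<^sup>2) > 0" for i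
    using assms by simp
  then have "(\<Sum>k\<in>UNIV. sqrt (\<sigma>2 k * (a k)\<^sup>2)) > 0"
    by (intro sum_pos) auto
  then show ?thesis
    using pos unfolding prob_vector_def selection_prob_def
    by (auto simp: sum_divide_distrib[symmetric] less_imp_le simp del: real_sqrt_gt_0_iff
             intro!: divide_nonneg_nonneg)
qed

end

theory Submission
  imports Defs
begin

text \<open>
  Uniform ergodicity of the one-dimensional chain forces the support of \<open>g\<close> to be bounded, since in a
  fixed number of steps the chain moves only a bounded distance with high probability. Hence the
  adapted variances of both algorithms stay in a fixed interval \<open>[lo, hi]\<close> with \<open>0 < lo\<close>, and they change
  by a deterministic amount tending to 0 per iteration.

  On a bounded support, a coordinate update with any proposal variance in \<open>[lo, hi]\<close> dominates a fixed
  multiple of the update with the proposal of the one-dimensional chain: moves have comparable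
  densities, and rejections always have probability bounded away from 0. Running the one-dimensional
  chain for \<open>n\<close> steps in each coordinate in turn nearly samples from \<open>\<pi>\<close>, so the Dobrushin coefficients
  of some power of all kernels with fixed variances in \<open>[lo, hi]\<close> are bounded by a common \<open>r < 1\<close>. All
  these kernels leave \<open>\<pi>\<close> invariant. Finally, over a window of fixed length the adaptive chain is
  close to the chain whose variances are frozen at the start of the window.
\<close>

section \<open>Powers of Markov kernels\<close>

text \<open>One accepted move changes one coordinate, and \<open>g\<close> has no lower bound on its
  support, so no explicit small set is at hand; the only mixing information is the one-dimensional
  chain itself. Hence it serves as the comparison kernel, coordinate by coordinate. With
  \<open>n\<close> steps for each entry of a list of \<open>d\<close> coordinates it is within
  \<open>d * \<eta>\<close> of \<pi>. Since every step of the sampler dominates \<open>c\<close>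
  times any chosen coordinate step, \<open>N = n * d\<close> steps dominate \<open>c ^ N\<close>
  times the comparison kernel. This is a lower bound by \<pi> with an additive defect, not by a
  measure; if \<open>d * \<eta> \<le> 1/4\<close>, testing it on \<open>u\<close> and on
  \<open>1 - u\<close> still gives the Dobrushin coefficient \<open>1 - c ^ N / 2\<close>. The order
  of choices matters: \<open>n\<close>, \<open>c\<close> and \<open>N\<close> do not depend on the
  variances within [lo, hi], so the rate is common to all frozen kernels; the window length is fixed
  next, and the drift per iteration is made small relative to it last. Kernels on the
  high-dimensional space are treated as operators on functions with values in [0, 1], so that each
  comparison is an inequality between integrals.\<close>

lemma measurable_kernel_power:
  assumes P: "P \<in> M \<rightarrow>\<^sub>M prob_algebra M" and "sets N = sets M"
  shows "kernel_power N P n \<in> M \<rightarrow>\<^sub>M prob_algebra M"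
proof (induction n)
  case 0
  have "kernel_power N P 0 = return M"
    using return_sets_cong[OF assms(2)] by (auto simp: fun_eq_iff)
  then show ?case by simp
next
  case (Suc n)
  show ?case
    using measurable_bind_prob_space[OF Suc P] by simp
qed

lemma nn_integral_kernel_power_0:
  assumes "sets N = sets M" "x \<in> space M" "f \<in> borel_measurable M"
  shows "(\<integral>\<^sup>+y. f y \<partial>kernel_power N P 0 x) = f x"
  using assms by (simp add: return_cong[OF assms(1)] nn_integral_return)

text \<open>Conditions on the last step. The first argument of \<open>kernel_power\<close> enters
  only through the \<open>return\<close> of step 0, so it may be any \<open>N\<close> with the same
  sets as \<open>M\<close>: the ergodicity hypothesis puts the target there, the sampler below
  \<open>borel\<close>.\<close>

lemma nn_integral_kernel_power_Suc:
  assumes P: "P \<in> M \<rightarrow>\<^sub>M prob_algebra M" and "sets N = sets M" and x: "x \<in> space M"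
    and f: "f \<in> borel_measurable M"
  shows "(\<integral>\<^sup>+y. f y \<partial>kernel_power N P (Suc n) x) = (\<integral>\<^sup>+y. (\<integral>\<^sup>+z. f z \<partial>P y) \<partial>kernel_power N P n x)"
proof -
  have "kernel_power N P n x \<in> space (prob_algebra M)"
    using measurable_space[OF measurable_kernel_power[OF P assms(2)] x] .
  then have "sets (kernel_power N P n x) = sets M" by (simp add: space_prob_algebra)
  then have "P \<in> kernel_power N P n x \<rightarrow>\<^sub>M subprob_algebra M"
    using measurable_prob_algebraD[OF P] by (simp cong: measurable_cong_sets)
  from nn_integral_bind[OF f this] show ?thesis by simp
qed

lemma prob_kernel:
  assumes "P \<in> M \<rightarrow>\<^sub>M prob_algebra N" "x \<in> space M"
  shows "prob_space (P x)" "sets (P x) = sets N" "space (P x) = space N"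
  using measurable_space[OF assms] sets_eq_imp_space_eq by (auto simp: space_prob_algebra)

lemma measurable_nn_integral_kernel:
  assumes "P \<in> M \<rightarrow>\<^sub>M prob_algebra N" "f \<in> borel_measurable N"
  shows "(\<lambda>x. \<integral>\<^sup>+y. f y \<partial>P x) \<in> borel_measurable M"
  using measurable_compose[OF measurable_prob_algebraD[OF assms(1)]
      nn_integral_measurable_subprob_algebra[OF assms(2)]] by simp

text \<open>Chapman-Kolmogorov. The recursion of \<open>kernel_power\<close> appends steps at the
  end, whereas the induction over a list of coordinates has to split off a block at the
  front.\<close>

lemma kernel_power_add:
  assumes P: "P \<in> M \<rightarrow>\<^sub>M prob_algebra M" and x: "x \<in> space M"
  shows "kernel_power M P (m + n) x = kernel_power M P m x \<bind> kernel_power M P n"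
proof (induction n)
  case 0
  have "sets (kernel_power M P m x) = sets M"
    by (rule prob_kernel[OF measurable_kernel_power[OF P refl] x])
  then have "kernel_power M P m x \<bind> return M = kernel_power M P m x"
    by (rule bind_return'')
  moreover have "kernel_power M P 0 = return M" by (auto simp: fun_eq_iff)
  ultimately show ?case by simp
next
  case (Suc n)
  have s: "sets (kernel_power M P m x) = sets M"
    by (rule prob_kernel[OF measurable_kernel_power[OF P refl] x])
  have "kernel_power M P n \<in> kernel_power M P m x \<rightarrow>\<^sub>M subprob_algebra M"
    using measurable_prob_algebraD[OF measurable_kernel_power[OF P refl]] s
    by (simp cong: measurable_cong_sets)
  from bind_assoc[OF this measurable_prob_algebraD[OF P]] Suc
  have "kernel_power M P (m + Suc n) x = kernel_power M P m x \<bind> (\<lambda>y. kernel_power M P n y \<bind> P)"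
    by simp
  also have "(\<lambda>y. kernel_power M P n y \<bind> P) = kernel_power M P (Suc n)"
    by (simp add: fun_eq_iff)
  finally show ?case .
qed

lemma nn_integral_kernel_power_add:
  assumes P: "P \<in> M \<rightarrow>\<^sub>M prob_algebra M" and x: "x \<in> space M" and f: "f \<in> borel_measurable M"
  shows "(\<integral>\<^sup>+y. f y \<partial>kernel_power M P (m + n) x) =
    (\<integral>\<^sup>+y. (\<integral>\<^sup>+z. f z \<partial>kernel_power M P n y) \<partial>kernel_power M P m x)"
proof -
  have s: "sets (kernel_power M P m x) = sets M"
    by (rule prob_kernel[OF measurable_kernel_power[OF P refl] x])
  have "kernel_power M P n \<in> kernel_power M P m x \<rightarrow>\<^sub>M subprob_algebra M"
    using measurable_prob_algebraD[OF measurable_kernel_power[OF P refl]] s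
    by (simp cong: measurable_cong_sets)
  from nn_integral_bind[OF f this] show ?thesis by (simp add: kernel_power_add[OF P x])
qed

lemma kernel_power_mult:
  assumes P: "P \<in> M \<rightarrow>\<^sub>M prob_algebra M" and x: "x \<in> space M"
  shows "kernel_power M (kernel_power M P m) k x = kernel_power M P (k * m) x"
proof (induction k)
  case (Suc k)
  then show ?case
    using kernel_power_add[OF P x, of "k * m" m] by (simp add: add.commute)
qed simp

lemma AE_kernel_power:
  assumes P: "P \<in> M \<rightarrow>\<^sub>M prob_algebra M" and sN: "sets N = sets M" and T[measurable]: "T \<in> sets M"
    and abs: "\<And>x. x \<in> T \<Longrightarrow> AE y in P x. y \<in> T" and x: "x \<in> T"
  shows "AE y in kernel_power N P n x. y \<in> T"
proof (induction n)
  case 0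
  have "x \<in> space M" using x T sets.sets_into_space by blast
  then have "(AE y in return M x. y \<in> T) \<longleftrightarrow> x \<in> T" by (rule AE_return) simp
  then show ?case using x unfolding kernel_power.simps return_cong[OF sN] by blast
next
  case (Suc n)
  have xM: "x \<in> space M" using x T sets.sets_into_space by blast
  have "sets (kernel_power N P n x) = sets M"
    by (rule prob_kernel[OF measurable_kernel_power[OF P sN] xM])
  then have P': "P \<in> kernel_power N P n x \<rightarrow>\<^sub>M subprob_algebra M"
    using measurable_prob_algebraD[OF P] by (simp cong: measurable_cong_sets)
  have "(AE y in kernel_power N P (Suc n) x. y \<in> T) \<longleftrightarrow>
      (AE y in kernel_power N P n x. AE z in P y. z \<in> T)"
    unfolding kernel_power.simps by (rule AE_bind[OF P']) measurable
  moreover have "AE y in kernel_power N P n x. AE z in P y. z \<in> T"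
    using Suc by eventually_elim (rule abs)
  ultimately show ?case by blast
qed

lemma nn_integral_stationary_kernel_power:
  assumes P: "P \<in> M \<rightarrow>\<^sub>M prob_algebra M" and mu: "sets \<mu> = sets M"
    and stat: "\<And>f. f \<in> borel_measurable M \<Longrightarrow> (\<integral>\<^sup>+x. (\<integral>\<^sup>+y. f y \<partial>P x) \<partial>\<mu>) = (\<integral>\<^sup>+x. f x \<partial>\<mu>)"
    and f: "f \<in> borel_measurable M"
  shows "(\<integral>\<^sup>+x. (\<integral>\<^sup>+y. f y \<partial>kernel_power M P n x) \<partial>\<mu>) = (\<integral>\<^sup>+x. f x \<partial>\<mu>)"
  using f
proof (induction n arbitrary: f)
  case 0
  then show ?case
    using sets_eq_imp_space_eq[OF mu] by (auto intro!: nn_integral_cong simp: nn_integral_return)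
next
  case (Suc n)
  have "(\<integral>\<^sup>+x. (\<integral>\<^sup>+y. f y \<partial>kernel_power M P (Suc n) x) \<partial>\<mu>) =
      (\<integral>\<^sup>+x. (\<integral>\<^sup>+y. (\<integral>\<^sup>+z. f z \<partial>P y) \<partial>kernel_power M P n x) \<partial>\<mu>)"
    using sets_eq_imp_space_eq[OF mu]
    by (intro nn_integral_cong nn_integral_kernel_power_Suc[OF P refl _ Suc.prems]) auto
  also have "\<dots> = (\<integral>\<^sup>+y. (\<integral>\<^sup>+z. f z \<partial>P y) \<partial>\<mu>)"
    by (rule Suc.IH[OF measurable_nn_integral_kernel[OF P Suc.prems]])
  also have "\<dots> = (\<integral>\<^sup>+x. f x \<partial>\<mu>)" by (rule stat[OF Suc.prems])
  finally show ?case .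
qed

lemma (in prob_space) integrable_01:
  fixes u :: "'a \<Rightarrow> real"
  assumes "u \<in> borel_measurable M" "\<And>x. 0 \<le> u x" "\<And>x. u x \<le> 1"
  shows "integrable M u"
  by (rule integrable_const_bound[where B=1]) (use assms in auto)

text \<open>Rescaling \<open>y \<mapsto> \<integral>u \<partial>K y\<close> to \<open>[0, 1]\<close> on \<open>T\<close> turns a bound \<open>r\<close> on the Dobrushin coefficient of \<open>K\<close>
  into the bound \<open>r ^ k\<close> for its \<open>k\<close>-th power.\<close>

lemma dobrushin_contraction:
  fixes u :: "'a \<Rightarrow> real"
  assumes K: "K \<in> M \<rightarrow>\<^sub>M prob_algebra M" and T[measurable]: "T \<in> sets M"
    and abs: "\<And>x. x \<in> T \<Longrightarrow> AE y in K x. y \<in> T"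
    and r: "0 \<le> r"
    and contr: "\<And>u :: 'a \<Rightarrow> real. \<And>x y. u \<in> borel_measurable M \<Longrightarrow> (\<And>z. 0 \<le> u z) \<Longrightarrow> (\<And>z. u z \<le> 1) \<Longrightarrow>
       x \<in> T \<Longrightarrow> y \<in> T \<Longrightarrow> (\<integral>z. u z \<partial>K x) \<le> (\<integral>z. u z \<partial>K y) + r"
    and u: "u \<in> borel_measurable M" "\<And>z. 0 \<le> u z" "\<And>z. u z \<le> 1"
    and x: "x \<in> T" and y: "y \<in> T"
  shows "(\<integral>z. u z \<partial>kernel_power M K k x) \<le> (\<integral>z. u z \<partial>kernel_power M K k y) + r ^ k"
  using u
proof (induction k arbitrary: u)
  case 0
  have "x \<in> space M" "y \<in> space M" using x y T sets.sets_into_space by blast+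
  then show ?case using 0(2)[of y] 0(3)[of x] by (simp add: integral_return 0(1))
next
  case (Suc k)
  note [measurable] = Suc.prems(1)
  have sp: "z \<in> space M" if "z \<in> T" for z using that T sets.sets_into_space by blast
  define H where "H = (\<lambda>z. \<integral>w. u w \<partial>K z)"
  have pK: "prob_space (K z)" "sets (K z) = sets M" if "z \<in> space M" for z
    using prob_kernel[OF K that] by auto
  have Hm[measurable]: "H \<in> borel_measurable M"
    unfolding H_def
    by (rule measurable_compose[OF measurable_prob_algebraD[OF K] integral_measurable_subprob_algebra]) simp
  have H01: "0 \<le> H z \<and> H z \<le> 1" if "z \<in> space M" for z
  proof -
    interpret prob_space "K z" by (rule pK[OF that])
    have um: "u \<in> borel_measurable (K z)" using Suc.prems(1) pK(2)[OF that] by (simp cong: measurable_cong_sets)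
    have "H z \<le> (\<integral>w. 1 \<partial>K z)" unfolding H_def
      by (rule integral_mono[OF integrable_01[OF um]]) (use Suc.prems in auto)
    moreover have "0 \<le> H z" unfolding H_def by (rule integral_nonneg_AE) (use Suc.prems in auto)
    ultimately show ?thesis by (simp add: prob_space)
  qed
  define a where "a = (INF z\<in>T. H z)"
  have bdd: "bdd_below (H ` T)" using H01 sp by (intro bdd_belowI[of _ 0]) auto
  \<comment> \<open>On \<open>T\<close> the oscillation bound puts \<open>(H z - a) / r\<close> into
    [0, 1], so the truncation acts only off \<open>T\<close>, which the chain avoids almost surely.
    For \<open>r = 0\<close> the quotient is 0 by convention and \<open>H\<close> is constant on
    \<open>T\<close>.\<close>
  define v where "v = (\<lambda>z. max 0 (min 1 ((H z - a) / r)))"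
  have vm[measurable]: "v \<in> borel_measurable M" unfolding v_def by measurable
  have v01: "0 \<le> v z" "v z \<le> 1" for z by (auto simp: v_def)
  have Hv: "H z = a + r * v z" if z: "z \<in> T" for z
  proof -
    have "a \<le> H z" unfolding a_def by (rule cINF_lower[OF bdd z])
    moreover have "H z - r \<le> a" unfolding a_def
    proof (rule cINF_greatest)
      show "T \<noteq> {}" using z by auto
      fix w assume "w \<in> T"
      from contr[OF Suc.prems z this] show "H z - r \<le> H w" by (simp add: H_def)
    qed
    ultimately show ?thesis using r by (cases "r = 0") (auto simp: v_def field_simps min_def max_def)
  qed
  have eq: "(\<integral>w. u w \<partial>kernel_power M K (Suc k) z) = a + r * (\<integral>w. v w \<partial>kernel_power M K k z)"
    if z: "z \<in> T" for z
  proof -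
    let ?N = "kernel_power M K k z"
    have N: "prob_space ?N" "sets ?N = sets M"
      using prob_kernel[OF measurable_kernel_power[OF K refl] sp[OF z]] by auto
    interpret prob_space ?N by (rule N)
    have Km: "K \<in> ?N \<rightarrow>\<^sub>M subprob_algebra M"
      using measurable_prob_algebraD[OF K] N(2) by (simp cong: measurable_cong_sets)
    have "ennreal (\<integral>w. u w \<partial>kernel_power M K (Suc k) z) = (\<integral>\<^sup>+w. u w \<partial>kernel_power M K (Suc k) z)"
    proof -
      have N': "prob_space (kernel_power M K (Suc k) z)" "sets (kernel_power M K (Suc k) z) = sets M"
        by (rule prob_kernel[OF measurable_kernel_power[OF K refl] sp[OF z]])+
      have um: "u \<in> borel_measurable (kernel_power M K (Suc k) z)"
        using Suc.prems(1) N'(2) by (simp cong: measurable_cong_sets)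
      show ?thesis
        by (rule nn_integral_eq_integral[symmetric, OF prob_space.integrable_01[OF N'(1) um]])
          (use Suc.prems in auto)
    qed
    also have "\<dots> = (\<integral>\<^sup>+y. (\<integral>\<^sup>+w. u w \<partial>K y) \<partial>?N)"
      by (rule nn_integral_kernel_power_Suc[OF K refl sp[OF z]]) simp
    also have "\<dots> = (\<integral>\<^sup>+y. H y \<partial>?N)"
    proof (rule nn_integral_cong)
      fix y assume "y \<in> space ?N"
      then have yM: "y \<in> space M" using sets_eq_imp_space_eq[OF N(2)] by simp
      have um: "u \<in> borel_measurable (K y)"
        using Suc.prems(1) pK(2)[OF yM] by (simp cong: measurable_cong_sets)
      show "(\<integral>\<^sup>+w. u w \<partial>K y) = ennreal (H y)" unfolding H_def
        by (rule nn_integral_eq_integral[OF prob_space.integrable_01[OF pK(1)[OF yM] um]])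
          (use Suc.prems in auto)
    qed
    also have "\<dots> = (\<integral>\<^sup>+y. ennreal (a + r * v y) \<partial>?N)"
      using AE_kernel_power[OF K refl T abs z, of k]
      by (intro nn_integral_cong_AE) (auto simp: Hv elim!: eventually_mono)
    also have "\<dots> = ennreal (\<integral>y. a + r * v y \<partial>?N)"
    proof (rule nn_integral_eq_integral)
      have a0: "0 \<le> a" unfolding a_def using z H01 sp by (intro cINF_greatest) auto
      show "AE y in ?N. 0 \<le> a + r * v y" using a0 r v01 by auto
      have "v \<in> borel_measurable ?N" using vm N(2) by (simp cong: measurable_cong_sets)
      then have "integrable ?N v" by (rule integrable_01[OF _ v01])
      then show "integrable ?N (\<lambda>y. a + r * v y)" by auto
    qed
    also have "(\<integral>y. a + r * v y \<partial>?N) = a + r * (\<integral>w. v w \<partial>?N)"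
    proof -
      have "v \<in> borel_measurable ?N" using vm N(2) by (simp cong: measurable_cong_sets)
      then have "integrable ?N v" by (rule integrable_01[OF _ v01])
      then show ?thesis by (simp add: prob_space)
    qed
    finally have "ennreal (\<integral>w. u w \<partial>kernel_power M K (Suc k) z) = ennreal (a + r * (\<integral>w. v w \<partial>?N))" .
    moreover have "0 \<le> a" unfolding a_def using z H01 sp by (intro cINF_greatest) auto
    moreover have "0 \<le> (\<integral>w. v w \<partial>?N)" by (rule integral_nonneg_AE) (use v01 in auto)
    moreover have "0 \<le> (\<integral>w. u w \<partial>kernel_power M K (Suc k) z)"
      by (rule integral_nonneg_AE) (use Suc.prems in auto)
    ultimately show ?thesis using r by (subst (asm) ennreal_inj) auto
  qed
  have "r * (\<integral>w. v w \<partial>kernel_power M K k x) \<le> r * ((\<integral>w. v w \<partial>kernel_power M K k y) + r ^ k)"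
    using Suc.IH[OF vm v01] r by (rule mult_left_mono)
  then show ?case unfolding eq[OF x] eq[OF y] by (simp add: algebra_simps)
qed

section \<open>Total variation and functions with values in [0, 1]\<close>

lemma abs_measure_diff_le_tv_dist:
  assumes "prob_space M" "prob_space N" "A \<in> sets M"
  shows "\<bar>measure M A - measure N A\<bar> \<le> tv_dist M N"
  unfolding tv_dist_def
proof (rule cSUP_upper[OF assms(3)])
  have "\<bar>measure M A - measure N A\<bar> \<le> 1" for A
    using prob_space.prob_le_1[OF assms(1), of A] prob_space.prob_le_1[OF assms(2), of A]
      measure_nonneg[of M A] measure_nonneg[of N A] by linarith
  then show "bdd_above ((\<lambda>A. \<bar>measure M A - measure N A\<bar>) ` sets M)"
    by (intro bdd_aboveI[of _ 1]) auto
qed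

lemma emeasure_le_add_tv_dist:
  assumes "prob_space M" "prob_space N" "A \<in> sets M"
  shows "emeasure N A \<le> emeasure M A + ennreal (tv_dist M N)"
proof -
  interpret M: prob_space M by fact
  interpret N: prob_space N by fact
  have *: "\<bar>measure M A - measure N A\<bar> \<le> tv_dist M N"
    by (rule abs_measure_diff_le_tv_dist[OF assms])
  then have "measure N A \<le> measure M A + tv_dist M N" by linarith
  moreover have "0 \<le> tv_dist M N" using * abs_ge_zero order_trans by blast
  ultimately show ?thesis
    by (simp add: M.emeasure_eq_measure N.emeasure_eq_measure ennreal_plus[symmetric] del: ennreal_plus)
qed

text \<open>\<open>tv_dist\<close> controls events only. A function with values in [0, 1] is the
  average over the levels \<open>t\<close> in [0, 1] of the indicators of its superlevel sets, so a
  bound for events passes to functions without losing a factor.\<close>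

lemma nn_integral_eq_layer_cake:
  assumes M: "prob_space M" and f: "f \<in> borel_measurable M" and f1: "\<And>x. f x \<le> (1::ennreal)"
  shows "(\<integral>\<^sup>+x. f x \<partial>M) = (\<integral>\<^sup>+t. emeasure M {x\<in>space M. ennreal t < f x} * indicator {0..1} t \<partial>lborel)"
proof -
  interpret prob_space M by fact
  interpret pair_sigma_finite M lborel ..
  note [measurable] = f
  have 1: "(\<integral>\<^sup>+t. indicator {t. 0 \<le> t \<and> ennreal t < f x} (t::real) \<partial>lborel) = f x" for x
  proof -
    obtain c where c: "f x = ennreal c" "0 \<le> c"
      using f1[of x] by (cases "f x") (auto simp: top_unique)
    have "{t. 0 \<le> t \<and> ennreal t < f x} = {0..<c}" using c by (auto simp: ennreal_less_iff)
    then show ?thesis using c by simp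
  qed
  have "(\<integral>\<^sup>+x. f x \<partial>M) = (\<integral>\<^sup>+x. (\<integral>\<^sup>+t. indicator {t. 0 \<le> t \<and> ennreal t < f x} (t::real) \<partial>lborel) \<partial>M)"
    by (simp add: 1)
  also have "\<dots> = (\<integral>\<^sup>+t. (\<integral>\<^sup>+x. indicator {t. 0 \<le> t \<and> ennreal t < f x} (t::real) \<partial>M) \<partial>lborel)"
    by (rule Fubini'[symmetric]) (simp add: indicator_def)
  also have "\<dots> = (\<integral>\<^sup>+t. emeasure M {x\<in>space M. ennreal t < f x} * indicator {0..1} t \<partial>lborel)"
  proof (rule nn_integral_cong)
    fix t :: real
    have "(\<integral>\<^sup>+x. indicator {t. 0 \<le> t \<and> ennreal t < f x} t \<partial>M) =
        (\<integral>\<^sup>+x. indicator {x\<in>space M. ennreal t < f x} x * indicator {0..1} t \<partial>M)"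
    proof (rule nn_integral_cong)
      fix x assume "x \<in> space M"
      have "t \<le> 1" if "ennreal t < f x"
        using less_le_trans[OF that f1] by (simp add: ennreal_less_one_iff)
      then show "indicator {t. 0 \<le> t \<and> ennreal t < f x} t =
          (indicator {x\<in>space M. ennreal t < f x} x * indicator {0..1} t :: ennreal)"
        using \<open>x \<in> space M\<close> by (auto split: split_indicator)
    qed
    also have "\<dots> = emeasure M {x\<in>space M. ennreal t < f x} * indicator {0..1} t"
      by (simp add: nn_integral_multc)
    finally show "(\<integral>\<^sup>+x. indicator {t. 0 \<le> t \<and> ennreal t < f x} t \<partial>M) =
      emeasure M {x\<in>space M. ennreal t < f x} * indicator {0..1} t" .
  qed
  finally show ?thesis .
qed

lemma nn_integral_le_add_tv_dist:
  assumes M: "prob_space M" and N: "prob_space N" and s: "sets M = sets N"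
    and f: "f \<in> borel_measurable M" and f1: "\<And>x. f x \<le> (1::ennreal)"
    and tv: "tv_dist M N \<le> \<eta>"
  shows "(\<integral>\<^sup>+x. f x \<partial>N) \<le> (\<integral>\<^sup>+x. f x \<partial>M) + ennreal \<eta>"
proof -
  interpret M: prob_space M by fact
  interpret pair_sigma_finite M lborel ..
  note [measurable] = f
  have fN: "f \<in> borel_measurable N" using f s by (simp cong: measurable_cong_sets)
  have sp: "space M = space N" by (rule sets_eq_imp_space_eq[OF s])
  have "(\<integral>\<^sup>+x. f x \<partial>N) = (\<integral>\<^sup>+t. emeasure N {x\<in>space N. ennreal t < f x} * indicator {0..1} t \<partial>lborel)"
    by (rule nn_integral_eq_layer_cake[OF N fN f1])
  also have "\<dots> \<le> (\<integral>\<^sup>+t. emeasure M {x\<in>space M. ennreal t < f x} * indicator {0..1::real} t +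
      ennreal \<eta> * indicator {0..1} t \<partial>lborel)"
  proof (rule nn_integral_mono)
    fix t :: real
    have "{x\<in>space M. ennreal t < f x} \<in> sets M" by measurable
    from emeasure_le_add_tv_dist[OF M N this]
    have "emeasure N {x\<in>space N. ennreal t < f x} \<le> emeasure M {x\<in>space M. ennreal t < f x} + ennreal \<eta>"
      using tv ennreal_leI[OF tv] by (auto simp: sp intro: order_trans add_left_mono)
    then show "emeasure N {x\<in>space N. ennreal t < f x} * indicator {0..1} t \<le>
      emeasure M {x\<in>space M. ennreal t < f x} * indicator {0..1} t + ennreal \<eta> * indicator {0..1} t"
      by (auto split: split_indicator)
  qed
  also have "\<dots> = (\<integral>\<^sup>+t. emeasure M {x\<in>space M. ennreal t < f x} * indicator {0..1::real} t \<partial>lborel) + ennreal \<eta>"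
  proof -
    have "(\<lambda>t. emeasure M {x\<in>space M. ennreal t < f x}) \<in> borel_measurable (lborel :: real measure)"
    proof -
      have "(\<lambda>t. \<integral>\<^sup>+x. indicator {x\<in>space M. ennreal t < f x} x \<partial>M) \<in> borel_measurable (lborel :: real measure)"
        by (simp add: indicator_def)
      then show ?thesis by (simp cong: measurable_cong)
    qed
    then show ?thesis by (subst nn_integral_add) (auto simp: nn_integral_cmult)
  qed
  also have "(\<integral>\<^sup>+t. emeasure M {x\<in>space M. ennreal t < f x} * indicator {0..1::real} t \<partial>lborel) = (\<integral>\<^sup>+x. f x \<partial>M)"
    by (rule nn_integral_eq_layer_cake[OF M f f1, symmetric])
  finally show ?thesis .
qed

section \<open>Measurable families of elementary distributions\<close>

text \<open>The parameters are functions on a measurable space because adapted variances are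
  functions of the history; fixed parameters are a special case. The same holds for the next two
  families.\<close>

lemma measurable_normal_kernel:
  assumes [measurable]: "m \<in> borel_measurable N" "s \<in> borel_measurable N"
    and s: "\<And>w. w \<in> space N \<Longrightarrow> 0 < s w"
  shows "(\<lambda>w. density lborel (normal_density (m w) (s w))) \<in> N \<rightarrow>\<^sub>M prob_algebra borel"
proof (intro measurable_prob_algebraI measurable_subprob_algebra)
  fix w assume "w \<in> space N"
  then show "prob_space (density lborel (normal_density (m w) (s w)))"
    by (intro prob_space_normal_density s)
  then show "subprob_space (density lborel (normal_density (m w) (s w)))"
    by (rule prob_space_imp_subprob_space)
next
  fix A :: "real set" assume [measurable]: "A \<in> sets borel"
  have "(\<lambda>w. \<integral>\<^sup>+y. ennreal (normal_density (m w) (s w) y) * indicator A y \<partial>lborel) \<in> borel_measurable N"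
    unfolding normal_density_def by measurable
  then show "(\<lambda>w. emeasure (density lborel (normal_density (m w) (s w))) A) \<in> borel_measurable N"
    by (simp add: emeasure_density)
qed simp

lemma measurable_bernoulli_kernel:
  assumes [measurable]: "p \<in> borel_measurable N" and p: "\<And>w. 0 \<le> p w" "\<And>w. p w \<le> 1"
  shows "(\<lambda>w. measure_pmf (bernoulli_pmf (p w))) \<in> N \<rightarrow>\<^sub>M prob_algebra (count_space UNIV)"
proof (intro measurable_prob_algebraI measurable_subprob_algebra)
  fix A :: "bool set"
  have "emeasure (measure_pmf (bernoulli_pmf (p w))) A =
      indicator A True * ennreal (p w) + indicator A False * ennreal (1 - p w)" for w
    using p by (simp add: nn_integral_indicator[symmetric] del: nn_integral_indicator)
  then show "(\<lambda>w. emeasure (measure_pmf (bernoulli_pmf (p w))) A) \<in> borel_measurable N"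
    by simp
qed (auto intro: measure_pmf.prob_space_axioms measure_pmf.subprob_space_axioms)

lemma emeasure_point_measure_finite_UNIV:
  "emeasure (point_measure UNIV f) A = (\<Sum>i\<in>A. f (i::'d::finite))"
  by (rule emeasure_point_measure_finite) auto

lemma prob_space_point_measure_prob_vector:
  fixes \<alpha> :: "'d::finite \<Rightarrow> real"
  assumes "prob_vector \<alpha>"
  shows "prob_space (point_measure UNIV (\<lambda>i. ennreal (\<alpha> i)))"
  using assms by (intro prob_spaceI)
    (simp add: emeasure_point_measure_finite_UNIV prob_vector_def sum_ennreal space_point_measure)

lemma measurable_point_measure_kernel:
  fixes \<alpha> :: "'w \<Rightarrow> 'd::finite \<Rightarrow> real"
  assumes [measurable]: "\<And>i. (\<lambda>w. \<alpha> w i) \<in> borel_measurable N"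
    and p: "\<And>w. w \<in> space N \<Longrightarrow> prob_vector (\<alpha> w)"
  shows "(\<lambda>w. point_measure UNIV (\<lambda>i. ennreal (\<alpha> w i))) \<in> N \<rightarrow>\<^sub>M prob_algebra (count_space UNIV)"
proof (intro measurable_prob_algebraI measurable_subprob_algebra)
  fix w assume "w \<in> space N"
  then show "prob_space (point_measure UNIV (\<lambda>i. ennreal (\<alpha> w i)))"
    by (intro prob_space_point_measure_prob_vector p)
  then show "subprob_space (point_measure UNIV (\<lambda>i. ennreal (\<alpha> w i)))"
    by (rule prob_space_imp_subprob_space)
qed (simp_all add: emeasure_point_measure_finite_UNIV sets_point_measure)

lemma measurable_pair_finite2:
  fixes f :: "'a \<Rightarrow> 'b::finite \<Rightarrow> 'c"
  assumes "\<And>b. (\<lambda>x. f x b) \<in> M \<rightarrow>\<^sub>M N"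
  shows "(\<lambda>(x, b). f x b) \<in> M \<Otimes>\<^sub>M count_space UNIV \<rightarrow>\<^sub>M N"
proof -
  have "(\<lambda>z. f (fst z) (snd z)) \<in> M \<Otimes>\<^sub>M count_space UNIV \<rightarrow>\<^sub>M N"
    by (rule measurable_compose_countable'[where I=UNIV and f="\<lambda>b z. f (fst z) b" and g=snd])
      (auto intro: measurable_compose[OF measurable_fst assms] countable_finite)
  then show ?thesis by (simp add: split_beta')
qed

text \<open>The shape shared by the one-dimensional step and by a coordinate update together with
  its record: propose, toss a coin, then map the outcome deterministically through
  \<open>h\<close>.\<close>

lemma nn_integral_accept_reject:
  assumes p: "p \<in> borel_measurable Q" "\<And>y. 0 \<le> p y" "\<And>y. p y \<le> 1"
    and h: "\<And>b. h b \<in> Q \<rightarrow>\<^sub>M N" and f: "f \<in> borel_measurable N"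
  shows "(\<integral>\<^sup>+z. f z \<partial>(Q \<bind> (\<lambda>y. measure_pmf (bernoulli_pmf (p y)) \<bind> (\<lambda>b. return N (h b y))))) =
    (\<integral>\<^sup>+y. f (h True y) * ennreal (p y) + f (h False y) * ennreal (1 - p y) \<partial>Q)"
proof -
  note [measurable] = p(1) h f
  have [measurable]: "(\<lambda>(y, b). h b y) \<in> Q \<Otimes>\<^sub>M count_space UNIV \<rightarrow>\<^sub>M N"
    by (rule measurable_pair_finite2) auto
  have 1: "(\<lambda>y. measure_pmf (bernoulli_pmf (p y)) \<bind> (\<lambda>b. return N (h b y))) \<in> Q \<rightarrow>\<^sub>M subprob_algebra N"
    by (intro measurable_prob_algebraD measurable_bind_prob_space2[OF measurable_bernoulli_kernel[OF p]])
      (simp add: split_beta')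
  have "(\<integral>\<^sup>+z. f z \<partial>(measure_pmf (bernoulli_pmf (p y)) \<bind> (\<lambda>b. return N (h b y)))) =
      f (h True y) * ennreal (p y) + f (h False y) * ennreal (1 - p y)" if y: "y \<in> space Q" for y
  proof -
    have hN: "h b y \<in> space N" for b using measurable_space[OF h y] .
    have "(\<lambda>b. return N (h b y)) \<in> measure_pmf (bernoulli_pmf (p y)) \<rightarrow>\<^sub>M subprob_algebra N"
      using hN by (auto simp: space_subprob_algebra prob_space_return prob_space_imp_subprob_space)
    from nn_integral_bind[OF f this] show ?thesis
      using p hN by (simp add: nn_integral_return)
  qed
  then show ?thesis
    by (subst nn_integral_bind[OF f 1]) (auto intro!: nn_integral_cong)
qed

lemma measurable_accept_reject:
  assumes Q: "Q \<in> M \<rightarrow>\<^sub>M prob_algebra L"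
    and p: "(\<lambda>(w, y). p w y) \<in> borel_measurable (M \<Otimes>\<^sub>M L)" "\<And>w y. 0 \<le> p w y" "\<And>w y. p w y \<le> 1"
    and h: "\<And>b. (\<lambda>(w, y). h w b y) \<in> M \<Otimes>\<^sub>M L \<rightarrow>\<^sub>M N"
  shows "(\<lambda>w. Q w \<bind> (\<lambda>y. measure_pmf (bernoulli_pmf (p w y)) \<bind> (\<lambda>b. return N (h w b y))))
    \<in> M \<rightarrow>\<^sub>M prob_algebra N"
proof (rule measurable_bind_prob_space2[OF Q])
  have "(\<lambda>(z, b). h (fst z) b (snd z)) \<in> (M \<Otimes>\<^sub>M L) \<Otimes>\<^sub>M count_space UNIV \<rightarrow>\<^sub>M N"
    using h by (intro measurable_pair_finite2) (auto simp: split_beta')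
  then have 1: "(\<lambda>(z, b). return N (h (fst z) b (snd z))) \<in>
      (M \<Otimes>\<^sub>M L) \<Otimes>\<^sub>M count_space UNIV \<rightarrow>\<^sub>M prob_algebra N"
    using measurable_compose[OF _ measurable_return_prob_space] by (simp add: split_beta')
  have "(\<lambda>z. measure_pmf (bernoulli_pmf (p (fst z) (snd z))) \<bind> (\<lambda>b. return N (h (fst z) b (snd z))))
    \<in> M \<Otimes>\<^sub>M L \<rightarrow>\<^sub>M prob_algebra N"
    using p by (intro measurable_bind_prob_space2[OF measurable_bernoulli_kernel 1]) (auto simp: split_beta')
  then show "(\<lambda>(w, y). measure_pmf (bernoulli_pmf (p w y)) \<bind> (\<lambda>b. return N (h w b y)))
    \<in> M \<Otimes>\<^sub>M L \<rightarrow>\<^sub>M prob_algebra N"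
    by (simp add: split_beta')
qed

section \<open>Comparison of normal densities\<close>

lemma nn_integral_normal_density:
  "0 < s \<Longrightarrow> (\<integral>\<^sup>+y. ennreal (normal_density m s y) \<partial>lborel) = 1"
  using prob_space.emeasure_space_1[OF prob_space_normal_density[of s m]] by (simp add: emeasure_density)

lemma normal_density_symmetric: "normal_density x s y = normal_density y s x"
  by (simp add: normal_density_def power2_commute)

text \<open>Turns an update of coordinate \<open>i\<close> with standard deviation \<open>s\<close>
  into an update for \<open>g\<close> itself with standard deviation \<open>C i * s\<close>; the
  extra factor is the Jacobian.\<close>

lemma normal_density_scale:
  assumes "0 < c"
  shows "normal_density (c * x) (c * s) (c * y) * c = normal_density x s y"
proof -
  have "sqrt (2 * pi * (c * s)\<^sup>2) = c * sqrt (2 * pi * s\<^sup>2)"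
    using assms by (simp add: real_sqrt_mult real_sqrt_abs power_mult_distrib)
  moreover have "(c * y - c * x)\<^sup>2 / (2 * (c * s)\<^sup>2) = (y - x)\<^sup>2 / (2 * s\<^sup>2)"
    using assms by (simp add: right_diff_distrib[symmetric] power_mult_distrib)
  ultimately show ?thesis using assms by (simp add: normal_density_def)
qed

text \<open>Widening lowers the prefactor by exactly \<open>s / s'\<close> and can only raise the
  exponential factor.\<close>

lemma normal_density_mono_sd:
  assumes "0 < s" "s \<le> s'"
  shows "s / s' * normal_density m s y \<le> normal_density m s' y"
proof -
  have "s / s' * normal_density m s y = 1 / (s' * sqrt (2 * pi)) * exp (-(y - m)\<^sup>2 / (2 * s\<^sup>2))"
    using assms by (simp add: normal_density_def real_sqrt_mult)
  also have "\<dots> \<le> 1 / (s' * sqrt (2 * pi)) * exp (-(y - m)\<^sup>2 / (2 * s'\<^sup>2))"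
    using assms by (intro mult_left_mono) (auto intro!: divide_left_mono power_mono)
  also have "\<dots> = normal_density m s' y"
    using assms by (simp add: normal_density_def real_sqrt_mult)
  finally show ?thesis .
qed

lemma std_normal_density_le_1: "normal_density x 1 y \<le> 1"
proof -
  have "1 \<le> sqrt (2 * pi)" using pi_gt3 by (simp add: real_le_rsqrt)
  moreover have "exp (- (y - x)\<^sup>2 / 2) \<le> 1" by simp
  ultimately have "exp (- (y - x)\<^sup>2 / 2) / sqrt (2 * pi) \<le> 1 / 1"
    by (intro frac_le) auto
  then show ?thesis by (simp add: normal_density_def)
qed

text \<open>Lower bound for normal densities within distance \<open>L\<close> of the mean, common to
  all standard deviations in [lo, hi]: the exponential is taken at the smallest one and the
  prefactor at the largest.\<close>

definition minor_const :: "real \<Rightarrow> real \<Rightarrow> real \<Rightarrow> real" where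
  "minor_const lo hi L = exp (- L\<^sup>2 / (2 * lo\<^sup>2)) / (hi * sqrt (2 * pi))"

lemma minor_const_pos: "0 < hi \<Longrightarrow> 0 < minor_const lo hi L"
  by (simp add: minor_const_def)

lemma minor_const_le_normal_density:
  assumes "0 < lo" "lo \<le> s" "s \<le> hi" "\<bar>y - x\<bar> \<le> L"
  shows "minor_const lo hi L \<le> normal_density x s y"
proof -
  have "(y - x)\<^sup>2 \<le> L\<^sup>2" using assms(4) by (simp add: abs_le_square_iff[symmetric])
  then have "(y - x)\<^sup>2 / (2 * s\<^sup>2) \<le> L\<^sup>2 / (2 * lo\<^sup>2)"
    using assms by (intro frac_le) (auto intro: power_mono)
  then have e: "exp (- L\<^sup>2 / (2 * lo\<^sup>2)) \<le> exp (- (y - x)\<^sup>2 / (2 * s\<^sup>2))" by simp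
  have "normal_density x s y = exp (- (y - x)\<^sup>2 / (2 * s\<^sup>2)) / (s * sqrt (2 * pi))"
    using assms by (simp add: normal_density_def real_sqrt_mult mult.commute)
  also have "\<dots> \<ge> minor_const lo hi L"
    unfolding minor_const_def using assms e by (intro frac_le mult_right_mono) auto
  finally show ?thesis .
qed

text \<open>Far away from \<open>x\<close> every proposal is rejected, so there only the mass of the proposal counts.\<close>

lemma normal_minorization:
  fixes F :: "real \<Rightarrow> ennreal"
  assumes F[measurable]: "F \<in> borel_measurable borel" and D: "0 \<le> D"
    and far: "\<And>y. D < \<bar>y - x\<bar> \<Longrightarrow> F y = b" and lo: "0 < lo" "lo \<le> s" "s \<le> hi"
  shows "ennreal (minor_const lo hi (D + 1)) * (\<integral>\<^sup>+y. ennreal (normal_density x 1 y) * F y \<partial>lborel)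
    \<le> (\<integral>\<^sup>+y. ennreal (normal_density x s y) * F y \<partial>lborel)"
proof -
  define k where "k = minor_const lo hi (D + 1)"
  have k: "0 \<le> k" unfolding k_def using lo minor_const_pos[of hi lo "D + 1"] by simp
  define A where "A = {y. \<bar>y - x\<bar> \<le> D}"
  have [measurable]: "A \<in> sets borel" unfolding A_def by measurable
  have s: "0 < s" using lo by simp
  have split: "(\<integral>\<^sup>+y. ennreal (normal_density x t y) * F y \<partial>lborel) =
     (\<integral>\<^sup>+y. ennreal (normal_density x t y) * F y * indicator A y \<partial>lborel) +
     b * (\<integral>\<^sup>+y. ennreal (normal_density x t y) * indicator (-A) y \<partial>lborel)" for t
  proof -
    have "(\<integral>\<^sup>+y. ennreal (normal_density x t y) * F y \<partial>lborel) =
      (\<integral>\<^sup>+y. ennreal (normal_density x t y) * F y * indicator A y +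
        b * (ennreal (normal_density x t y) * indicator (-A) y) \<partial>lborel)"
      by (rule nn_integral_cong) (auto simp: A_def far not_le mult.commute split: split_indicator)
    then show ?thesis by (simp add: nn_integral_add nn_integral_cmult)
  qed
  have near: "ennreal k * (\<integral>\<^sup>+y. ennreal (normal_density x 1 y) * F y * indicator A y \<partial>lborel) \<le>
     (\<integral>\<^sup>+y. ennreal (normal_density x s y) * F y * indicator A y \<partial>lborel)"
  proof -
    have "ennreal k * (\<integral>\<^sup>+y. ennreal (normal_density x 1 y) * F y * indicator A y \<partial>lborel) =
      (\<integral>\<^sup>+y. ennreal k * (ennreal (normal_density x 1 y) * F y * indicator A y) \<partial>lborel)"
      by (simp add: nn_integral_cmult)
    also have "\<dots> \<le> (\<integral>\<^sup>+y. ennreal (normal_density x s y) * F y * indicator A y \<partial>lborel)"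
    proof (rule nn_integral_mono)
      fix y
      show "ennreal k * (ennreal (normal_density x 1 y) * F y * indicator A y)
         \<le> ennreal (normal_density x s y) * F y * indicator A y"
      proof (cases "y \<in> A")
        case True
        then have "k \<le> normal_density x s y"
          unfolding k_def A_def by (intro minor_const_le_normal_density lo) auto
        moreover have "k * normal_density x 1 y \<le> k * 1"
          using k by (intro mult_left_mono std_normal_density_le_1)
        ultimately have "k * normal_density x 1 y \<le> normal_density x s y" by simp
        then have "ennreal k * ennreal (normal_density x 1 y) * F y \<le> ennreal (normal_density x s y) * F y"
          using k by (intro mult_right_mono) (auto simp: ennreal_mult''[symmetric])
        then show ?thesis using True by (simp add: mult.assoc)
      qed simp
    qed
    finally show ?thesis .
  qed
  \<comment> \<open>The standard normal mass beyond \<open>D\<close> is at most 1, so it is enough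
    to exhibit mass \<open>k\<close> beyond \<open>D\<close> under the other proposal. The interval
    of length 1 next to \<open>A\<close> supplies it, which is why \<open>minor_const\<close> is
    taken at \<open>D + 1\<close>.\<close>
  have "ennreal k * (\<integral>\<^sup>+y. ennreal (normal_density x 1 y) * indicator (-A) y \<partial>lborel) \<le> ennreal k * 1"
  proof (rule mult_left_mono)
    have "(\<integral>\<^sup>+y. ennreal (normal_density x 1 y) * indicator (-A) y \<partial>lborel) \<le>
      (\<integral>\<^sup>+y. ennreal (normal_density x 1 y) \<partial>lborel)"
      by (rule nn_integral_mono) (auto split: split_indicator)
    then show "(\<integral>\<^sup>+y. ennreal (normal_density x 1 y) * indicator (-A) y \<partial>lborel) \<le> 1"
      by (simp add: nn_integral_normal_density)
  qed simp
  also have "\<dots> = (\<integral>\<^sup>+y. ennreal k * indicator {x + D<..x + D + 1} y \<partial>lborel)"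
    by (simp add: nn_integral_cmult)
  also have "\<dots> \<le> (\<integral>\<^sup>+y. ennreal (normal_density x s y) * indicator (-A) y \<partial>lborel)"
  proof (rule nn_integral_mono)
    fix y
    show "ennreal k * indicator {x + D<..x + D + 1} y \<le> ennreal (normal_density x s y) * indicator (-A) y"
    proof (cases "y \<in> {x + D<..x + D + 1}")
      case True
      then have "y \<notin> A" "k \<le> normal_density x s y"
        unfolding k_def A_def using D by (auto intro!: minor_const_le_normal_density lo)
      then show ?thesis using True by (simp add: ennreal_leI)
    qed simp
  qed
  finally have "ennreal k * (\<integral>\<^sup>+y. ennreal (normal_density x 1 y) * indicator (-A) y \<partial>lborel) \<le>
    (\<integral>\<^sup>+y. ennreal (normal_density x s y) * indicator (-A) y \<partial>lborel)" .
  from add_mono[OF near mult_left_mono[OF this, of b]]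
  show ?thesis unfolding split[of 1] split[of s] k_def[symmetric]
    by (simp add: distrib_left mult.left_commute)
qed

text \<open>The wider density dominates a multiple of the narrower one, the multiple being the ratio
  of the standard deviations, and what is left over has mass 1 minus that ratio, at most
  \<open>t\<close>. Variances may move either way, hence the two cases; when the new density is the
  narrower one, the same fraction is split off from it instead.\<close>

lemma normal_integral_perturb:
  fixes F :: "real \<Rightarrow> ennreal"
  assumes F[measurable]: "F \<in> borel_measurable borel" and F1: "\<And>y. F y \<le> 1"
    and s: "0 < s" "0 < s'" and t: "0 \<le> t" "(1 - t) * s \<le> s'" "(1 - t) * s' \<le> s"
  shows "(\<integral>\<^sup>+y. ennreal (normal_density x s' y) * F y \<partial>lborel) \<le>
    (\<integral>\<^sup>+y. ennreal (normal_density x s y) * F y \<partial>lborel) + ennreal t"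
proof -
  have gap: "(\<integral>\<^sup>+y. ennreal (normal_density x b y - a / b * normal_density x a y) \<partial>lborel) = ennreal (1 - a / b)"
    if ab: "0 < a" "a \<le> b" for a b
  proof -
    have "(\<integral>\<^sup>+y. ennreal (normal_density x b y - a / b * normal_density x a y) \<partial>lborel) =
      ennreal (\<integral>y. normal_density x b y - a / b * normal_density x a y \<partial>lborel)"
      using ab normal_density_mono_sd[OF ab]
      by (intro nn_integral_eq_integral) auto
    also have "\<dots> = ennreal (1 - a / b)" using ab by simp
    finally show ?thesis .
  qed
  show ?thesis
  proof (cases "s \<le> s'")
    case True
    have "(\<integral>\<^sup>+y. ennreal (normal_density x s' y) * F y \<partial>lborel) \<le>
      (\<integral>\<^sup>+y. ennreal (normal_density x s y) * F y +
        ennreal (normal_density x s' y - s / s' * normal_density x s y) \<partial>lborel)"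
    proof (rule nn_integral_mono)
      fix y
      let ?d = "normal_density x s' y - s / s' * normal_density x s y"
      have "0 \<le> ?d" using normal_density_mono_sd[OF s(1) True] by simp
      moreover have "s / s' * normal_density x s y \<le> 1 * normal_density x s y"
        using True s by (intro mult_right_mono) auto
      ultimately have "ennreal (normal_density x s' y) \<le> ennreal (normal_density x s y) + ennreal ?d"
        by (subst ennreal_plus[symmetric]) (auto intro!: ennreal_leI simp del: ennreal_plus)
      then have "ennreal (normal_density x s' y) * F y \<le>
          (ennreal (normal_density x s y) + ennreal ?d) * F y" by (rule mult_right_mono) simp
      also have "\<dots> \<le> ennreal (normal_density x s y) * F y + ennreal ?d"
        using mult_left_mono[OF F1[of y], of "ennreal ?d"] by (simp add: distrib_right add_left_mono)
      finally show "ennreal (normal_density x s' y) * F y \<le>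
          ennreal (normal_density x s y) * F y + ennreal ?d" .
    qed
    also have "\<dots> = (\<integral>\<^sup>+y. ennreal (normal_density x s y) * F y \<partial>lborel) + ennreal (1 - s / s')"
      using gap[OF s(1) True] by (simp add: nn_integral_add)
    also have "\<dots> \<le> (\<integral>\<^sup>+y. ennreal (normal_density x s y) * F y \<partial>lborel) + ennreal t"
      using s t by (intro add_left_mono ennreal_leI) (simp add: field_simps)
    finally show ?thesis .
  next
    case False
    then have le: "s' \<le> s" by simp
    have "(\<integral>\<^sup>+y. ennreal (normal_density x s' y) * F y \<partial>lborel) \<le>
      (\<integral>\<^sup>+y. ennreal (normal_density x s y) * F y + ennreal (1 - s' / s) * ennreal (normal_density x s' y) \<partial>lborel)"
    proof (rule nn_integral_mono)
      fix y
      have "0 \<le> (1 - s' / s) * normal_density x s' y" using s le by (intro mult_nonneg_nonneg) auto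
      then have "ennreal (normal_density x s' y) = ennreal (s' / s * normal_density x s' y) +
          ennreal ((1 - s' / s) * normal_density x s' y)"
        using s le by (subst ennreal_plus[symmetric]) (auto simp: left_diff_distrib simp del: ennreal_plus)
      also have "\<dots> \<le> ennreal (normal_density x s y) + ennreal ((1 - s' / s) * normal_density x s' y)"
        by (intro add_right_mono ennreal_leI normal_density_mono_sd s le)
      finally have "ennreal (normal_density x s' y) * F y \<le>
          (ennreal (normal_density x s y) + ennreal ((1 - s' / s) * normal_density x s' y)) * F y"
        by (rule mult_right_mono) simp
      also have "\<dots> \<le> ennreal (normal_density x s y) * F y + ennreal ((1 - s' / s) * normal_density x s' y)"
        using mult_left_mono[OF F1[of y], of "ennreal ((1 - s' / s) * normal_density x s' y)"]
        by (simp add: distrib_right add_left_mono)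
      finally show "ennreal (normal_density x s' y) * F y \<le>
          ennreal (normal_density x s y) * F y + ennreal (1 - s' / s) * ennreal (normal_density x s' y)"
        using s le by (simp add: ennreal_mult)
    qed
    also have "\<dots> = (\<integral>\<^sup>+y. ennreal (normal_density x s y) * F y \<partial>lborel) + ennreal (1 - s' / s)"
      using s by (simp add: nn_integral_add nn_integral_cmult nn_integral_normal_density)
    also have "\<dots> \<le> (\<integral>\<^sup>+y. ennreal (normal_density x s y) * F y \<partial>lborel) + ennreal t"
      using s t by (intro add_left_mono ennreal_leI) (simp add: field_simps)
    finally show ?thesis .
  qed
qed

section \<open>The one-dimensional chain\<close>

definition accept_prob :: "(real \<Rightarrow> real) \<Rightarrow> real \<Rightarrow> real \<Rightarrow> real" where
  "accept_prob g x y = min 1 (g y / g x)"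

lemma measurable_accept_prob[measurable]:
  assumes [measurable]: "g \<in> borel_measurable borel" "u \<in> borel_measurable M" "v \<in> borel_measurable M"
  shows "(\<lambda>w. accept_prob g (u w) (v w)) \<in> borel_measurable M"
  unfolding accept_prob_def by measurable

lemma accept_prob_bounds:
  assumes "\<And>z. 0 \<le> g z"
  shows "0 \<le> accept_prob g x y" "accept_prob g x y \<le> 1"
  using assms by (auto simp: accept_prob_def)

lemma measurable_rwm_kernel:
  assumes g[measurable]: "g \<in> borel_measurable borel" and g0: "\<And>z. 0 \<le> g z"
  shows "rwm_kernel g \<in> borel \<rightarrow>\<^sub>M prob_algebra borel"
proof -
  have "(\<lambda>x. density lborel (normal_density x 1) \<bind> (\<lambda>y. measure_pmf (bernoulli_pmf (accept_prob g x y)) \<bind>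
      (\<lambda>b. return borel (if b then y else x)))) \<in> borel \<rightarrow>\<^sub>M prob_algebra borel"
    by (rule measurable_accept_reject[OF measurable_normal_kernel])
      (auto simp: accept_prob_bounds[of g, OF g0])
  then show ?thesis unfolding rwm_kernel_def[abs_def] accept_prob_def by simp
qed

lemma nn_integral_rwm_kernel:
  assumes g[measurable]: "g \<in> borel_measurable borel" and g0: "\<And>z. 0 \<le> g z"
    and f[measurable]: "f \<in> borel_measurable borel"
  shows "(\<integral>\<^sup>+z. f z \<partial>rwm_kernel g x) = (\<integral>\<^sup>+y. ennreal (normal_density x 1 y) *
     (f y * ennreal (accept_prob g x y) + f x * ennreal (1 - accept_prob g x y)) \<partial>lborel)"
proof -
  have "(\<integral>\<^sup>+z. f z \<partial>rwm_kernel g x) = (\<integral>\<^sup>+y. f (if True then y else x) * ennreal (accept_prob g x y) +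
      f (if False then y else x) * ennreal (1 - accept_prob g x y) \<partial>density lborel (normal_density x 1))"
    unfolding rwm_kernel_def accept_prob_def[symmetric]
    by (rule nn_integral_accept_reject[where N=borel]) (auto simp: accept_prob_bounds[of g, OF g0])
  then show ?thesis by (simp add: nn_integral_density)
qed

text \<open>Detailed balance: the accepted flow from \<open>x\<close> to \<open>y\<close> has
  density \<open>normal_density x s y * min (\<nu> x) (\<nu> y)\<close>, which is symmetric.
  Exchanging the variables in the accepted part makes it recombine with the rejected part to the
  full mass at \<open>x\<close>.\<close>

lemma nn_integral_stationary_metropolis:
  fixes \<nu> :: "real \<Rightarrow> real" and f :: "real \<Rightarrow> ennreal"
  assumes \<nu>[measurable]: "\<nu> \<in> borel_measurable borel" and \<nu>0: "\<And>x. 0 \<le> \<nu> x"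
    and f[measurable]: "f \<in> borel_measurable borel" and s: "0 < s"
  shows "(\<integral>\<^sup>+x. ennreal (\<nu> x) * (\<integral>\<^sup>+y. ennreal (normal_density x s y) *
     (f y * ennreal (accept_prob \<nu> x y) + f x * ennreal (1 - accept_prob \<nu> x y)) \<partial>lborel) \<partial>lborel) =
    (\<integral>\<^sup>+x. ennreal (\<nu> x) * f x \<partial>lborel)" (is "?L = ?R")
proof -
  define m where "m x y = min (\<nu> x) (\<nu> y)" for x y
  have m0: "0 \<le> m x y" "m x y \<le> \<nu> x" for x y using \<nu>0 by (auto simp: m_def)
  \<comment> \<open>For \<open>\<nu> x = 0\<close> both sides vanish, so the convention for division
    by 0 in \<open>accept_prob\<close> does no harm.\<close>
  have m: "\<nu> x * accept_prob \<nu> x y = m x y" for x y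
    using \<nu>0[of x] \<nu>0[of y] by (cases "\<nu> x = 0") (auto simp: m_def accept_prob_def min_def field_simps)
  have [measurable]: "(\<lambda>z. m (fst z) (snd z)) \<in> borel_measurable (borel \<Otimes>\<^sub>M borel)"
    "(\<lambda>z. m (snd z) (fst z)) \<in> borel_measurable (borel \<Otimes>\<^sub>M borel)"
    "\<And>x. m x \<in> borel_measurable borel" "\<And>x. (\<lambda>y. m y x) \<in> borel_measurable borel"
    unfolding m_def by measurable
  have [measurable]: "(\<lambda>z. normal_density (fst z) s (snd z)) \<in> borel_measurable (borel \<Otimes>\<^sub>M borel)"
    "(\<lambda>z. normal_density (snd z) s (fst z)) \<in> borel_measurable (borel \<Otimes>\<^sub>M borel)"
    unfolding normal_density_def by measurable
  let ?q = "\<lambda>x y. ennreal (normal_density x s y)"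
  have "?L = (\<integral>\<^sup>+x. (\<integral>\<^sup>+y. ?q x y * f y * ennreal (m x y) + ?q x y * f x * ennreal (\<nu> x - m x y) \<partial>lborel) \<partial>lborel)"
  proof (rule nn_integral_cong)
    fix x
    have "ennreal (\<nu> x) * (\<integral>\<^sup>+y. ?q x y *
        (f y * ennreal (accept_prob \<nu> x y) + f x * ennreal (1 - accept_prob \<nu> x y)) \<partial>lborel) =
      (\<integral>\<^sup>+y. ennreal (\<nu> x) * (?q x y *
        (f y * ennreal (accept_prob \<nu> x y) + f x * ennreal (1 - accept_prob \<nu> x y))) \<partial>lborel)"
      by (rule nn_integral_cmult[symmetric]) measurable
    also have "\<dots> = (\<integral>\<^sup>+y. ?q x y * f y * ennreal (m x y) + ?q x y * f x * ennreal (\<nu> x - m x y) \<partial>lborel)"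
    proof (rule nn_integral_cong)
      fix y
      have "ennreal (\<nu> x) * ennreal (accept_prob \<nu> x y) = ennreal (m x y)"
        using \<nu>0 accept_prob_bounds[of \<nu>, OF \<nu>0] by (simp add: ennreal_mult[symmetric] m)
      moreover have "ennreal (\<nu> x) * ennreal (1 - accept_prob \<nu> x y) = ennreal (\<nu> x - m x y)"
        using \<nu>0 accept_prob_bounds[of \<nu>, OF \<nu>0] by (simp add: ennreal_mult[symmetric] right_diff_distrib m)
      moreover have "ennreal (\<nu> x) * (?q x y * (f y * ennreal (accept_prob \<nu> x y) + f x * ennreal (1 - accept_prob \<nu> x y)))
        = ?q x y * f y * (ennreal (\<nu> x) * ennreal (accept_prob \<nu> x y)) +
          ?q x y * f x * (ennreal (\<nu> x) * ennreal (1 - accept_prob \<nu> x y))"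
        by (simp add: distrib_left mult_ac)
      ultimately show "ennreal (\<nu> x) * (?q x y * (f y * ennreal (accept_prob \<nu> x y) + f x * ennreal (1 - accept_prob \<nu> x y)))
        = ?q x y * f y * ennreal (m x y) + ?q x y * f x * ennreal (\<nu> x - m x y)" by simp
    qed
    finally show "ennreal (\<nu> x) * (\<integral>\<^sup>+y. ?q x y *
        (f y * ennreal (accept_prob \<nu> x y) + f x * ennreal (1 - accept_prob \<nu> x y)) \<partial>lborel) =
      (\<integral>\<^sup>+y. ?q x y * f y * ennreal (m x y) + ?q x y * f x * ennreal (\<nu> x - m x y) \<partial>lborel)" .
  qed
  also have "\<dots> = (\<integral>\<^sup>+x. (\<integral>\<^sup>+y. ?q x y * f y * ennreal (m x y) \<partial>lborel) \<partial>lborel) +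
      (\<integral>\<^sup>+x. (\<integral>\<^sup>+y. ?q x y * f x * ennreal (\<nu> x - m x y) \<partial>lborel) \<partial>lborel)"
    by (simp add: nn_integral_add)
  also have "(\<integral>\<^sup>+x. (\<integral>\<^sup>+y. ?q x y * f y * ennreal (m x y) \<partial>lborel) \<partial>lborel) =
      (\<integral>\<^sup>+y. (\<integral>\<^sup>+x. ?q x y * f y * ennreal (m x y) \<partial>lborel) \<partial>lborel)"
    by (rule lborel_pair.Fubini'[symmetric]) (simp add: split_beta')
  also have "\<dots> = (\<integral>\<^sup>+x. (\<integral>\<^sup>+y. ?q x y * f x * ennreal (m x y) \<partial>lborel) \<partial>lborel)"
  proof (intro nn_integral_cong)
    fix x y
    have "normal_density y s x = normal_density x s y" "m y x = m x y"
      by (simp_all only: normal_density_symmetric[of y s x] m_def min.commute[of "\<nu> y" "\<nu> x"])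
    then show "?q y x * f x * ennreal (m y x) = ?q x y * f x * ennreal (m x y)" by simp
  qed
  also have "\<dots> + (\<integral>\<^sup>+x. (\<integral>\<^sup>+y. ?q x y * f x * ennreal (\<nu> x - m x y) \<partial>lborel) \<partial>lborel) =
    (\<integral>\<^sup>+x. (\<integral>\<^sup>+y. ?q x y * f x * ennreal (m x y) + ?q x y * f x * ennreal (\<nu> x - m x y) \<partial>lborel) \<partial>lborel)"
    by (simp add: nn_integral_add)
  also have "\<dots> = (\<integral>\<^sup>+x. (\<integral>\<^sup>+y. (ennreal (\<nu> x) * f x) * ?q x y \<partial>lborel) \<partial>lborel)"
  proof (intro nn_integral_cong)
    fix x y
    have "ennreal (m x y) + ennreal (\<nu> x - m x y) = ennreal (\<nu> x)"
      using m0[of x y] by (simp add: ennreal_plus[symmetric] del: ennreal_plus)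
    then show "?q x y * f x * ennreal (m x y) + ?q x y * f x * ennreal (\<nu> x - m x y) = (ennreal (\<nu> x) * f x) * ?q x y"
      by (metis distrib_left mult.commute mult.left_commute)
  qed
  also have "\<dots> = ?R" by (simp add: nn_integral_cmult nn_integral_normal_density s)
  finally show ?thesis .
qed

section \<open>Displacement of the chain and boundedness of the support\<close>

lemma normal_tail_bound:
  assumes l: "0 < l"
  shows "(\<integral>\<^sup>+y. ennreal (normal_density x 1 y) * indicator {y. l < \<bar>y - x\<bar>} y \<partial>lborel) \<le> ennreal (1 / l\<^sup>2)"
proof -
  have "(\<integral>\<^sup>+y. ennreal (normal_density x 1 y) * indicator {y. l < \<bar>y - x\<bar>} y \<partial>lborel) \<le>
    (\<integral>\<^sup>+y. ennreal (1 / l\<^sup>2) * ennreal (normal_density x 1 y * (y - x) ^ 2) \<partial>lborel)"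
  proof (rule nn_integral_mono)
    fix y
    show "ennreal (normal_density x 1 y) * indicator {y. l < \<bar>y - x\<bar>} y \<le>
      ennreal (1 / l\<^sup>2) * ennreal (normal_density x 1 y * (y - x) ^ 2)"
    proof (cases "l < \<bar>y - x\<bar>")
      case True
      then have "l\<^sup>2 \<le> (y - x)\<^sup>2" using l abs_le_square_iff[of l "y - x"] by simp
      then have "1 \<le> (y - x)\<^sup>2 / l\<^sup>2" using l by simp
      then have "normal_density x 1 y * 1 \<le> normal_density x 1 y * ((y - x)\<^sup>2 / l\<^sup>2)"
        by (intro mult_left_mono) auto
      then show ?thesis using True by (simp add: ennreal_mult'[symmetric] ennreal_leI)
    qed simp
  qed
  also have "\<dots> = ennreal (1 / l\<^sup>2) * (\<integral>\<^sup>+y. ennreal (normal_density x 1 y * (y - x) ^ 2) \<partial>lborel)"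
    by (rule nn_integral_cmult) simp
  also have "(\<integral>\<^sup>+y. ennreal (normal_density x 1 y * (y - x) ^ 2) \<partial>lborel) =
      ennreal (\<integral>y. normal_density x 1 y * (y - x) ^ 2 \<partial>lborel)"
    by (rule nn_integral_eq_integral) (auto intro!: integrable_normal_moment)
  also have "(\<integral>y. normal_density x 1 y * (y - x) ^ 2 \<partial>lborel) = 1"
    using integral_normal_moment_even[of 1 x 1] by simp
  finally show ?thesis by simp
qed

text \<open>A displacement of more than \<open>n * l\<close> forces one of the \<open>n\<close>
  steps to exceed \<open>l\<close>. A rejection does not move, and a proposal exceeds
  \<open>l\<close> with probability at most \<open>1 / l\<^sup>2\<close> by Chebyshev, so the bound
  is the same for all \<open>x\<close> and does not involve \<open>g\<close>.\<close>

lemma kernel_power_displacement: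
  assumes g[measurable]: "g \<in> borel_measurable borel" and g0: "\<And>z. 0 \<le> g z" and l: "0 < l"
    and sN: "sets N = sets borel"
  shows "emeasure (kernel_power N (rwm_kernel g) n x) {y. real n * l < \<bar>y - x\<bar>} \<le> ennreal (real n / l\<^sup>2)"
proof (induction n)
  case 0
  show ?case using l by (simp add: return_cong[OF sN])
next
  case (Suc n)
  let ?R = "rwm_kernel g" and ?K = "kernel_power N (rwm_kernel g)"
  note R = measurable_rwm_kernel[OF g g0]
  note K = prob_kernel[OF measurable_kernel_power[OF R sN], simplified]
  interpret K: prob_space "?K n x" by (rule K)
  have step: "(\<integral>\<^sup>+z. indicator {z. real (Suc n) * l < \<bar>z - x\<bar>} z \<partial>?R y) \<le>
      indicator {y. real n * l < \<bar>y - x\<bar>} y + ennreal (1 / l\<^sup>2)" for y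
  proof -
    interpret R: prob_space "?R y" by (rule prob_kernel[OF R]) simp
    have "(\<integral>\<^sup>+z. indicator {z. real (Suc n) * l < \<bar>z - x\<bar>} z \<partial>?R y) \<le>
       (\<integral>\<^sup>+z. indicator {y. real n * l < \<bar>y - x\<bar>} y + indicator {z. l < \<bar>z - y\<bar>} z \<partial>?R y)"
    proof (rule nn_integral_mono)
      fix z
      show "(indicator {z. real (Suc n) * l < \<bar>z - x\<bar>} z :: ennreal) \<le>
        indicator {y. real n * l < \<bar>y - x\<bar>} y + indicator {z. l < \<bar>z - y\<bar>} z"
        by (auto simp: algebra_simps split: split_indicator)
    qed
    also have "\<dots> = indicator {y. real n * l < \<bar>y - x\<bar>} y + (\<integral>\<^sup>+z. indicator {z. l < \<bar>z - y\<bar>} z \<partial>?R y)"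
      using prob_kernel(2)[OF R, of y]
      by (subst nn_integral_add) (auto simp: R.emeasure_space_1 cong: measurable_cong_sets)
    also have "(\<integral>\<^sup>+z. indicator {z. l < \<bar>z - y\<bar>} z \<partial>?R y) \<le> ennreal (1 / l\<^sup>2)"
    proof -
      have "(\<integral>\<^sup>+z. indicator {z. l < \<bar>z - y\<bar>} z \<partial>?R y) =
        (\<integral>\<^sup>+z. ennreal (normal_density y 1 z) * (indicator {z. l < \<bar>z - y\<bar>} z * ennreal (accept_prob g y z) +
           indicator {z. l < \<bar>z - y\<bar>} y * ennreal (1 - accept_prob g y z)) \<partial>lborel)"
        by (rule nn_integral_rwm_kernel[OF g g0]) simp
      also have "\<dots> \<le> (\<integral>\<^sup>+z. ennreal (normal_density y 1 z) * indicator {z. l < \<bar>z - y\<bar>} z \<partial>lborel)"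
      proof (intro nn_integral_mono mult_left_mono)
        fix z
        have "ennreal (accept_prob g y z) \<le> 1" using accept_prob_bounds(2)[of g, OF g0] by simp
        then show "indicator {z. l < \<bar>z - y\<bar>} z * ennreal (accept_prob g y z) +
           indicator {z. l < \<bar>z - y\<bar>} y * ennreal (1 - accept_prob g y z) \<le> indicator {z. l < \<bar>z - y\<bar>} z"
          using l by (auto split: split_indicator)
      qed simp
      also have "\<dots> \<le> ennreal (1 / l\<^sup>2)" by (rule normal_tail_bound[OF l])
      finally show ?thesis .
    qed
    finally show ?thesis by (simp add: add_left_mono)
  qed
  have "emeasure (?K (Suc n) x) {y. real (Suc n) * l < \<bar>y - x\<bar>} =
      (\<integral>\<^sup>+y. indicator {y. real (Suc n) * l < \<bar>y - x\<bar>} y \<partial>?K (Suc n) x)"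
    using K(2)[of "Suc n" x] by (subst nn_integral_indicator) auto
  also have "\<dots> = (\<integral>\<^sup>+y. (\<integral>\<^sup>+z. indicator {y. real (Suc n) * l < \<bar>y - x\<bar>} z \<partial>?R y) \<partial>?K n x)"
    by (rule nn_integral_kernel_power_Suc[OF R sN]) auto
  also have "\<dots> \<le> (\<integral>\<^sup>+y. indicator {y. real n * l < \<bar>y - x\<bar>} y + ennreal (1 / l\<^sup>2) \<partial>?K n x)"
    by (intro nn_integral_mono step)
  also have "\<dots> = emeasure (?K n x) {y. real n * l < \<bar>y - x\<bar>} + ennreal (1 / l\<^sup>2)"
    using K(2)[of n x]
    by (subst nn_integral_add) (auto simp: K.emeasure_space_1 nn_integral_indicator cong: measurable_cong_sets)
  also have "\<dots> \<le> ennreal (real n / l\<^sup>2) + ennreal (1 / l\<^sup>2)" by (intro add_right_mono Suc)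
  also have "\<dots> = ennreal (real (Suc n) / l\<^sup>2)"
    by (simp add: ennreal_plus[symmetric] add_divide_distrib del: ennreal_plus)
  finally show ?case .
qed

text \<open>In \<open>n\<close> steps the chain moves less than some \<open>L\<close> with high probability, uniformly in the starting
  point. So uniform ergodicity forces more than half of the target mass to lie within \<open>L\<close> of each
  point of the support.\<close>

lemma uniformly_ergodic_imp_bounded_support:
  assumes g[measurable]: "g \<in> borel_measurable borel" and g0: "\<And>z. 0 \<le> g z"
    and g1: "(\<integral>\<^sup>+ z. ennreal (g z) \<partial>lborel) = 1"
    and ue: "uniformly_ergodic {z. 0 < g z} (rwm_kernel g) (density lborel g)"
  obtains D where "0 \<le> D" "\<And>x y. 0 < g x \<Longrightarrow> 0 < g y \<Longrightarrow> \<bar>x - y\<bar> \<le> D"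
proof -
  let ?\<mu> = "density lborel g"
  let ?K = "kernel_power ?\<mu> (rwm_kernel g)"
  note R = measurable_rwm_kernel[OF g g0]
  interpret \<mu>: prob_space ?\<mu>
    by (rule prob_spaceI) (simp add: emeasure_density g1)
  obtain k \<rho> where \<rho>: "0 \<le> \<rho>" "\<rho> < 1" and tv: "\<And>x n. 0 < g x \<Longrightarrow> tv_dist (?K n x) ?\<mu> \<le> k * \<rho> ^ n"
    using ue unfolding uniformly_ergodic_def by auto
  have "(\<lambda>n. k * \<rho> ^ n) \<longlonglongrightarrow> k * 0" by (intro tendsto_mult tendsto_const LIMSEQ_power_zero) (use \<rho> in auto)
  then have "eventually (\<lambda>n. k * \<rho> ^ n < 1/8) sequentially" by (intro order_tendstoD) auto
  then obtain n where n: "k * \<rho> ^ n < 1/8" by (auto simp: eventually_sequentially)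
  \<comment> \<open>The displacement and the distance to stationarity each cost 1/8, which leaves
    mass 3/4 near every point of the support; anything above 1/2 rules out two disjoint
    neighbourhoods. The \<open>+ 1\<close> keeps \<open>l\<close> positive when
    \<open>n = 0\<close>.\<close>
  define l where "l = sqrt (8 * (real n + 1))"
  have l: "0 < l" "real n / l\<^sup>2 \<le> 1/8" by (auto simp: l_def field_simps)
  define L where "L = real n * l"
  have near: "3/4 \<le> measure ?\<mu> {y. \<bar>y - x\<bar> \<le> L}" if x: "0 < g x" for x
  proof -
    note K = prob_kernel[OF measurable_kernel_power[OF R, of ?\<mu> n], of x, simplified]
    interpret K: prob_space "?K n x" by (rule K)
    have "emeasure (?K n x) {y. real n * l < \<bar>y - x\<bar>} \<le> ennreal (real n / l\<^sup>2)"
      by (rule kernel_power_displacement[OF g g0 l(1)]) simp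
    then have "measure (?K n x) {y. L < \<bar>y - x\<bar>} \<le> real n / l\<^sup>2"
      by (simp add: K.emeasure_eq_measure L_def)
    from order_trans[OF this l(2)] have "measure (?K n x) {y. L < \<bar>y - x\<bar>} \<le> 1/8" .
    moreover have "measure (?K n x) {y. L < \<bar>y - x\<bar>} = 1 - measure (?K n x) {y. \<bar>y - x\<bar> \<le> L}"
    proof -
      have "{y. L < \<bar>y - x\<bar>} = space (?K n x) - {y. \<bar>y - x\<bar> \<le> L}" using K(3) by auto
      moreover have "{y. \<bar>y - x\<bar> \<le> L} \<in> sets (?K n x)" unfolding K(2) by measurable
      ultimately show ?thesis using K.prob_compl by metis
    qed
    moreover have "{y. \<bar>y - x\<bar> \<le> L} \<in> sets (?K n x)" unfolding K(2) by measurable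
    from abs_measure_diff_le_tv_dist[OF K(1) \<mu>.prob_space_axioms this]
    have "\<bar>measure (?K n x) {y. \<bar>y - x\<bar> \<le> L} - measure ?\<mu> {y. \<bar>y - x\<bar> \<le> L}\<bar> \<le> 1/8"
      using tv[OF x, of n] n by linarith
    ultimately show ?thesis by linarith
  qed
  show thesis
  proof (rule that[of "2 * L"])
    show "0 \<le> 2 * L" unfolding L_def using l by simp
    fix x y assume xy: "0 < g x" "0 < g y"
    show "\<bar>x - y\<bar> \<le> 2 * L"
    proof (rule ccontr)
      assume "\<not> ?thesis"
      then have "{z. \<bar>z - x\<bar> \<le> L} \<inter> {z. \<bar>z - y\<bar> \<le> L} = {}" by auto
      then have "measure ?\<mu> ({z. \<bar>z - x\<bar> \<le> L} \<union> {z. \<bar>z - y\<bar> \<le> L}) =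
        measure ?\<mu> {z. \<bar>z - x\<bar> \<le> L} + measure ?\<mu> {z. \<bar>z - y\<bar> \<le> L}"
        by (intro \<mu>.finite_measure_Union) auto
      then show False using near[OF xy(1)] near[OF xy(2)] \<mu>.prob_le_1[of "{z. \<bar>z - x\<bar> \<le> L} \<union> {z. \<bar>z - y\<bar> \<le> L}"]
        by linarith
    qed
  qed
qed

section \<open>The Metropolis-within-Gibbs kernel\<close>

definition coord_upd :: "real^'d \<Rightarrow> 'd::finite \<Rightarrow> real \<Rightarrow> real^'d" where
  "coord_upd x i y = (\<chi> k. if k = i then y else x $ k)"

lemma coord_upd_nth[simp]: "coord_upd x i y $ k = (if k = i then y else x $ k)"
  by (simp add: coord_upd_def)

lemma coord_upd_self[simp]: "coord_upd x i (x $ i) = x"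
  by (simp add: vec_eq_iff)

lemma coord_upd_upd[simp]: "coord_upd (coord_upd x i y) i z = coord_upd x i z"
  by (simp add: vec_eq_iff)

lemma measurable_vec_nth[measurable (raw)]:
  fixes f :: "_ \<Rightarrow> real^'d::finite"
  shows "f \<in> borel_measurable M \<Longrightarrow> (\<lambda>w. f w $ i) \<in> borel_measurable M"
  using borel_measurable_inner[of f M "\<lambda>_. axis i 1"] by (simp add: inner_axis)

lemma measurable_vecI:
  fixes f :: "_ \<Rightarrow> real^'d::finite"
  assumes "\<And>i. (\<lambda>w. f w $ i) \<in> borel_measurable M"
  shows "f \<in> borel_measurable M"
proof (rule borel_measurable_euclidean_space[THEN iffD2, rule_format])
  fix b :: "real^'d" assume "b \<in> Basis"
  then obtain i where "b = axis i 1" by (auto simp: Basis_vec_def)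
  then show "(\<lambda>w. f w \<bullet> b) \<in> borel_measurable M" using assms[of i] by (simp add: inner_axis)
qed

lemma measurable_coord_upd[measurable (raw)]:
  assumes [measurable]: "f \<in> borel_measurable M" "h \<in> borel_measurable M"
  shows "(\<lambda>w. coord_upd (f w) i (h w)) \<in> borel_measurable M"
proof (rule measurable_vecI)
  fix k show "(\<lambda>w. coord_upd (f w) i (h w) $ k) \<in> borel_measurable M"
    by (cases "k = i") (simp_all add: measurable_vec_nth)
qed

locale mwg_target =
  fixes g :: "real \<Rightarrow> real" and C :: "'d::finite \<Rightarrow> real"
  assumes g_measurable[measurable]: "g \<in> borel_measurable borel"
    and g_nonneg: "\<And>z. 0 \<le> g z"
    and g_density: "(\<integral>\<^sup>+ z. ennreal (g z) \<partial>lborel) = 1"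
    and C_pos: "\<And>i. 0 < C i"
begin

section \<open>Marginals, one-coordinate operators and stationarity\<close>

definition marginal :: "'d \<Rightarrow> real \<Rightarrow> real" where
  "marginal i z = C i * g (C i * z)"

lemma measurable_marginal[measurable]: "marginal i \<in> borel_measurable borel"
  unfolding marginal_def by measurable

lemma marginal_nonneg: "0 \<le> marginal i z"
  using C_pos[of i] g_nonneg by (simp add: marginal_def)

lemma accept_prob_marginal: "accept_prob (marginal i) x y = accept_prob g (C i * x) (C i * y)"
  using C_pos[of i] by (simp add: accept_prob_def marginal_def)

lemma nn_integral_scale:
  assumes [measurable]: "F \<in> borel_measurable borel"
  shows "(\<integral>\<^sup>+z. F z \<partial>lborel) = ennreal (C i) * (\<integral>\<^sup>+z. F (C i * z) \<partial>lborel)"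
  using nn_integral_real_affine[of F "C i" 0] C_pos[of i] by simp

lemma nn_integral_marginal:
  assumes F[measurable]: "F \<in> borel_measurable borel"
  shows "(\<integral>\<^sup>+z. ennreal (marginal i z) * F z \<partial>lborel) = (\<integral>\<^sup>+z. ennreal (g z) * F (z / C i) \<partial>lborel)"
proof -
  have "(\<integral>\<^sup>+z. ennreal (g z) * F (z / C i) \<partial>lborel) =
    ennreal (C i) * (\<integral>\<^sup>+z. ennreal (g (C i * z)) * F (C i * z / C i) \<partial>lborel)"
    by (rule nn_integral_scale) measurable
  also have "\<dots> = (\<integral>\<^sup>+z. ennreal (C i) * (ennreal (g (C i * z)) * F (C i * z / C i)) \<partial>lborel)"
    by (rule nn_integral_cmult[symmetric]) measurable
  also have "\<dots> = (\<integral>\<^sup>+z. ennreal (marginal i z) * F z \<partial>lborel)"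
    using C_pos[of i] g_nonneg
    by (intro nn_integral_cong) (simp add: marginal_def ennreal_mult mult.assoc)
  finally show ?thesis ..
qed

lemma nn_integral_marginal_1: "(\<integral>\<^sup>+z. ennreal (marginal i z) \<partial>lborel) = 1"
  using nn_integral_marginal[of "\<lambda>_. 1" i] g_density by simp

text \<open>The expectation operator of an update of coordinate \<open>i\<close>; here
  \<open>s\<close> is a standard deviation, not a variance. As an operator on functions it lets
  minorization and perturbation be read off from the integrand.\<close>

definition coord_step :: "'d \<Rightarrow> real \<Rightarrow> (real^'d \<Rightarrow> ennreal) \<Rightarrow> real^'d \<Rightarrow> ennreal" where
  "coord_step i s G x = (\<integral>\<^sup>+y. ennreal (normal_density (x $ i) s y) *
     (G (coord_upd x i y) * ennreal (accept_prob (marginal i) (x $ i) y) +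
      G x * ennreal (1 - accept_prob (marginal i) (x $ i) y)) \<partial>lborel)"

text \<open>The Gibbs (heat bath) update: for a product target the conditional law of coordinate
  \<open>i\<close> is its marginal.\<close>

definition resample :: "'d \<Rightarrow> (real^'d \<Rightarrow> ennreal) \<Rightarrow> real^'d \<Rightarrow> ennreal" where
  "resample i G x = (\<integral>\<^sup>+z. ennreal (marginal i z) * G (coord_upd x i z) \<partial>lborel)"

lemma measurable_coord_step[measurable]:
  assumes [measurable]: "G \<in> borel_measurable borel"
  shows "coord_step i s G \<in> borel_measurable borel"
  unfolding coord_step_def normal_density_def by measurable

lemma measurable_resample[measurable]:
  assumes [measurable]: "G \<in> borel_measurable borel"
  shows "resample i G \<in> borel_measurable borel"
  unfolding resample_def by measurable

text \<open>On the line through \<open>x\<close> in direction \<open>i\<close> this is the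
  stationarity of the marginal under a one-dimensional Metropolis step: moving after an exact
  resampling changes nothing.\<close>

lemma resample_coord_step:
  assumes [measurable]: "G \<in> borel_measurable borel" and s: "0 < s"
  shows "resample i (coord_step i s G) x = resample i G x"
proof -
  have "(\<lambda>y. G (coord_upd x i y)) \<in> borel_measurable borel" by measurable
  from nn_integral_stationary_metropolis[OF measurable_marginal marginal_nonneg this s, of i]
  show ?thesis by (simp add: resample_def coord_step_def)
qed

lemma coord_upd_shift: "coord_upd x i (x $ i + t) = x + t *\<^sub>R axis i 1"
  by (simp add: vec_eq_iff axis_def)

lemma nn_integral_product_target:
  assumes [measurable]: "G \<in> borel_measurable borel"
  shows "(\<integral>\<^sup>+x. G x \<partial>product_target g C) = (\<integral>\<^sup>+x. (\<Prod>i\<in>UNIV. ennreal (marginal i (x $ i))) * G x \<partial>lborel)"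
proof -
  have "(\<integral>\<^sup>+x. G x \<partial>product_target g C) =
      (\<integral>\<^sup>+x. ennreal (\<Prod>i\<in>UNIV. C i * g (C i * x $ i)) * G x \<partial>lborel)"
    unfolding product_target_def by (rule nn_integral_density) simp_all
  then show ?thesis
    using marginal_nonneg by (simp add: prod_ennreal marginal_def)
qed

text \<open>Fubini with respect to a single coordinate of \<open>real^'d\<close> is replaced by translations along \<open>axis i 1\<close>.\<close>

lemma nn_integral_resample:
  assumes G[measurable]: "G \<in> borel_measurable borel"
  shows "(\<integral>\<^sup>+x. resample i G x \<partial>product_target g C) = (\<integral>\<^sup>+x. G x \<partial>product_target g C)"
proof -
  define rest where "rest x = (\<Prod>k\<in>UNIV - {i}. ennreal (marginal k (x $ k)))" for x :: "real^'d"
  define m where "m t = ennreal (marginal i t)" for t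
  let ?e = "axis i (1::real) :: real^'d"
  have [measurable]: "rest \<in> borel_measurable borel" "m \<in> borel_measurable borel"
    unfolding rest_def m_def by measurable
  have split: "(\<Prod>k\<in>UNIV. ennreal (marginal k (x $ k))) = m (x $ i) * rest x" for x :: "real^'d"
    unfolding rest_def m_def by (rule prod.remove) auto
  have rest_shift: "rest (x + t *\<^sub>R ?e) = rest x" for x t
    unfolding rest_def by (intro prod.cong) (auto simp: axis_def)
  have nth_shift: "(x + t *\<^sub>R ?e) $ i = x $ i + t" for x t by (simp add: axis_def)
  have m1: "(\<integral>\<^sup>+t. m (c - t) \<partial>lborel) = 1" for c
    using nn_integral_real_affine[of m "-1" c] nn_integral_marginal_1[of i] by (simp add: m_def)
  have res: "resample i G x = (\<integral>\<^sup>+t. m (x $ i + t) * G (x + t *\<^sub>R ?e) \<partial>lborel)" for x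
    using nn_integral_real_affine[of "\<lambda>z. m z * G (coord_upd x i z)" 1 "x $ i"]
    by (simp add: resample_def m_def coord_upd_shift)
  \<comment> \<open>Integrand with the new point as \<open>x\<close> and the displacement as
    \<open>t\<close>: \<open>x $ i - t\<close> is the old value of the coordinate and
    \<open>x $ i\<close> the resampled one. Translation invariance moves the base point to the new
    state; integrating over \<open>t\<close> then removes the old value by
    \<open>m1\<close>.\<close>
  define h where "h t x = rest x * m (x $ i - t) * m (x $ i) * G x" for t x
  have [measurable]: "h t \<in> borel_measurable borel" for t unfolding h_def by measurable
  have [measurable]: "(\<lambda>z. h (fst z) (snd z)) \<in> borel_measurable (borel \<Otimes>\<^sub>M borel)"
    "(\<lambda>z. h (snd z) (fst z)) \<in> borel_measurable (borel \<Otimes>\<^sub>M borel)"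
    "(\<lambda>z. h (snd z) (fst z + snd z *\<^sub>R ?e)) \<in> borel_measurable (borel \<Otimes>\<^sub>M borel)"
    unfolding h_def by measurable
  have "(\<integral>\<^sup>+x. resample i G x \<partial>product_target g C) = (\<integral>\<^sup>+x. m (x $ i) * rest x * resample i G x \<partial>lborel)"
    by (simp add: nn_integral_product_target split)
  also have "\<dots> = (\<integral>\<^sup>+x. (\<integral>\<^sup>+t. h t (x + t *\<^sub>R ?e) \<partial>lborel) \<partial>lborel)"
  proof (rule nn_integral_cong)
    fix x :: "real^'d"
    have "m (x $ i) * rest x * resample i G x =
      (\<integral>\<^sup>+t. m (x $ i) * rest x * (m (x $ i + t) * G (x + t *\<^sub>R ?e)) \<partial>lborel)"
      unfolding res by (rule nn_integral_cmult[symmetric]) measurable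
    also have "\<dots> = (\<integral>\<^sup>+t. h t (x + t *\<^sub>R ?e) \<partial>lborel)"
      by (intro nn_integral_cong) (simp add: h_def rest_shift nth_shift mult_ac)
    finally show "m (x $ i) * rest x * resample i G x = (\<integral>\<^sup>+t. h t (x + t *\<^sub>R ?e) \<partial>lborel)" .
  qed
  also have "\<dots> = (\<integral>\<^sup>+t. (\<integral>\<^sup>+x. h t (x + t *\<^sub>R ?e) \<partial>lborel) \<partial>lborel)"
    by (rule lborel_pair.Fubini'[symmetric]) (simp add: split_beta')
  also have "\<dots> = (\<integral>\<^sup>+t. (\<integral>\<^sup>+x. h t x \<partial>lborel) \<partial>lborel)"
  proof (rule nn_integral_cong)
    fix t :: real
    have "(\<integral>\<^sup>+x. h t x \<partial>lborel) = (\<integral>\<^sup>+x. h t x \<partial>distr lborel borel ((+) (t *\<^sub>R ?e)))"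
      by (simp add: lborel_distr_plus)
    also have "\<dots> = (\<integral>\<^sup>+x. h t (x + t *\<^sub>R ?e) \<partial>lborel)"
      by (subst nn_integral_distr) (auto simp: add.commute)
    finally show "(\<integral>\<^sup>+x. h t (x + t *\<^sub>R ?e) \<partial>lborel) = (\<integral>\<^sup>+x. h t x \<partial>lborel)" ..
  qed
  also have "\<dots> = (\<integral>\<^sup>+x. (\<integral>\<^sup>+t. h t x \<partial>lborel) \<partial>lborel)"
    by (rule lborel_pair.Fubini') (simp add: split_beta')
  also have "\<dots> = (\<integral>\<^sup>+x. m (x $ i) * rest x * G x \<partial>lborel)"
  proof (rule nn_integral_cong)
    fix x :: "real^'d"
    have "(\<integral>\<^sup>+t. h t x \<partial>lborel) = (\<integral>\<^sup>+t. (m (x $ i) * rest x * G x) * m (x $ i - t) \<partial>lborel)"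
      by (intro nn_integral_cong) (simp add: h_def mult_ac)
    also have "\<dots> = m (x $ i) * rest x * G x"
      by (subst nn_integral_cmult) (auto simp: m1)
    finally show "(\<integral>\<^sup>+t. h t x \<partial>lborel) = m (x $ i) * rest x * G x" .
  qed
  also have "\<dots> = (\<integral>\<^sup>+x. G x \<partial>product_target g C)"
    by (simp add: nn_integral_product_target split)
  finally show ?thesis .
qed

text \<open>An extra Gibbs update leaves \<pi>-integrals unchanged and absorbs the coordinate step,
  so the stationarity of \<pi> reduces to the one-dimensional statement.\<close>

lemma nn_integral_coord_step:
  assumes [measurable]: "G \<in> borel_measurable borel" and s: "0 < s"
  shows "(\<integral>\<^sup>+x. coord_step i s G x \<partial>product_target g C) = (\<integral>\<^sup>+x. G x \<partial>product_target g C)"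
  using nn_integral_resample[of "coord_step i s G" i] nn_integral_resample[of G i]
  by (simp add: resample_coord_step[OF _ s])

lemma sets_product_target[simp, measurable_cong]: "sets (product_target g C) = sets borel"
  and space_product_target[simp]: "space (product_target g C) = UNIV"
  by (simp_all add: product_target_def)

lemma prod_Basis_vec: "(\<Prod>b\<in>(Basis :: (real^'d) set). f b) = (\<Prod>i\<in>UNIV. f (axis i 1))"
proof -
  have B: "(Basis :: (real^'d) set) = (\<lambda>i. axis i 1) ` UNIV" by (auto simp: Basis_vec_def)
  have "inj (\<lambda>i. axis i (1::real) :: real^'d)" by (auto simp: inj_on_def axis_eq_axis)
  then show ?thesis unfolding B by (simp add: prod.reindex)
qed

lemma prob_space_product_target: "prob_space (product_target g C)"
proof (rule prob_spaceI)
  \<comment> \<open>The product formula for Lebesgue measure is indexed by basis vectors;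
    \<open>ix\<close> recovers the coordinate from its axis vector.\<close>
  define ix where "ix b = (SOME i. b = axis i (1::real))" for b :: "real^'d"
  have ix: "ix (axis i 1) = i" for i
    unfolding ix_def by (rule some_equality) (auto simp: axis_eq_axis)
  have "emeasure (product_target g C) (space (product_target g C)) =
    (\<integral>\<^sup>+x. 1 \<partial>product_target g C)" by simp
  also have "\<dots> = (\<integral>\<^sup>+x. (\<Prod>b\<in>Basis. ennreal (marginal (ix b) (x \<bullet> b))) \<partial>lborel)"
    by (subst nn_integral_product_target) (simp_all add: prod_Basis_vec ix inner_axis)
  also have "\<dots> = (\<Prod>b\<in>(Basis::(real^'d) set). (\<integral>\<^sup>+x. ennreal (marginal (ix b) x) \<partial>lborel))"
    by (rule nn_integral_lborel_prod) auto
  also have "\<dots> = 1" by (simp add: nn_integral_marginal_1)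
  finally show "emeasure (product_target g C) (space (product_target g C)) = 1" .
qed

definition support :: "(real^'d) set" where
  "support = {x. \<forall>i. 0 < g (C i * x $ i)}"

lemma support_sets[measurable]: "support \<in> sets borel"
  unfolding support_def by measurable

lemma AE_support: "AE x in product_target g C. x \<in> support"
proof -
  have "AE x in lborel. 0 < ennreal (\<Prod>i\<in>UNIV. C i * g (C i * x $ i)) \<longrightarrow> x \<in> support"
  proof (rule AE_I2, intro impI)
    fix x :: "real^'d" assume "0 < ennreal (\<Prod>i\<in>UNIV. C i * g (C i * x $ i))"
    then have "(\<Prod>i\<in>UNIV. C i * g (C i * x $ i)) \<noteq> 0" by (metis ennreal_0 less_irrefl)
    then have "g (C i * x $ i) \<noteq> 0" for i by (auto simp: prod_zero_iff)
    then show "x \<in> support" unfolding support_def using g_nonneg by (auto simp: less_le)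
  qed
  then show ?thesis unfolding product_target_def by (subst AE_density) auto
qed

section \<open>The one-step kernel of the sampler and its records\<close>

definition mwg_kernel :: "('d \<Rightarrow> real) \<Rightarrow> ('d \<Rightarrow> real) \<Rightarrow> real^'d \<Rightarrow> (real^'d) measure" where
  "mwg_kernel \<alpha> \<sigma>2 x = distr (mwg_step g C \<alpha> \<sigma>2 x) borel fst"

definition coord_record :: "'d \<Rightarrow> real \<Rightarrow> real^'d \<Rightarrow> 'd mwg_record measure" where
  "coord_record i s x = density lborel (normal_density (x $ i) s) \<bind> (\<lambda>y.
     measure_pmf (bernoulli_pmf (accept_prob (marginal i) (x $ i) y)) \<bind> (\<lambda>b.
     return record_space (if b then coord_upd x i y else x, i, b)))"

lemma mwg_step_eq:
  "mwg_step g C \<alpha> \<sigma>2 x = point_measure UNIV (\<lambda>i. ennreal (\<alpha> i)) \<bind> (\<lambda>i. coord_record i (sqrt (\<sigma>2 i)) x)"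
  unfolding mwg_step_def coord_record_def accept_prob_marginal
  unfolding accept_prob_def coord_upd_def ..

lemma measurable_record_space:
  "f \<in> borel_measurable M \<Longrightarrow> (\<lambda>w. (f w, i, b)) \<in> M \<rightarrow>\<^sub>M record_space"
  unfolding record_space_def by (intro measurable_Pair) auto

lemma measurable_state_of[measurable]: "state_of \<in> record_space \<rightarrow>\<^sub>M borel"
  unfolding record_space_def by measurable

lemma measurable_coord_record:
  assumes [measurable]: "s \<in> borel_measurable M" "X \<in> borel_measurable M"
    and s: "\<And>w. w \<in> space M \<Longrightarrow> 0 < s w"
  shows "(\<lambda>w. coord_record i (s w) (X w)) \<in> M \<rightarrow>\<^sub>M prob_algebra record_space"
  unfolding coord_record_def
  by (rule measurable_accept_reject[OF measurable_normal_kernel])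
    (auto simp: accept_prob_bounds[of "marginal i", OF marginal_nonneg] s split_beta'
      intro!: measurable_record_space)

lemma measurable_mwg_step:
  assumes X: "X \<in> borel_measurable M"
    and \<alpha>: "\<And>i. (\<lambda>w. \<alpha> w i) \<in> borel_measurable M" "\<And>w. w \<in> space M \<Longrightarrow> prob_vector (\<alpha> w)"
    and \<sigma>2: "\<And>i. (\<lambda>w. \<sigma>2 w i) \<in> borel_measurable M" "\<And>w i. w \<in> space M \<Longrightarrow> 0 < \<sigma>2 w i"
  shows "(\<lambda>w. mwg_step g C (\<alpha> w) (\<sigma>2 w) (X w)) \<in> M \<rightarrow>\<^sub>M prob_algebra record_space"
  unfolding mwg_step_eq using X \<sigma>2
  by (intro measurable_bind_prob_space2[OF measurable_point_measure_kernel[OF \<alpha>]]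
      measurable_pair_finite2 measurable_coord_record) auto

lemma nn_integral_coord_record:
  assumes f: "f \<in> borel_measurable record_space"
  shows "(\<integral>\<^sup>+z. f z \<partial>coord_record i s x) = (\<integral>\<^sup>+y. ennreal (normal_density (x $ i) s y) *
     (f (coord_upd x i y, i, True) * ennreal (accept_prob (marginal i) (x $ i) y) +
      f (x, i, False) * ennreal (1 - accept_prob (marginal i) (x $ i) y)) \<partial>lborel)"
proof -
  have [measurable]: "(\<lambda>y. f (coord_upd x i y, i, True)) \<in> borel_measurable borel"
    by (rule measurable_compose[OF measurable_record_space f]) measurable
  have "(\<integral>\<^sup>+z. f z \<partial>coord_record i s x) =
    (\<integral>\<^sup>+y. f (if True then coord_upd x i y else x, i, True) * ennreal (accept_prob (marginal i) (x $ i) y) +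
      f (if False then coord_upd x i y else x, i, False) * ennreal (1 - accept_prob (marginal i) (x $ i) y)
       \<partial>density lborel (normal_density (x $ i) s))"
    unfolding coord_record_def
    by (rule nn_integral_accept_reject[OF _ _ _ _ f])
      (auto simp: accept_prob_bounds[of "marginal i", OF marginal_nonneg] intro!: measurable_record_space)
  then show ?thesis by (simp add: nn_integral_density)
qed

lemma nn_integral_mwg_step:
  assumes f: "f \<in> borel_measurable record_space" and \<sigma>2: "\<And>i. 0 < \<sigma>2 i"
  shows "(\<integral>\<^sup>+z. f z \<partial>mwg_step g C \<alpha> \<sigma>2 x) =
    (\<Sum>i\<in>UNIV. ennreal (\<alpha> i) * (\<integral>\<^sup>+z. f z \<partial>coord_record i (sqrt (\<sigma>2 i)) x))"
proof -
  have "coord_record i (sqrt (\<sigma>2 i)) x \<in> space (prob_algebra record_space)" for i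
    using measurable_space[OF measurable_coord_record[of "\<lambda>_. sqrt (\<sigma>2 i)" "count_space UNIV" "\<lambda>_. x" i]] \<sigma>2
    by auto
  then have "(\<lambda>i. coord_record i (sqrt (\<sigma>2 i)) x) \<in>
      point_measure UNIV (\<lambda>i. ennreal (\<alpha> i)) \<rightarrow>\<^sub>M subprob_algebra record_space"
    by (auto simp: point_measure_def space_prob_algebra space_subprob_algebra prob_space_imp_subprob_space)
  from nn_integral_bind[OF f this] show ?thesis
    by (simp add: mwg_step_eq nn_integral_point_measure_finite)
qed

lemma measurable_mwg_kernel:
  assumes "prob_vector \<alpha>" "\<And>i. 0 < \<sigma>2 i"
  shows "mwg_kernel \<alpha> \<sigma>2 \<in> borel \<rightarrow>\<^sub>M prob_algebra borel"
proof -
  have "(\<lambda>x. mwg_step g C \<alpha> \<sigma>2 x) \<in> borel \<rightarrow>\<^sub>M prob_algebra record_space"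
    by (rule measurable_mwg_step) (use assms in auto)
  then show ?thesis unfolding mwg_kernel_def[abs_def]
    by (rule measurable_distr_prob_space2) measurable
qed

lemma sets_mwg_step:
  assumes "prob_vector \<alpha>" "\<And>i. 0 < \<sigma>2 i"
  shows "prob_space (mwg_step g C \<alpha> \<sigma>2 x)" "sets (mwg_step g C \<alpha> \<sigma>2 x) = sets record_space"
proof -
  have "(\<lambda>x. mwg_step g C \<alpha> \<sigma>2 x) \<in> borel \<rightarrow>\<^sub>M prob_algebra record_space"
    by (rule measurable_mwg_step) (use assms in auto)
  from prob_kernel[OF this, of x]
  show "prob_space (mwg_step g C \<alpha> \<sigma>2 x)" "sets (mwg_step g C \<alpha> \<sigma>2 x) = sets record_space" by auto
qed

lemma nn_integral_mwg_step_state: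
  assumes G: "G \<in> borel_measurable borel" and \<sigma>2: "\<And>i. 0 < \<sigma>2 i"
  shows "(\<integral>\<^sup>+z. G (state_of z) \<partial>mwg_step g C \<alpha> \<sigma>2 x) =
    (\<Sum>i\<in>UNIV. ennreal (\<alpha> i) * coord_step i (sqrt (\<sigma>2 i)) G x)"
  unfolding nn_integral_mwg_step[OF measurable_compose[OF measurable_state_of G] \<sigma>2]
  by (simp add: nn_integral_coord_record[OF measurable_compose[OF measurable_state_of G]] coord_step_def)

lemma nn_integral_mwg_kernel:
  assumes G: "G \<in> borel_measurable borel" and \<alpha>: "prob_vector \<alpha>" and \<sigma>2: "\<And>i. 0 < \<sigma>2 i"
  shows "(\<integral>\<^sup>+y. G y \<partial>mwg_kernel \<alpha> \<sigma>2 x) = (\<integral>\<^sup>+z. G (state_of z) \<partial>mwg_step g C \<alpha> \<sigma>2 x)"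
proof -
  have "state_of \<in> mwg_step g C \<alpha> \<sigma>2 x \<rightarrow>\<^sub>M borel"
    using measurable_state_of sets_mwg_step(2)[OF \<alpha> \<sigma>2] by (simp cong: measurable_cong_sets)
  then show ?thesis unfolding mwg_kernel_def by (rule nn_integral_distr) (simp add: G)
qed

lemma nn_integral_stationary_mwg_kernel:
  assumes G[measurable]: "G \<in> borel_measurable borel" and \<alpha>: "prob_vector \<alpha>" and \<sigma>2: "\<And>i. 0 < \<sigma>2 i"
  shows "(\<integral>\<^sup>+x. (\<integral>\<^sup>+y. G y \<partial>mwg_kernel \<alpha> \<sigma>2 x) \<partial>product_target g C) = (\<integral>\<^sup>+x. G x \<partial>product_target g C)"
proof -
  have "(\<integral>\<^sup>+x. (\<integral>\<^sup>+y. G y \<partial>mwg_kernel \<alpha> \<sigma>2 x) \<partial>product_target g C) =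
      (\<Sum>i\<in>UNIV. ennreal (\<alpha> i) * (\<integral>\<^sup>+x. coord_step i (sqrt (\<sigma>2 i)) G x \<partial>product_target g C))"
    unfolding nn_integral_mwg_kernel[OF G \<alpha> \<sigma>2] nn_integral_mwg_step_state[OF G \<sigma>2]
    by (subst nn_integral_sum) (simp_all add: nn_integral_cmult)
  also have "\<dots> = (\<Sum>i\<in>UNIV. ennreal (\<alpha> i)) * (\<integral>\<^sup>+x. G x \<partial>product_target g C)"
    using \<sigma>2 by (simp add: nn_integral_coord_step sum_distrib_right)
  also have "(\<Sum>i\<in>UNIV. ennreal (\<alpha> i)) = 1"
    using \<alpha> by (simp add: prob_vector_def sum_ennreal)
  finally show ?thesis by simp
qed

text \<open>Leaving the support would require accepting a proposal at which \<open>g\<close>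
  vanishes, and this has acceptance probability 0; a rejection stays put.\<close>

lemma AE_mwg_step_support:
  assumes x: "x \<in> support" and \<alpha>: "prob_vector \<alpha>" and \<sigma>2: "\<And>i. 0 < \<sigma>2 i"
  shows "AE z in mwg_step g C \<alpha> \<sigma>2 x. state_of z \<in> support"
proof -
  let ?G = "indicator (- support) :: real^'d \<Rightarrow> ennreal"
  have [measurable]: "?G \<in> borel_measurable borel" by simp
  have zero: "coord_step i s ?G x = 0" for i s
  proof -
    have "?G (coord_upd x i y) * ennreal (accept_prob (marginal i) (x $ i) y) = 0" for y
    proof (cases "coord_upd x i y \<in> support")
      case False
      then have "\<not> 0 < g (C i * y)" using x by (auto simp: support_def split: if_splits)
      then have "g (C i * y) = 0" using g_nonneg[of "C i * y"] by simp
      then have "accept_prob (marginal i) (x $ i) y = 0"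
        unfolding accept_prob_marginal by (simp add: accept_prob_def)
      then show ?thesis by simp
    qed simp
    then have "(\<lambda>y. ?G (coord_upd x i y) * ennreal (accept_prob (marginal i) (x $ i) y)) = (\<lambda>_. 0)"
      by (simp only: fun_eq_iff) simp
    from fun_cong[OF this] show ?thesis unfolding coord_step_def using x by (simp only:) simp
  qed
  have Gm: "(\<lambda>z. ?G (state_of z)) \<in> borel_measurable (mwg_step g C \<alpha> \<sigma>2 x)"
    using measurable_compose[OF measurable_state_of, of ?G borel] sets_mwg_step(2)[OF \<alpha> \<sigma>2]
    by (simp cong: measurable_cong_sets)
  have "(\<integral>\<^sup>+z. ?G (state_of z) \<partial>mwg_step g C \<alpha> \<sigma>2 x) = 0"
    by (subst nn_integral_mwg_step_state) (auto simp: zero \<sigma>2)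
  then have "AE z in mwg_step g C \<alpha> \<sigma>2 x. ?G (state_of z) = 0"
    using nn_integral_0_iff_AE[OF Gm] by simp
  then show ?thesis by eventually_elim (simp split: split_indicator_asm)
qed

lemma AE_mwg_kernel_support:
  assumes x: "x \<in> support" and \<alpha>: "prob_vector \<alpha>" and \<sigma>2: "\<And>i. 0 < \<sigma>2 i"
  shows "AE y in mwg_kernel \<alpha> \<sigma>2 x. y \<in> support"
proof -
  have "state_of \<in> mwg_step g C \<alpha> \<sigma>2 x \<rightarrow>\<^sub>M borel"
    using measurable_state_of sets_mwg_step(2)[OF \<alpha> \<sigma>2] by (simp cong: measurable_cong_sets)
  from AE_distr_iff[OF this, of "\<lambda>y. y \<in> support"] show ?thesis
    unfolding mwg_kernel_def using AE_mwg_step_support[OF assms] by simp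
qed

end

section \<open>Simultaneous uniform ergodicity\<close>

lemma AE_rwm_kernel_support:
  assumes g[measurable]: "g \<in> borel_measurable borel" and g0: "\<And>z. 0 \<le> g z" and x: "0 < g x"
  shows "AE y in rwm_kernel g x. 0 < g y"
proof -
  let ?G = "indicator {y. \<not> 0 < g y} :: real \<Rightarrow> ennreal"
  have [measurable]: "?G \<in> borel_measurable borel" by simp
  have "?G y * ennreal (accept_prob g x y) = 0" for y
  proof (cases "0 < g y")
    case False
    then have "g y = 0" using g0[of y] by simp
    then show ?thesis by (simp add: accept_prob_def)
  qed simp
  then have 0: "(\<integral>\<^sup>+y. ?G y \<partial>rwm_kernel g x) = 0"
    unfolding nn_integral_rwm_kernel[OF g g0 \<open>?G \<in> _\<close>] using x by (simp only:) simp
  have "?G \<in> borel_measurable (rwm_kernel g x)"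
    using prob_kernel(2)[OF measurable_rwm_kernel[OF g g0], of x] by (simp cong: measurable_cong_sets)
  from 0 nn_integral_0_iff_AE[OF this] have "AE y in rwm_kernel g x. ?G y = 0" by simp
  then show ?thesis by eventually_elim (simp split: split_indicator_asm)
qed

locale ergodic_mwg_target = mwg_target g C for g and C :: "'d::finite \<Rightarrow> real" +
  fixes D :: real
  assumes D_nonneg: "0 \<le> D"
    and bounded_support: "\<And>x y. 0 < g x \<Longrightarrow> 0 < g y \<Longrightarrow> \<bar>x - y\<bar> \<le> D"
    and rwm_ergodic: "uniformly_ergodic {z. 0 < g z} (rwm_kernel g) (density lborel g)"
begin

section \<open>The one-dimensional chain as comparison kernel\<close>

abbreviation rwm_power :: "nat \<Rightarrow> real \<Rightarrow> real measure" where
  "rwm_power \<equiv> kernel_power (density lborel g) (rwm_kernel g)"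

lemma rwm_measurable: "rwm_kernel g \<in> borel \<rightarrow>\<^sub>M prob_algebra borel"
  by (rule measurable_rwm_kernel[OF g_measurable g_nonneg])

lemma rwm_power_measurable: "rwm_power n \<in> borel \<rightarrow>\<^sub>M prob_algebra borel"
  by (rule measurable_kernel_power[OF rwm_measurable]) simp

lemma AE_rwm_power:
  assumes "0 < g z"
  shows "AE y in rwm_power n z. 0 < g y"
  using AE_kernel_power[OF rwm_measurable, of "density lborel g" "{z. 0 < g z}" z n] assms
    AE_rwm_kernel_support[OF g_measurable g_nonneg] by simp

text \<open>Runs the chain for \<open>g\<close> along coordinate \<open>i\<close> in the scale of
  \<open>g\<close> and divides by \<open>C i\<close> to return. It mediates between the sampler,
  which dominates a multiple of it, and \<open>resample\<close>, which it approximates for large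
  \<open>n\<close>.\<close>

definition coord_rwm :: "nat \<Rightarrow> 'd \<Rightarrow> (real^'d \<Rightarrow> ennreal) \<Rightarrow> real^'d \<Rightarrow> ennreal" where
  "coord_rwm n i G x = (\<integral>\<^sup>+z. G (coord_upd x i (z / C i)) \<partial>rwm_power n (C i * x $ i))"

lemma measurable_coord_rwm[measurable]:
  assumes [measurable]: "G \<in> borel_measurable borel"
  shows "coord_rwm n i G \<in> borel_measurable borel"
  unfolding coord_rwm_def
proof (rule nn_integral_measurable_subprob_algebra2)
  show "(\<lambda>(x, z). G (coord_upd x i (z / C i))) \<in> borel_measurable (borel \<Otimes>\<^sub>M borel)" by measurable
  show "(\<lambda>x. rwm_power n (C i * x $ i)) \<in> borel \<rightarrow>\<^sub>M subprob_algebra borel"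
    by (rule measurable_compose[OF _ measurable_prob_algebraD[OF rwm_power_measurable]]) measurable
qed

text \<open>In the scale of \<open>g\<close> the proposal has standard deviation
  \<open>C i * s\<close>, which lies in a fixed interval. Proposals farther than \<open>D\<close>
  leave the support and are rejected, so the integrand is constant there and
  \<open>normal_minorization\<close> applies.\<close>

lemma coord_step_minorization:
  assumes x: "x \<in> support" and G[measurable]: "G \<in> borel_measurable borel"
    and s: "0 < lo" "lo \<le> s" "s \<le> hi"
  shows "ennreal (minor_const (C i * lo) (C i * hi) (D + 1)) *
      (\<integral>\<^sup>+z. G (coord_upd x i (z / C i)) \<partial>rwm_kernel g (C i * x $ i)) \<le> coord_step i s G x"
proof -
  let ?x = "C i * x $ i"
  define F where "F y = G (coord_upd x i (y / C i)) * ennreal (accept_prob g ?x y) +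
      G x * ennreal (1 - accept_prob g ?x y)" for y
  have [measurable]: "F \<in> borel_measurable borel" unfolding F_def by measurable
  have gx: "0 < g ?x" using x by (simp add: support_def)
  have far: "F y = G x" if "D < \<bar>y - ?x\<bar>" for y
  proof -
    have "\<not> 0 < g y" using bounded_support[OF _ gx, of y] that by auto
    then have "g y = 0" using g_nonneg[of y] by simp
    then show ?thesis by (simp add: F_def accept_prob_def)
  qed
  have "(\<integral>\<^sup>+z. G (coord_upd x i (z / C i)) \<partial>rwm_kernel g ?x) =
      (\<integral>\<^sup>+y. ennreal (normal_density ?x 1 y) * F y \<partial>lborel)"
    using nn_integral_rwm_kernel[OF g_measurable g_nonneg, of "\<lambda>z. G (coord_upd x i (z / C i))" ?x] C_pos[of i]
    by (simp add: F_def)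
  moreover have "coord_step i s G x = (\<integral>\<^sup>+y. ennreal (normal_density ?x (C i * s) y) * F y \<partial>lborel)"
  proof -
    have "(\<integral>\<^sup>+y. ennreal (normal_density ?x (C i * s) y) * F y \<partial>lborel) =
      ennreal (C i) * (\<integral>\<^sup>+y. ennreal (normal_density ?x (C i * s) (C i * y)) * F (C i * y) \<partial>lborel)"
      by (rule nn_integral_scale) measurable
    also have "\<dots> = (\<integral>\<^sup>+y. ennreal (C i) * (ennreal (normal_density ?x (C i * s) (C i * y)) * F (C i * y)) \<partial>lborel)"
      by (rule nn_integral_cmult[symmetric]) measurable
    also have "\<dots> = (\<integral>\<^sup>+y. ennreal (normal_density (x $ i) s y) * F (C i * y) \<partial>lborel)"
    proof (rule nn_integral_cong)
      fix y
      have "ennreal (normal_density (x $ i) s y) = ennreal (C i) * ennreal (normal_density ?x (C i * s) (C i * y))"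
        using C_pos[of i] normal_density_scale[OF C_pos[of i], of "x $ i" s y]
        by (simp add: ennreal_mult[symmetric] mult.commute)
      then show "ennreal (C i) * (ennreal (normal_density ?x (C i * s) (C i * y)) * F (C i * y)) =
        ennreal (normal_density (x $ i) s y) * F (C i * y)" by (simp add: mult.assoc)
    qed
    also have "\<dots> = coord_step i s G x"
      using C_pos[of i] by (simp add: coord_step_def F_def accept_prob_marginal)
    finally show ?thesis ..
  qed
  ultimately show ?thesis
    using normal_minorization[of F D ?x "G x" "C i * lo" "C i * s" "C i * hi"] far D_nonneg s C_pos[of i]
    by simp
qed

lemma support_coord_upd: "x \<in> support \<Longrightarrow> 0 < g z \<Longrightarrow> coord_upd x i (z / C i) \<in> support"
  using C_pos[of i] by (auto simp: support_def)

text \<open>The one-step bound holds for every coordinate, so it can be iterated with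
  \<open>i\<close> kept fixed, as if the random scan had selected \<open>i\<close> each time. The
  bound is assumed on the support only, and the one-dimensional chain does not leave it.\<close>

lemma kernel_power_minorization:
  assumes P: "P \<in> borel \<rightarrow>\<^sub>M prob_algebra borel"
    and minor: "\<And>x i G. x \<in> support \<Longrightarrow> G \<in> borel_measurable borel \<Longrightarrow>
      c * (\<integral>\<^sup>+z. G (coord_upd x i (z / C i)) \<partial>rwm_kernel g (C i * x $ i)) \<le> (\<integral>\<^sup>+y. G y \<partial>P x)"
    and x: "x \<in> support" and G: "G \<in> borel_measurable borel"
  shows "c ^ n * coord_rwm n i G x \<le> (\<integral>\<^sup>+y. G y \<partial>kernel_power borel P n x)"
  using G
proof (induction n arbitrary: G)
  case 0
  have [measurable]: "(\<lambda>z. G (coord_upd x i (z / C i))) \<in> borel_measurable borel" using 0 by measurable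
  have "coord_rwm 0 i G x = G (coord_upd x i (C i * x $ i / C i))"
    unfolding coord_rwm_def by (rule nn_integral_kernel_power_0) auto
  then show ?case using 0 C_pos[of i] nn_integral_kernel_power_0[of borel borel x G P] by simp
next
  case (Suc n)
  note [measurable] = Suc.prems
  define H where "H y = (\<integral>\<^sup>+z. G z \<partial>P y)" for y
  have Hm[measurable]: "H \<in> borel_measurable borel"
    unfolding H_def by (rule measurable_nn_integral_kernel[OF P Suc.prems])
  define f where "f z = G (coord_upd x i (z / C i))" for z
  have fm[measurable]: "f \<in> borel_measurable borel" unfolding f_def by measurable
  let ?x = "C i * x $ i"
  have gx: "0 < g ?x" using x by (simp add: support_def)
  have "c ^ Suc n * coord_rwm (Suc n) i G x = c ^ Suc n * (\<integral>\<^sup>+y. (\<integral>\<^sup>+z. f z \<partial>rwm_kernel g y) \<partial>rwm_power n ?x)"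
    unfolding coord_rwm_def f_def[symmetric]
    by (subst nn_integral_kernel_power_Suc[OF rwm_measurable _ _ fm]) auto
  also have "\<dots> = c ^ n * (\<integral>\<^sup>+y. c * (\<integral>\<^sup>+z. f z \<partial>rwm_kernel g y) \<partial>rwm_power n ?x)"
  proof -
    have "(\<lambda>y. \<integral>\<^sup>+z. f z \<partial>rwm_kernel g y) \<in> borel_measurable (rwm_power n ?x)"
      using measurable_nn_integral_kernel[OF rwm_measurable fm]
        prob_kernel(2)[OF rwm_power_measurable, of ?x n] by (simp cong: measurable_cong_sets)
    then show ?thesis by (simp add: nn_integral_cmult mult_ac)
  qed
  also have "\<dots> \<le> c ^ n * coord_rwm n i H x"
    unfolding coord_rwm_def
  proof (intro mult_left_mono nn_integral_mono_AE)
    show "AE y in rwm_power n ?x. c * (\<integral>\<^sup>+z. f z \<partial>rwm_kernel g y) \<le> H (coord_upd x i (y / C i))"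
      using AE_rwm_power[OF gx]
    proof eventually_elim
      fix y assume y: "0 < g y"
      from minor[OF support_coord_upd[OF x y] Suc.prems, of i i]
      show "c * (\<integral>\<^sup>+z. f z \<partial>rwm_kernel g y) \<le> H (coord_upd x i (y / C i))"
        using C_pos[of i] by (simp add: H_def f_def)
    qed
  qed simp
  also have "\<dots> \<le> (\<integral>\<^sup>+y. H y \<partial>kernel_power borel P n x)" by (rule Suc.IH[OF Hm])
  also have "\<dots> = (\<integral>\<^sup>+y. G y \<partial>kernel_power borel P (Suc n) x)"
    unfolding H_def by (rule nn_integral_kernel_power_Suc[symmetric, OF P]) (auto simp: Suc.prems)
  finally show ?case .
qed

lemma measurable_foldr_coord_rwm:
  "G \<in> borel_measurable borel \<Longrightarrow> foldr (coord_rwm n) is G \<in> borel_measurable borel"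
  by (induction "is") (auto intro: measurable_coord_rwm)

lemma measurable_foldr_resample:
  "G \<in> borel_measurable borel \<Longrightarrow> foldr resample is G \<in> borel_measurable borel"
  by (induction "is") (auto intro: measurable_resample)

text \<open>Chains the blocks for the successive coordinates of the list. The head of the list is
  the block that is run first, in accordance with the nesting of operators in
  \<open>foldr\<close>.\<close>

lemma kernel_power_minorization_list:
  assumes P: "P \<in> borel \<rightarrow>\<^sub>M prob_algebra borel"
    and abs: "\<And>x. x \<in> support \<Longrightarrow> AE y in P x. y \<in> support"
    and minor: "\<And>x i G. x \<in> support \<Longrightarrow> G \<in> borel_measurable borel \<Longrightarrow>
      c * (\<integral>\<^sup>+z. G (coord_upd x i (z / C i)) \<partial>rwm_kernel g (C i * x $ i)) \<le> (\<integral>\<^sup>+y. G y \<partial>P x)"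
    and x: "x \<in> support" and G: "G \<in> borel_measurable borel"
  shows "c ^ (n * length is) * foldr (coord_rwm n) is G x \<le> (\<integral>\<^sup>+y. G y \<partial>kernel_power borel P (n * length is) x)"
  using x
proof (induction "is" arbitrary: x)
  case Nil
  then show ?case using nn_integral_kernel_power_0[of borel borel x G P] G by simp
next
  case (Cons i "is")
  define F where "F = foldr (coord_rwm n) is G"
  have Fm: "F \<in> borel_measurable borel" unfolding F_def by (rule measurable_foldr_coord_rwm[OF G])
  note K = prob_kernel[OF measurable_kernel_power[OF P, of borel n], of x, simplified]
  have FK: "F \<in> borel_measurable (kernel_power borel P n x)"
    using Fm K(2) by (simp cong: measurable_cong_sets)
  have "c ^ (n * length (i # is)) * foldr (coord_rwm n) (i # is) G x =
      c ^ (n * length is) * (c ^ n * coord_rwm n i F x)"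
    by (simp add: F_def power_add mult_ac)
  also have "\<dots> \<le> c ^ (n * length is) * (\<integral>\<^sup>+y. F y \<partial>kernel_power borel P n x)"
    by (intro mult_left_mono kernel_power_minorization[OF P minor Cons.prems Fm]) auto
  also have "\<dots> = (\<integral>\<^sup>+y. c ^ (n * length is) * F y \<partial>kernel_power borel P n x)"
    by (rule nn_integral_cmult[symmetric, OF FK])
  also have "\<dots> \<le> (\<integral>\<^sup>+y. (\<integral>\<^sup>+z. G z \<partial>kernel_power borel P (n * length is) y) \<partial>kernel_power borel P n x)"
    using AE_kernel_power[OF P refl support_sets abs Cons.prems, of n]
    by (intro nn_integral_mono_AE) (auto simp: F_def intro: Cons.IH elim!: eventually_mono)
  also have "\<dots> = (\<integral>\<^sup>+y. G y \<partial>kernel_power borel P (n * length (i # is)) x)"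
    using nn_integral_kernel_power_add[OF P, of x G n "n * length is"] G by simp
  finally show ?case .
qed

section \<open>Approximate resampling of all coordinates\<close>

lemma resample_le_1:
  assumes "\<And>x. G x \<le> 1"
  shows "resample i G x \<le> 1"
proof -
  have "resample i G x \<le> (\<integral>\<^sup>+z. ennreal (marginal i z) * 1 \<partial>lborel)"
    unfolding resample_def by (intro nn_integral_mono mult_left_mono assms) simp
  then show ?thesis by (simp add: nn_integral_marginal_1)
qed

lemma foldr_resample_le_1:
  assumes "\<And>x. G x \<le> 1"
  shows "foldr resample is G x \<le> 1"
  by (induction "is" arbitrary: x) (auto intro: assms resample_le_1)

lemma resample_le_coord_rwm:
  assumes tv: "\<And>z. 0 < g z \<Longrightarrow> tv_dist (rwm_power n z) (density lborel g) \<le> \<eta>"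
    and x: "x \<in> support" and G[measurable]: "G \<in> borel_measurable borel" and G1: "\<And>x. G x \<le> 1"
  shows "resample i G x \<le> coord_rwm n i G x + ennreal \<eta>"
proof -
  let ?x = "C i * x $ i"
  have gx: "0 < g ?x" using x by (simp add: support_def)
  note K = prob_kernel[OF rwm_power_measurable, of ?x n, simplified]
  have fm[measurable]: "(\<lambda>z. G (coord_upd x i (z / C i))) \<in> borel_measurable borel" by measurable
  have "prob_space (density lborel g)"
    by (rule prob_spaceI) (simp add: emeasure_density g_density)
  then have "(\<integral>\<^sup>+z. G (coord_upd x i (z / C i)) \<partial>density lborel g) \<le> coord_rwm n i G x + ennreal \<eta>"
    unfolding coord_rwm_def
    by (intro nn_integral_le_add_tv_dist K tv gx) (use K fm G1 in \<open>auto cong: measurable_cong_sets\<close>)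
  also have "(\<integral>\<^sup>+z. G (coord_upd x i (z / C i)) \<partial>density lborel g) = resample i G x"
    unfolding resample_def by (simp add: nn_integral_density nn_integral_marginal)
  finally show ?thesis .
qed

text \<open>The errors add up without amplification: each operator is an average, so an earlier
  error passes through unchanged, and the function that is resampled next is still bounded by
  1.\<close>

lemma foldr_resample_le_coord_rwm:
  assumes tv: "\<And>z. 0 < g z \<Longrightarrow> tv_dist (rwm_power n z) (density lborel g) \<le> \<eta>" and \<eta>: "0 \<le> \<eta>"
    and x: "x \<in> support" and G: "G \<in> borel_measurable borel" and G1: "\<And>x. G x \<le> 1"
  shows "foldr resample is G x \<le> foldr (coord_rwm n) is G x + ennreal (real (length is) * \<eta>)"
  using x
proof (induction "is" arbitrary: x)
  case (Cons i "is")
  define F where "F = foldr resample is G"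
  define F' where "F' = foldr (coord_rwm n) is G"
  have F: "F \<in> borel_measurable borel" "\<And>x. F x \<le> 1"
    unfolding F_def by (auto intro: measurable_foldr_resample[OF G] foldr_resample_le_1 G1)
  have F'[measurable]: "F' \<in> borel_measurable borel"
    unfolding F'_def by (auto intro: measurable_foldr_coord_rwm[OF G])
  let ?x = "C i * x $ i"
  have gx: "0 < g ?x" using Cons.prems by (simp add: support_def)
  note K = prob_kernel[OF rwm_power_measurable, of ?x n, simplified]
  interpret K: prob_space "rwm_power n ?x" by (rule K)
  have "(\<lambda>z. F' (coord_upd x i (z / C i))) \<in> borel_measurable borel" by measurable
  then have m: "(\<lambda>z. F' (coord_upd x i (z / C i))) \<in> borel_measurable (rwm_power n ?x)"
    using K(2) by (simp cong: measurable_cong_sets)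
  have "resample i F x \<le> coord_rwm n i F x + ennreal \<eta>"
    by (rule resample_le_coord_rwm[OF tv Cons.prems F])
  also have "coord_rwm n i F x \<le> (\<integral>\<^sup>+z. F' (coord_upd x i (z / C i)) + ennreal (real (length is) * \<eta>) \<partial>rwm_power n ?x)"
    unfolding coord_rwm_def using AE_rwm_power[OF gx, of n]
    by (intro nn_integral_mono_AE)
      (auto simp: F_def F'_def intro!: Cons.IH support_coord_upd Cons.prems elim!: eventually_mono)
  also have "\<dots> = coord_rwm n i F' x + ennreal (real (length is) * \<eta>)"
    using m by (simp add: nn_integral_add coord_rwm_def K.emeasure_space_1)
  finally have "resample i F x \<le> coord_rwm n i F' x + (ennreal (real (length is) * \<eta>) + ennreal \<eta>)"
    by (simp add: add_right_mono add.assoc)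
  also have "ennreal (real (length is) * \<eta>) + ennreal \<eta> = ennreal (real (length (i # is)) * \<eta>)"
    using \<eta> by (simp add: ennreal_plus[symmetric] distrib_right add.commute del: ennreal_plus)
  finally show ?case by (simp add: F_def F'_def)
qed simp

lemma nn_integral_foldr_resample:
  assumes "G \<in> borel_measurable borel"
  shows "(\<integral>\<^sup>+x. foldr resample is G x \<partial>product_target g C) = (\<integral>\<^sup>+x. G x \<partial>product_target g C)"
  by (induction "is") (simp_all add: nn_integral_resample measurable_foldr_resample[OF assms])

text \<open>Resampling a coordinate forgets its initial value.\<close>

lemma foldr_resample_cong:
  assumes "\<And>k. k \<notin> set is \<Longrightarrow> x $ k = x' $ k"
  shows "foldr resample is G x = foldr resample is G x'"
  using assms
proof (induction "is" arbitrary: x x')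
  case Nil
  then have "x = x'" by (simp add: vec_eq_iff)
  then show ?case by simp
next
  case (Cons i "is")
  have "foldr resample is G (coord_upd x i z) = foldr resample is G (coord_upd x' i z)" for z
    by (rule Cons.IH) (use Cons.prems in auto)
  then show ?case unfolding foldr.simps comp_def resample_def[of i] by simp
qed

text \<open>Once every coordinate has been resampled the result is a constant function. Stationarity
  gives it the same \<pi>-integral as \<open>G\<close>, which identifies the constant without
  unfolding \<pi> into an iterated integral.\<close>

lemma foldr_resample_all:
  assumes "set is = (UNIV :: 'd set)" and G: "G \<in> borel_measurable borel"
  shows "foldr resample is G x = (\<integral>\<^sup>+x. G x \<partial>product_target g C)"
proof -
  interpret \<pi>: prob_space "product_target g C" by (rule prob_space_product_target)
  have "(\<integral>\<^sup>+x. G x \<partial>product_target g C) = (\<integral>\<^sup>+y. foldr resample is G y \<partial>product_target g C)"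
    by (rule nn_integral_foldr_resample[OF G, symmetric])
  also have "\<dots> = (\<integral>\<^sup>+y. foldr resample is G x \<partial>product_target g C)"
    by (intro nn_integral_cong foldr_resample_cong) (use assms in auto)
  also have "\<dots> = foldr resample is G x" using \<pi>.emeasure_space_1 by simp
  finally show ?thesis ..
qed

text \<open>The defect carries the same factor \<open>c ^ (n * length is)\<close> as the main term.
  Therefore it can be kept a fixed fraction of it, however small that factor is.\<close>

lemma kernel_power_ge_target:
  assumes P: "P \<in> borel \<rightarrow>\<^sub>M prob_algebra borel"
    and abs: "\<And>x. x \<in> support \<Longrightarrow> AE y in P x. y \<in> support"
    and minor: "\<And>x i G. x \<in> support \<Longrightarrow> G \<in> borel_measurable borel \<Longrightarrow>
      c * (\<integral>\<^sup>+z. G (coord_upd x i (z / C i)) \<partial>rwm_kernel g (C i * x $ i)) \<le> (\<integral>\<^sup>+y. G y \<partial>P x)"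
    and tv: "\<And>z. 0 < g z \<Longrightarrow> tv_dist (rwm_power n z) (density lborel g) \<le> \<eta>" and \<eta>: "0 \<le> \<eta>"
    and l: "set is = (UNIV :: 'd set)"
    and x: "x \<in> support" and G: "G \<in> borel_measurable borel" and G1: "\<And>x. G x \<le> 1"
  shows "c ^ (n * length is) * (\<integral>\<^sup>+x. G x \<partial>product_target g C) \<le>
    (\<integral>\<^sup>+y. G y \<partial>kernel_power borel P (n * length is) x) + c ^ (n * length is) * ennreal (real (length is) * \<eta>)"
proof -
  have "c ^ (n * length is) * (\<integral>\<^sup>+x. G x \<partial>product_target g C) \<le>
    c ^ (n * length is) * (foldr (coord_rwm n) is G x + ennreal (real (length is) * \<eta>))"
    using foldr_resample_le_coord_rwm[OF tv \<eta> x G G1, of "is"] foldr_resample_all[OF l G]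
    by (intro mult_left_mono) auto
  also have "\<dots> \<le> (\<integral>\<^sup>+y. G y \<partial>kernel_power borel P (n * length is) x) +
      c ^ (n * length is) * ennreal (real (length is) * \<eta>)"
    unfolding distrib_left
    by (rule add_right_mono, rule kernel_power_minorization_list[OF P abs minor x G])
  finally show ?thesis .
qed

text \<open>The lower bound is applied to \<open>u\<close> at \<open>y\<close> and to
  \<open>1 - u\<close> at \<open>x\<close>. The two main terms add up to \<open>c ^ N\<close>, and
  each loses at most \<open>c ^ N / 4\<close>.\<close>

lemma kernel_power_contraction:
  fixes c :: real
  assumes P: "P \<in> borel \<rightarrow>\<^sub>M prob_algebra borel"
    and abs: "\<And>x. x \<in> support \<Longrightarrow> AE y in P x. y \<in> support"
    and minor: "\<And>x i G. x \<in> support \<Longrightarrow> G \<in> borel_measurable borel \<Longrightarrow>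
      ennreal c * (\<integral>\<^sup>+z. G (coord_upd x i (z / C i)) \<partial>rwm_kernel g (C i * x $ i)) \<le> (\<integral>\<^sup>+y. G y \<partial>P x)"
    and c: "0 \<le> c"
    and tv: "\<And>z. 0 < g z \<Longrightarrow> tv_dist (rwm_power n z) (density lborel g) \<le> \<eta>" and \<eta>: "0 \<le> \<eta>"
    and l: "set is = (UNIV :: 'd set)" "real (length is) * \<eta> \<le> 1/4" and N: "N = n * length is"
    and u: "u \<in> borel_measurable borel" "\<And>x. 0 \<le> u x" "\<And>x. u x \<le> (1::real)"
    and x: "x \<in> support" and y: "y \<in> support"
  shows "(\<integral>z. u z \<partial>kernel_power borel P N x) \<le> (\<integral>z. u z \<partial>kernel_power borel P N y) + (1 - c ^ N / 2)"
proof -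
  interpret \<pi>: prob_space "product_target g C" by (rule prob_space_product_target)
  have lower: "c ^ N * (\<integral>z. v z \<partial>product_target g C) \<le> (\<integral>z. v z \<partial>kernel_power borel P N w) + c ^ N * (1/4)"
    if v: "v \<in> borel_measurable borel" "\<And>x. 0 \<le> v x" "\<And>x. v x \<le> (1::real)" and w: "w \<in> support" for v w
  proof -
    note K = prob_kernel[OF measurable_kernel_power[OF P, of borel N], of w, simplified]
    interpret K: prob_space "kernel_power borel P N w" by (rule K)
    have vK: "v \<in> borel_measurable (kernel_power borel P N w)" "v \<in> borel_measurable (product_target g C)"
      using v(1) K(2) by (simp_all cong: measurable_cong_sets)
    have "ennreal c ^ N * (\<integral>\<^sup>+x. ennreal (v x) \<partial>product_target g C) \<le>
      (\<integral>\<^sup>+y. ennreal (v y) \<partial>kernel_power borel P N w) + ennreal c ^ N * ennreal (real (length is) * \<eta>)"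
      unfolding N using v by (intro kernel_power_ge_target[OF P abs minor tv \<eta> l(1) w]) auto
    also have "\<dots> \<le> (\<integral>\<^sup>+y. ennreal (v y) \<partial>kernel_power borel P N w) + ennreal c ^ N * ennreal (1/4)"
      using l(2) by (intro add_left_mono mult_left_mono ennreal_leI) auto
    also have "(\<integral>\<^sup>+y. ennreal (v y) \<partial>kernel_power borel P N w) = ennreal (\<integral>y. v y \<partial>kernel_power borel P N w)"
      by (rule nn_integral_eq_integral[OF K.integrable_01[OF vK(1)]]) (use v in auto)
    also have "(\<integral>\<^sup>+x. ennreal (v x) \<partial>product_target g C) = ennreal (\<integral>x. v x \<partial>product_target g C)"
      by (rule nn_integral_eq_integral[OF \<pi>.integrable_01[OF vK(2)]]) (use v in auto)
    also have "ennreal c ^ N * ennreal (\<integral>x. v x \<partial>product_target g C) = ennreal (c ^ N * (\<integral>x. v x \<partial>product_target g C))"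
      using c v by (simp add: ennreal_power ennreal_mult integral_nonneg_AE)
    also have "ennreal c ^ N * ennreal (1/4) = ennreal (c ^ N * (1/4))"
      unfolding ennreal_power[OF c] by (rule ennreal_mult[symmetric]) (use c in auto)
    also have "ennreal (\<integral>y. v y \<partial>kernel_power borel P N w) + ennreal (c ^ N * (1/4)) =
        ennreal ((\<integral>y. v y \<partial>kernel_power borel P N w) + c ^ N * (1/4))"
      using c v by (intro ennreal_plus[symmetric]) (auto intro!: integral_nonneg_AE)
    finally show ?thesis
      using c v by (subst (asm) ennreal_le_iff) (auto intro!: add_nonneg_nonneg integral_nonneg_AE)
  qed
  note K = prob_kernel[OF measurable_kernel_power[OF P, of borel N], of x, simplified]
  interpret K: prob_space "kernel_power borel P N x" by (rule K)
  have uK: "u \<in> borel_measurable (kernel_power borel P N x)" "u \<in> borel_measurable (product_target g C)"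
    using u(1) K(2) by (simp_all cong: measurable_cong_sets)
  have "c ^ N * (\<integral>z. 1 - u z \<partial>product_target g C) \<le> (\<integral>z. 1 - u z \<partial>kernel_power borel P N x) + c ^ N * (1/4)"
    by (rule lower) (use u x in auto)
  also have "(\<integral>z. 1 - u z \<partial>product_target g C) = 1 - (\<integral>z. u z \<partial>product_target g C)"
    using \<pi>.integrable_01[OF uK(2) u(2,3)] \<pi>.prob_space by simp
  also have "(\<integral>z. 1 - u z \<partial>kernel_power borel P N x) = 1 - (\<integral>z. u z \<partial>kernel_power borel P N x)"
    using K.integrable_01[OF uK(1) u(2,3)] K.prob_space by simp
  finally show ?thesis using lower[OF u y] by (simp add: right_diff_distrib)
qed

text \<open>A bound on the oscillation between two starting points becomes a bound on the distance
  to \<pi> by averaging the second point over \<pi>, which stationarity turns into the integral of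
  \<open>u\<close>.\<close>

lemma kernel_power_converges:
  fixes c :: real
  assumes P: "P \<in> borel \<rightarrow>\<^sub>M prob_algebra borel"
    and abs: "\<And>x. x \<in> support \<Longrightarrow> AE y in P x. y \<in> support"
    and minor: "\<And>x i G. x \<in> support \<Longrightarrow> G \<in> borel_measurable borel \<Longrightarrow>
      ennreal c * (\<integral>\<^sup>+z. G (coord_upd x i (z / C i)) \<partial>rwm_kernel g (C i * x $ i)) \<le> (\<integral>\<^sup>+y. G y \<partial>P x)"
    and c: "0 \<le> c" "c \<le> 1"
    and stat: "\<And>f. f \<in> borel_measurable borel \<Longrightarrow>
      (\<integral>\<^sup>+x. (\<integral>\<^sup>+y. f y \<partial>P x) \<partial>product_target g C) = (\<integral>\<^sup>+x. f x \<partial>product_target g C)"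
    and tv: "\<And>z. 0 < g z \<Longrightarrow> tv_dist (rwm_power n z) (density lborel g) \<le> \<eta>" and \<eta>: "0 \<le> \<eta>"
    and l: "set is = (UNIV :: 'd set)" "real (length is) * \<eta> \<le> 1/4" and N: "N = n * length is"
    and u: "u \<in> borel_measurable borel" "\<And>x. 0 \<le> u x" "\<And>x. u x \<le> (1::real)"
    and x: "x \<in> support"
  shows "(\<integral>\<^sup>+z. u z \<partial>kernel_power borel P (k * N) x) \<le>
    (\<integral>\<^sup>+z. u z \<partial>product_target g C) + ennreal ((1 - c ^ N / 2) ^ k)"
proof -
  interpret \<pi>: prob_space "product_target g C" by (rule prob_space_product_target)
  define r where "r = 1 - c ^ N / 2"
  have r: "0 \<le> r" using c power_le_one[of c N] by (simp add: r_def)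
  have osc: "(\<integral>z. u z \<partial>kernel_power borel P (k * N) x) \<le> (\<integral>z. u z \<partial>kernel_power borel P (k * N) y) + r ^ k"
    if y: "y \<in> support" for y
  proof -
    have "(\<integral>z. u z \<partial>kernel_power borel (kernel_power borel P N) k x) \<le>
       (\<integral>z. u z \<partial>kernel_power borel (kernel_power borel P N) k y) + r ^ k"
    proof (rule dobrushin_contraction[OF measurable_kernel_power[OF P refl] support_sets _ r _ u x y])
      show "AE y in kernel_power borel P N x. y \<in> support" if "x \<in> support" for x
        by (rule AE_kernel_power[OF P refl support_sets abs that])
    qed (unfold r_def, rule kernel_power_contraction[OF P abs minor c(1) tv \<eta> l N])
    then show ?thesis by (simp add: kernel_power_mult[OF P])
  qed
  have nn: "(\<integral>\<^sup>+z. u z \<partial>kernel_power borel P (k * N) y) = ennreal (\<integral>z. u z \<partial>kernel_power borel P (k * N) y)" for y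
  proof -
    note K = prob_kernel[OF measurable_kernel_power[OF P, of borel "k * N"], of y, simplified]
    interpret K: prob_space "kernel_power borel P (k * N) y" by (rule K)
    have uK: "u \<in> borel_measurable (kernel_power borel P (k * N) y)"
      using u(1) K(2) by (simp cong: measurable_cong_sets)
    show ?thesis by (rule nn_integral_eq_integral[OF K.integrable_01[OF uK]]) (use u in auto)
  qed
  have "(\<integral>\<^sup>+z. u z \<partial>kernel_power borel P (k * N) x) =
      (\<integral>\<^sup>+y. (\<integral>\<^sup>+z. u z \<partial>kernel_power borel P (k * N) x) \<partial>product_target g C)"
    using \<pi>.emeasure_space_1 by simp
  also have "\<dots> \<le> (\<integral>\<^sup>+y. (\<integral>\<^sup>+z. u z \<partial>kernel_power borel P (k * N) y) + ennreal (r ^ k) \<partial>product_target g C)"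
    using AE_support
  proof (intro nn_integral_mono_AE, eventually_elim)
    fix y assume "y \<in> support"
    from osc[OF this] have "ennreal (\<integral>z. u z \<partial>kernel_power borel P (k * N) x) \<le>
        ennreal ((\<integral>z. u z \<partial>kernel_power borel P (k * N) y) + r ^ k)" by (rule ennreal_leI)
    also have "\<dots> = ennreal (\<integral>z. u z \<partial>kernel_power borel P (k * N) y) + ennreal (r ^ k)"
      using u r by (intro ennreal_plus integral_nonneg_AE) auto
    finally show "(\<integral>\<^sup>+z. u z \<partial>kernel_power borel P (k * N) x) \<le>
      (\<integral>\<^sup>+z. u z \<partial>kernel_power borel P (k * N) y) + ennreal (r ^ k)" unfolding nn .
  qed
  also have "\<dots> = (\<integral>\<^sup>+y. (\<integral>\<^sup>+z. u z \<partial>kernel_power borel P (k * N) y) \<partial>product_target g C) + ennreal (r ^ k)"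
  proof -
    have "(\<lambda>y. \<integral>\<^sup>+z. u z \<partial>kernel_power borel P (k * N) y) \<in> borel_measurable (product_target g C)"
      using measurable_nn_integral_kernel[OF measurable_kernel_power[OF P refl, of "k * N"], of u] u(1)
      by (simp cong: measurable_cong_sets)
    then show ?thesis using \<pi>.emeasure_space_1 by (simp add: nn_integral_add)
  qed
  also have "(\<integral>\<^sup>+y. (\<integral>\<^sup>+z. u z \<partial>kernel_power borel P (k * N) y) \<partial>product_target g C) = (\<integral>\<^sup>+z. u z \<partial>product_target g C)"
    by (rule nn_integral_stationary_kernel_power[OF P _ stat]) (use u in auto)
  finally show ?thesis unfolding r_def .
qed

section \<open>Constants uniform over all variances in [lo, hi]\<close>

lemma selection_prob_lower_bound:
  assumes "\<And>i. a i \<noteq> 0" and "0 < lo" "\<And>i. lo \<le> \<sigma>2 i" "\<And>i. \<sigma>2 i \<le> hi"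
  shows "sqrt (lo * (a i)\<^sup>2) / (\<Sum>k\<in>UNIV. sqrt (hi * (a k)\<^sup>2)) \<le> selection_prob a \<sigma>2 (i::'d)"
proof -
  have pos: "0 < \<sigma>2 k" for k using assms(2) assms(3)[of k] by linarith
  then have "0 < (\<Sum>k\<in>UNIV. sqrt (\<sigma>2 k * (a k)\<^sup>2))" using assms by (intro sum_pos) auto
  then show ?thesis unfolding selection_prob_def
    using assms by (intro frac_le sum_mono real_sqrt_le_mono mult_right_mono) (auto simp: less_imp_le[OF pos])
qed

lemma uniform_minorization:
  assumes a: "\<forall>i. a i \<noteq> 0" and lo: "0 < lo" "lo \<le> hi"
  obtains c where "0 < c" "c \<le> 1" "\<forall>\<sigma>2 x i G. (\<forall>i. lo \<le> \<sigma>2 i \<and> \<sigma>2 i \<le> hi) \<longrightarrow> x \<in> support \<longrightarrow>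
      G \<in> borel_measurable borel \<longrightarrow>
      ennreal c * (\<integral>\<^sup>+z. G (coord_upd x i (z / C i)) \<partial>rwm_kernel g (C i * x $ i)) \<le>
        (\<integral>\<^sup>+y. G y \<partial>mwg_kernel (selection_prob a \<sigma>2) \<sigma>2 x)"
proof -
  \<comment> \<open>The smallest possible probability of selecting \<open>i\<close>, times the
    factor by which its update dominates a step of the one-dimensional chain.\<close>
  define e where "e i = sqrt (lo * (a i)\<^sup>2) / (\<Sum>k\<in>UNIV. sqrt (hi * (a k)\<^sup>2)) *
      minor_const (C i * sqrt lo) (C i * sqrt hi) (D + 1)" for i
  have sp: "0 < (\<Sum>k\<in>UNIV. sqrt (hi * (a k)\<^sup>2))" using a lo by (intro sum_pos) auto
  have e: "0 < e i" for i
    unfolding e_def using a lo sp C_pos[of i]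
    by (intro mult_pos_pos divide_pos_pos minor_const_pos) auto
  \<comment> \<open>The minimum is over finitely many coordinates, hence positive. The cap at 1
    makes \<open>1 - c ^ N / 2\<close> nonnegative.\<close>
  define c where "c = min 1 (Min (range e))"
  have c: "0 < c" "c \<le> 1" "\<And>i. c \<le> e i"
    using e by (auto simp: c_def min.coboundedI2)
  show thesis
  proof (rule that[OF c(1,2)], intro allI impI)
    fix \<sigma>2 :: "'d \<Rightarrow> real" and x i and G :: "real^'d \<Rightarrow> ennreal"
    assume \<sigma>: "\<forall>i. lo \<le> \<sigma>2 i \<and> \<sigma>2 i \<le> hi" and x: "x \<in> support" and G: "G \<in> borel_measurable borel"
    have pos: "0 < \<sigma>2 i" for i using \<sigma>[rule_format, of i] lo by linarith
    let ?\<alpha> = "selection_prob a \<sigma>2"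
    let ?k = "minor_const (C i * sqrt lo) (C i * sqrt hi) (D + 1)"
    let ?I = "\<integral>\<^sup>+z. G (coord_upd x i (z / C i)) \<partial>rwm_kernel g (C i * x $ i)"
    have k: "0 < ?k" using C_pos[of i] lo by (intro minor_const_pos) auto
    have pv: "prob_vector ?\<alpha>" by (rule prob_vector_selection_prob[OF a[rule_format] pos])
    have "sqrt (lo * (a i)\<^sup>2) / (\<Sum>k\<in>UNIV. sqrt (hi * (a k)\<^sup>2)) \<le> ?\<alpha> i"
      by (rule selection_prob_lower_bound) (use a lo \<sigma> in auto)
    then have "e i \<le> ?\<alpha> i * ?k" unfolding e_def using k by (intro mult_right_mono) auto
    then have "c \<le> ?\<alpha> i * ?k" using c(3)[of i] by simp
    then have "ennreal c * ?I \<le> ennreal (?\<alpha> i * ?k) * ?I" by (intro mult_right_mono ennreal_leI) auto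
    also have "\<dots> = ennreal (?\<alpha> i) * (ennreal ?k * ?I)"
      using k pv by (simp add: ennreal_mult prob_vector_def mult.assoc)
    also have "\<dots> \<le> ennreal (?\<alpha> i) * coord_step i (sqrt (\<sigma>2 i)) G x"
      by (intro mult_left_mono coord_step_minorization[OF x G]) (use lo \<sigma> in auto)
    also have "\<dots> \<le> (\<Sum>i\<in>UNIV. ennreal (?\<alpha> i) * coord_step i (sqrt (\<sigma>2 i)) G x)"
      by (rule member_le_sum) auto
    also have "\<dots> = (\<integral>\<^sup>+y. G y \<partial>mwg_kernel ?\<alpha> \<sigma>2 x)"
      unfolding nn_integral_mwg_kernel[OF G pv pos] nn_integral_mwg_step_state[OF G pos] ..
    finally show "ennreal c * ?I \<le> (\<integral>\<^sup>+y. G y \<partial>mwg_kernel ?\<alpha> \<sigma>2 x)" .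
  qed
qed

proposition simultaneous_uniform_ergodicity:
  assumes a: "\<forall>i. a i \<noteq> 0" and lo: "0 < lo" "lo \<le> hi"
  obtains N r where "0 \<le> r" "r < 1"
    "\<forall>\<sigma>2 x u k. (\<forall>i. lo \<le> \<sigma>2 i \<and> \<sigma>2 i \<le> hi) \<longrightarrow> x \<in> support \<longrightarrow> u \<in> borel_measurable borel \<longrightarrow>
      (\<forall>z. 0 \<le> u z \<and> u z \<le> (1::real)) \<longrightarrow>
      (\<integral>\<^sup>+z. u z \<partial>kernel_power borel (mwg_kernel (selection_prob a \<sigma>2) \<sigma>2) (k * N) x) \<le>
        (\<integral>\<^sup>+z. u z \<partial>product_target g C) + ennreal (r ^ k)"
proof -
  obtain c where c: "0 < c" "c \<le> 1" and minor: "\<forall>\<sigma>2 x i G. (\<forall>i. lo \<le> \<sigma>2 i \<and> \<sigma>2 i \<le> hi) \<longrightarrow> x \<in> support \<longrightarrow>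
      G \<in> borel_measurable borel \<longrightarrow>
      ennreal c * (\<integral>\<^sup>+z. G (coord_upd x i (z / C i)) \<partial>rwm_kernel g (C i * x $ i)) \<le>
        (\<integral>\<^sup>+y. G y \<partial>mwg_kernel (selection_prob a \<sigma>2) \<sigma>2 x)"
    by (rule uniform_minorization[OF a lo]) (rule that)
  obtain "is" :: "'d list" where l: "set is = UNIV" using finite_list[of "UNIV :: 'd set"] by auto
  \<comment> \<open>\<open>d\<close> is the length of a list that covers all coordinates, possibly
    with repetitions. Replacing each of its Gibbs updates by \<open>n\<close> steps of the chain may
    cost \<open>1 / (4 * d)\<close>, 1/4 in total. This \<open>n\<close> depends on the
    one-dimensional chain and on \<open>d\<close>, not on the variances.\<close>
  define d where "d = real (length is)"
  have d: "0 < d" using l by (cases "is") (auto simp: d_def)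
  obtain K \<rho> where \<rho>: "0 \<le> \<rho>" "\<rho> < 1" and tv: "\<And>x n. 0 < g x \<Longrightarrow> tv_dist (rwm_power n x) (density lborel g) \<le> K * \<rho> ^ n"
    using rwm_ergodic unfolding uniformly_ergodic_def by auto
  have "(\<lambda>n. K * \<rho> ^ n) \<longlonglongrightarrow> K * 0" by (intro tendsto_mult tendsto_const LIMSEQ_power_zero) (use \<rho> in auto)
  then have "eventually (\<lambda>n. K * \<rho> ^ n < 1 / (4 * d)) sequentially" using d by (intro order_tendstoD) auto
  then obtain n where n: "K * \<rho> ^ n < 1 / (4 * d)" by (auto simp: eventually_sequentially)
  have tv': "tv_dist (rwm_power n z) (density lborel g) \<le> 1 / (4 * d)" if "0 < g z" for z
    using tv[OF that, of n] n by linarith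
  have l': "real (length is) * (1 / (4 * d)) \<le> 1/4" using d by (simp add: d_def)
  define N where "N = n * length is"
  have cN: "0 < c ^ N" "c ^ N \<le> 1" using c by (auto intro: power_le_one)
  show thesis
  proof (rule that[of "1 - c ^ N / 2" N], goal_cases)
    case 3
    show ?case
    proof (intro allI impI)
    fix \<sigma>2 :: "'d \<Rightarrow> real" and x k and u :: "real^'d \<Rightarrow> real"
    assume \<sigma>: "\<forall>i. lo \<le> \<sigma>2 i \<and> \<sigma>2 i \<le> hi" and x: "x \<in> support" and u: "u \<in> borel_measurable borel"
      "\<forall>z. 0 \<le> u z \<and> u z \<le> 1"
    have pos: "0 < \<sigma>2 i" for i using \<sigma>[rule_format, of i] lo by linarith
    have pv: "prob_vector (selection_prob a \<sigma>2)" by (rule prob_vector_selection_prob[OF a[rule_format] pos])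
    have minor': "ennreal c * (\<integral>\<^sup>+z. G (coord_upd x i (z / C i)) \<partial>rwm_kernel g (C i * x $ i)) \<le>
        (\<integral>\<^sup>+y. G y \<partial>mwg_kernel (selection_prob a \<sigma>2) \<sigma>2 x)"
      if "x \<in> support" "G \<in> borel_measurable borel" for x i G
      using minor \<sigma> that by blast
    show "(\<integral>\<^sup>+z. u z \<partial>kernel_power borel (mwg_kernel (selection_prob a \<sigma>2) \<sigma>2) (k * N) x) \<le>
        (\<integral>\<^sup>+z. u z \<partial>product_target g C) + ennreal ((1 - c ^ N / 2) ^ k)"
      by (rule kernel_power_converges[OF measurable_mwg_kernel[OF pv pos] AE_mwg_kernel_support[OF _ pv pos]
            minor' less_imp_le[OF c(1)] c(2) nn_integral_stationary_mwg_kernel[OF _ pv pos]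
            tv' _ l l' N_def u(1) _ _ x]) (use d u(2) in auto)
    qed
  qed (use cN in auto)
qed

end

section \<open>Adaptive chains\<close>

text \<open>A bound in one direction is enough, since passing to complements reverses it.\<close>

lemma tv_dist_le:
  assumes M: "prob_space M" and N: "prob_space N" and s: "sets M = sets N"
    and le: "\<And>A. A \<in> sets M \<Longrightarrow> measure M A \<le> measure N A + e"
  shows "tv_dist M N \<le> e"
  unfolding tv_dist_def
proof (rule cSUP_least)
  show "sets M \<noteq> {}" by auto
  fix A assume A: "A \<in> sets M"
  have "measure M (space M - A) = 1 - measure M A" by (rule prob_space.prob_compl[OF M A])
  moreover have "measure N (space M - A) = 1 - measure N A"
    using prob_space.prob_compl[OF N, of A] A s sets_eq_imp_space_eq[OF s] by simp
  moreover have "measure M (space M - A) \<le> measure N (space M - A) + e" by (rule le) (use A in auto)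
  ultimately show "\<bar>measure M A - measure N A\<bar> \<le> e" using le[OF A] by linarith
qed

lemma tv_dist_nonneg:
  assumes "prob_space M" "prob_space N"
  shows "0 \<le> tv_dist M N"
  using abs_measure_diff_le_tv_dist[OF assms sets.empty_sets] by simp

section \<open>Sensitivity of one step to the variances\<close>

lemma sqrt_perturb:
  assumes "0 \<le> t" "0 \<le> a" "0 \<le> b" "(1 - t) * a \<le> b"
  shows "(1 - t) * sqrt a \<le> sqrt b"
proof (cases "t \<le> 1")
  case True
  \<comment> \<open>A factor in [0, 1] is at least its own square, so the relative change of a
    standard deviation is no worse than that of the variance.\<close>
  then have "(1 - t) * sqrt a = sqrt ((1 - t)\<^sup>2 * a)" by (simp add: real_sqrt_mult)
  also have "(1 - t)\<^sup>2 * a \<le> (1 - t) * a"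
    using True assms by (intro mult_right_mono) (auto simp: power2_eq_square mult_left_le)
  then have "sqrt ((1 - t)\<^sup>2 * a) \<le> sqrt b" using assms by (intro real_sqrt_le_mono) simp
  finally show ?thesis .
next
  case False
  then have "(1 - t) * sqrt a \<le> 0" using assms by (intro mult_nonpos_nonneg) auto
  also have "0 \<le> sqrt b" using assms by simp
  finally show ?thesis .
qed

text \<open>Numerator and normalising sum each cost at most a factor \<open>sqrt (1 - t)\<close>,
  together \<open>1 - t\<close>. Both directions of closeness are needed because the sum stands in
  the denominator. For \<open>t \<ge> 1\<close> the left side is not positive.\<close>

lemma selection_prob_perturb:
  assumes a: "\<forall>i. a i \<noteq> 0" and pos: "\<And>i. 0 < v i" "\<And>i. 0 < w i"
    and t: "\<And>i. (1 - t) * w i \<le> v i" "\<And>i. (1 - t) * v i \<le> w i"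
  shows "(1 - t) * selection_prob a w i \<le> selection_prob a v i"
proof -
  have W: "0 < (\<Sum>k\<in>UNIV. sqrt (w k * (a k)\<^sup>2))" "0 < (\<Sum>k\<in>UNIV. sqrt (v k * (a k)\<^sup>2))"
    using a pos by (auto intro!: sum_pos)
  have pv: "0 \<le> selection_prob a w i" "0 \<le> selection_prob a v i"
    using prob_vector_selection_prob[of a] a pos unfolding prob_vector_def by blast+
  show ?thesis
  proof (cases "t < 1")
    case True
    define r where "r = sqrt (1 - t)"
    have r: "0 < r" "r * r = 1 - t" using True by (auto simp: r_def)
    have 1: "r * sqrt (w k * (a k)\<^sup>2) \<le> sqrt (v k * (a k)\<^sup>2)"
      "r * sqrt (v k * (a k)\<^sup>2) \<le> sqrt (w k * (a k)\<^sup>2)" for k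
      using mult_right_mono[OF t(1)[of k], of "(a k)\<^sup>2"] mult_right_mono[OF t(2)[of k], of "(a k)\<^sup>2"]
      unfolding r_def real_sqrt_mult[symmetric] by (auto simp: mult.assoc)
    have 2: "r * (\<Sum>k\<in>UNIV. sqrt (v k * (a k)\<^sup>2)) \<le> (\<Sum>k\<in>UNIV. sqrt (w k * (a k)\<^sup>2))"
      unfolding sum_distrib_left by (intro sum_mono 1)
    have "(r * sqrt (w i * (a i)\<^sup>2)) * (r * (\<Sum>k\<in>UNIV. sqrt (v k * (a k)\<^sup>2))) \<le>
        sqrt (v i * (a i)\<^sup>2) * (\<Sum>k\<in>UNIV. sqrt (w k * (a k)\<^sup>2))"
      by (intro mult_mono 1 2 mult_nonneg_nonneg sum_nonneg) (use r in \<open>auto simp: less_imp_le[OF pos(1)]\<close>)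
    also have "(r * sqrt (w i * (a i)\<^sup>2)) * (r * (\<Sum>k\<in>UNIV. sqrt (v k * (a k)\<^sup>2))) =
        (1 - t) * sqrt (w i * (a i)\<^sup>2) * (\<Sum>k\<in>UNIV. sqrt (v k * (a k)\<^sup>2))"
      by (simp add: r(2)[symmetric] mult_ac)
    finally show ?thesis
      unfolding selection_prob_def using W by (simp add: frac_le_eq divide_simps mult_ac)
  next
    case False
    then have "(1 - t) * selection_prob a w i \<le> 0" using pv by (intro mult_nonpos_nonneg) auto
    then show ?thesis using pv by linarith
  qed
qed

context mwg_target
begin

lemma measurable_state_component: "j < n \<Longrightarrow> (\<lambda>h :: 'd history. state_of (h j)) \<in> borel_measurable (PiM {0..<n} (\<lambda>_. record_space))"
  using measurable_compose[OF measurable_component_singleton[of j "{0..<n}" "\<lambda>_. record_space"] measurable_state_of]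
  by simp

lemma coord_step_le_1:
  assumes [measurable]: "G \<in> borel_measurable borel" and G1: "\<And>x. G x \<le> 1" and s: "0 < s"
  shows "coord_step i s G x \<le> 1"
    and "G (coord_upd x i y) * ennreal (accept_prob (marginal i) (x $ i) y) +
      G x * ennreal (1 - accept_prob (marginal i) (x $ i) y) \<le> 1"
proof -
  show *: "G (coord_upd x i y) * ennreal (accept_prob (marginal i) (x $ i) y) +
      G x * ennreal (1 - accept_prob (marginal i) (x $ i) y) \<le> 1" for y
  proof -
    let ?a = "accept_prob (marginal i) (x $ i) y"
    have a: "0 \<le> ?a" "?a \<le> 1" using accept_prob_bounds[of "marginal i", OF marginal_nonneg] by auto
    have "G (coord_upd x i y) * ennreal ?a + G x * ennreal (1 - ?a) \<le> 1 * ennreal ?a + 1 * ennreal (1 - ?a)"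
      by (intro add_mono mult_right_mono G1) auto
    also have "\<dots> = 1" using a by (simp add: ennreal_plus[symmetric] del: ennreal_plus)
    finally show ?thesis .
  qed
  have "coord_step i s G x \<le> (\<integral>\<^sup>+y. ennreal (normal_density (x $ i) s y) * 1 \<partial>lborel)"
    unfolding coord_step_def by (intro nn_integral_mono mult_left_mono *) auto
  then show "coord_step i s G x \<le> 1" using s by (simp add: nn_integral_normal_density)
qed

lemma coord_step_perturb:
  assumes G[measurable]: "G \<in> borel_measurable borel" and G1: "\<And>x. G x \<le> 1"
    and s: "0 < s" "0 < s'" and t: "0 \<le> t" "(1 - t) * s \<le> s'" "(1 - t) * s' \<le> s"
  shows "coord_step i s' G x \<le> coord_step i s G x + ennreal t"
  unfolding coord_step_def
  by (rule normal_integral_perturb[OF _ coord_step_le_1(2)[OF G G1 s(1)] s t]) measurable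

definition mwg_op :: "('d \<Rightarrow> real) \<Rightarrow> ('d \<Rightarrow> real) \<Rightarrow> (real^'d \<Rightarrow> ennreal) \<Rightarrow> real^'d \<Rightarrow> ennreal" where
  "mwg_op \<alpha> \<sigma>2 G x = (\<Sum>i\<in>UNIV. ennreal (\<alpha> i) * coord_step i (sqrt (\<sigma>2 i)) G x)"

lemma measurable_mwg_op:
  assumes [measurable]: "G \<in> borel_measurable borel"
  shows "mwg_op \<alpha> \<sigma>2 G \<in> borel_measurable borel"
  unfolding mwg_op_def by measurable

lemma mwg_op_le_1:
  assumes G: "G \<in> borel_measurable borel" "\<And>x. G x \<le> 1" and \<alpha>: "prob_vector \<alpha>" and \<sigma>2: "\<And>i. 0 < \<sigma>2 i"
  shows "mwg_op \<alpha> \<sigma>2 G x \<le> 1"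
proof -
  have "mwg_op \<alpha> \<sigma>2 G x \<le> (\<Sum>i\<in>UNIV. ennreal (\<alpha> i) * 1)"
    unfolding mwg_op_def by (intro sum_mono mult_left_mono coord_step_le_1(1)[OF G]) (use \<sigma>2 in auto)
  also have "\<dots> = 1" using \<alpha> by (simp add: prob_vector_def sum_ennreal)
  finally show ?thesis .
qed

text \<open>An absolute change \<open>e\<close> of a variance that is at least \<open>lo\<close> is
  a relative change of at most \<open>e / lo\<close>. It enters twice, through the proposal
  densities and through the selection probabilities, hence the factor 2.\<close>

lemma mwg_op_perturb:
  assumes a: "\<forall>i. a i \<noteq> 0" and G: "G \<in> borel_measurable borel" "\<And>x. G x \<le> 1"
    and lo: "0 < lo" "\<And>i. lo \<le> v i" "\<And>i. lo \<le> w i" and e: "\<And>i. \<bar>v i - w i\<bar> \<le> e" "0 \<le> e"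
  shows "mwg_op (selection_prob a w) w G x \<le> mwg_op (selection_prob a v) v G x + ennreal (2 * (e / lo))"
proof -
  define t where "t = e / lo"
  have t: "0 \<le> t" using e lo by (simp add: t_def)
  have pos: "0 < v i" "0 < w i" for i using lo(1) lo(2)[of i] lo(3)[of i] by linarith+
  have tt: "(1 - t) * w i \<le> v i" "(1 - t) * v i \<le> w i" for i
  proof -
    have "e \<le> t * w i" "e \<le> t * v i"
      using lo(1) mult_left_mono[OF lo(3)[of i] t] mult_left_mono[OF lo(2)[of i] t] by (auto simp: t_def)
    then show "(1 - t) * w i \<le> v i" "(1 - t) * v i \<le> w i"
      using e(1)[of i] by (auto simp: left_diff_distrib)
  qed
  let ?\<alpha>v = "selection_prob a v" and ?\<alpha>w = "selection_prob a w"
  have pv: "prob_vector ?\<alpha>v" "prob_vector ?\<alpha>w"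
    using prob_vector_selection_prob[of a] a pos by blast+
  have nn: "0 \<le> ?\<alpha>v i" "0 \<le> ?\<alpha>w i" for i using pv by (auto simp: prob_vector_def)
  have sum1: "(\<Sum>i\<in>UNIV. ennreal (?\<alpha>w i) * ennreal t) = ennreal t"
    using pv(2) by (simp add: prob_vector_def sum_ennreal sum_distrib_right[symmetric])
  let ?U = "\<lambda>i. coord_step i (sqrt (v i)) G x"
  have U1: "?U i \<le> 1" for i by (rule coord_step_le_1(1)[OF G]) (use pos in auto)
  have "mwg_op ?\<alpha>w w G x \<le> (\<Sum>i\<in>UNIV. ennreal (?\<alpha>w i) * (?U i + ennreal t))"
    unfolding mwg_op_def
    by (intro sum_mono mult_left_mono coord_step_perturb[OF G] t sqrt_perturb tt)
      (use pos in \<open>auto simp: less_imp_le\<close>)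
  also have "\<dots> = (\<Sum>i\<in>UNIV. ennreal (?\<alpha>w i) * ?U i) + ennreal t"
    by (simp add: distrib_left sum.distrib sum1)
  also have "(\<Sum>i\<in>UNIV. ennreal (?\<alpha>w i) * ?U i) \<le>
      (\<Sum>i\<in>UNIV. ennreal (?\<alpha>v i) * ?U i + ennreal (?\<alpha>w i) * ennreal t)"
  proof (rule sum_mono)
    fix i
    have "(1 - t) * ?\<alpha>w i \<le> ?\<alpha>v i"
      by (rule selection_prob_perturb[OF a]) (use pos tt in auto)
    then have "?\<alpha>w i \<le> ?\<alpha>v i + ?\<alpha>w i * t" by (simp add: left_diff_distrib mult.commute)
    then have "ennreal (?\<alpha>w i) \<le> ennreal (?\<alpha>v i + ?\<alpha>w i * t)" by (rule ennreal_leI)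
    also have "\<dots> = ennreal (?\<alpha>v i) + ennreal (?\<alpha>w i) * ennreal t"
      using nn t by (simp add: ennreal_mult)
    finally have "ennreal (?\<alpha>w i) * ?U i \<le> (ennreal (?\<alpha>v i) + ennreal (?\<alpha>w i) * ennreal t) * ?U i"
      by (rule mult_right_mono) simp
    also have "\<dots> \<le> ennreal (?\<alpha>v i) * ?U i + ennreal (?\<alpha>w i) * ennreal t"
      using mult_left_mono[OF U1[of i], of "ennreal (?\<alpha>w i) * ennreal t"]
      by (simp add: distrib_right add_left_mono)
    finally show "ennreal (?\<alpha>w i) * ?U i \<le> ennreal (?\<alpha>v i) * ?U i + ennreal (?\<alpha>w i) * ennreal t" .
  qed
  also have "\<dots> = mwg_op ?\<alpha>v v G x + ennreal t"
    by (simp add: sum.distrib sum1 mwg_op_def)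
  finally have "mwg_op ?\<alpha>w w G x \<le> mwg_op ?\<alpha>v v G x + (ennreal t + ennreal t)"
    by (simp add: add.assoc add_right_mono)
  also have "ennreal t + ennreal t = ennreal (2 * (e / lo))"
    using t by (simp add: ennreal_plus[symmetric] t_def del: ennreal_plus)
  finally show ?thesis .
qed

end

text \<open>What the HST and RR rules have in common. Bounds and drift are required only for
  histories inside the support, since the sample variance is bounded only there; positivity is
  required for all histories, because it makes the one-step laws probability kernels everywhere. The
  drift starts at \<open>n = 2\<close>: the sample variance of one observation is a convention, not
  close to the next value.\<close>

locale adaptive_run = ergodic_mwg_target g C D for g and C :: "'d::finite \<Rightarrow> real" and D +
  fixes a :: "'d \<Rightarrow> real" and V :: "nat \<Rightarrow> 'd history \<Rightarrow> 'd \<Rightarrow> real" and \<alpha>0 :: "'d \<Rightarrow> real"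
    and x0 :: "real^'d" and lo hi :: real and \<eta> :: "nat \<Rightarrow> real"
  assumes a_nonzero: "\<forall>i. a i \<noteq> 0" and \<alpha>0: "prob_vector \<alpha>0" and x0: "x0 \<in> support"
    and lo: "0 < lo" "lo \<le> hi"
    and V_measurable: "\<And>n i. 0 < n \<Longrightarrow> (\<lambda>h. V n h i) \<in> borel_measurable (PiM {0..<n} (\<lambda>_. record_space))"
    and V_pos: "\<And>n h i. 0 < n \<Longrightarrow> 0 < V n h i"
    and V_cong: "\<And>n h h'. (\<And>j. j < n \<Longrightarrow> h j = h' j) \<Longrightarrow> V n h = V n h'"
    and V_bounds: "\<And>n h i. 0 < n \<Longrightarrow> \<forall>j<n. state_of (h j) \<in> support \<Longrightarrow> lo \<le> V n h i \<and> V n h i \<le> hi"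
    and V_diff: "\<And>n h i. 2 \<le> n \<Longrightarrow> \<forall>j<Suc n. state_of (h j) \<in> support \<Longrightarrow> \<bar>V (Suc n) h i - V n h i\<bar> \<le> \<eta> n"
    and \<eta>: "\<eta> \<longlonglongrightarrow> 0"
begin

abbreviation K :: "nat \<Rightarrow> 'd history \<Rightarrow> 'd mwg_record measure" where
  "K \<equiv> adaptive_mwg g C a V \<alpha>0 x0"

abbreviation H :: "nat \<Rightarrow> 'd history measure" where
  "H n \<equiv> PiM {0..<n} (\<lambda>_. record_space)"

lemma space_record_space[simp]: "space record_space = UNIV"
  by (simp add: record_space_def space_pair_measure)

section \<open>The law of the history and its almost sure properties\<close>

lemma prob_vector_selection: "0 < n \<Longrightarrow> prob_vector (selection_prob a (V n h))"
  by (rule prob_vector_selection_prob) (use a_nonzero V_pos in auto)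

lemma measurable_K: "K n \<in> H n \<rightarrow>\<^sub>M prob_algebra record_space"
proof (cases "n = 0")
  case True
  then show ?thesis
    unfolding adaptive_mwg_def[abs_def] using measurable_const[of "return record_space (x0, undefined, False)"]
    by (simp add: space_prob_algebra prob_space_return)
next
  case False
  then have n: "0 < n" by simp
  have [measurable]: "\<And>i. (\<lambda>h. V n h i) \<in> borel_measurable (H n)" by (rule V_measurable[OF n])
  have s: "(\<lambda>h. (if n = 1 then \<alpha>0 else selection_prob a (V n h)) i) \<in> borel_measurable (H n)" for i
    by (cases "n = 1") (simp_all add: selection_prob_def)
  have "(\<lambda>h. mwg_step g C (if n = 1 then \<alpha>0 else selection_prob a (V n h)) (V n h) (state_of (h (n - 1))))
      \<in> H n \<rightarrow>\<^sub>M prob_algebra record_space"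
    using n by (intro measurable_mwg_step measurable_state_component s)
      (auto intro: \<alpha>0 prob_vector_selection V_pos)
  then show ?thesis unfolding adaptive_mwg_def[abs_def] using n by simp
qed

sublocale IT: Ionescu_Tulcea K "\<lambda>_. record_space"
  by (rule Ionescu_Tulcea.intro[OF measurable_prob_algebraD[OF measurable_K] prob_kernel(1)[OF measurable_K]])

lemma undefined_in_H: "(\<lambda>_. undefined) \<in> space (H 0)"
  by (simp add: space_PiM)

lemma AE_K_support:
  assumes "h \<in> space (H n)" "\<forall>j<n. state_of (h j) \<in> support"
  shows "AE z in K n h. state_of z \<in> support"
proof (cases "n = 0")
  case True
  have "(AE z in return record_space (x0, undefined, False). state_of z \<in> support) \<longleftrightarrow> x0 \<in> support"
    by (subst AE_return) auto
  then show ?thesis using True x0 unfolding adaptive_mwg_def by auto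
next
  case False
  then show ?thesis unfolding adaptive_mwg_def using assms(2)
    by (auto intro!: AE_mwg_step_support \<alpha>0 prob_vector_selection V_pos)
qed

lemma measurable_V_later:
  assumes "0 < n"
  shows "(\<lambda>h. V n h i) \<in> borel_measurable (H (n + j))"
proof -
  have "(\<lambda>h. V n (restrict h {0..<n}) i) \<in> borel_measurable (H (n + j))"
    by (rule measurable_compose[OF measurable_restrict_subset V_measurable[OF assms]]) auto
  moreover have "V n (restrict h {0..<n}) = V n h" for h by (rule V_cong) simp
  ultimately show ?thesis by simp
qed

lemma measurable_good:
  "Measurable.pred (H m) (\<lambda>h. \<forall>j<m. state_of (h j) \<in> support)"
proof -
  have "Measurable.pred (H m) (\<lambda>h. \<forall>j\<in>{..<m}. state_of (h j) \<in> support)"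
  proof (rule pred_intros_finite)
    fix j assume "j \<in> {..<m}"
    then have [measurable]: "(\<lambda>h. state_of (h j)) \<in> borel_measurable (H m)"
      by (intro measurable_state_component) simp
    show "Measurable.pred (H m) (\<lambda>h. state_of (h j) \<in> support)" by measurable
  qed simp
  then show ?thesis by (simp add: Ball_def)
qed

lemma measurable_AE_C:
  "Measurable.pred (H (n + m)) (\<lambda>w. (\<forall>j<n + m. state_of (w j) \<in> support) \<and> (0 < n \<longrightarrow> V n w = V n h))"
proof -
  have "Measurable.pred (H (n + m)) (\<lambda>w. 0 < n \<longrightarrow> V n w = V n h)"
  proof (cases "0 < n")
    case True
    have "Measurable.pred (H (n + m)) (\<lambda>w. \<forall>i\<in>UNIV. V n w i = V n h i)"
    proof (rule pred_intros_finite)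
      fix i
      have [measurable]: "(\<lambda>w. V n w i) \<in> borel_measurable (H (n + m))" by (rule measurable_V_later[OF True])
      show "Measurable.pred (H (n + m)) (\<lambda>w. V n w i = V n h i)" by measurable
    qed simp
    then show ?thesis using True by (simp add: fun_eq_iff)
  qed simp
  with measurable_good[of "n + m"] show ?thesis by (rule pred_intros_logic)
qed

text \<open>Continuing a history adds records from index \<open>n\<close> on, so the variances
  frozen at \<open>n\<close> can still be read off from the continuation \<open>w\<close>. The
  second conjunct is restricted to \<open>0 < n\<close>, where \<open>V n\<close> is measurable; the
  case \<open>n = 0\<close> provides the invariance of the support from the very start.\<close>

lemma AE_C:
  assumes h: "h \<in> space (H n)" and good: "\<forall>j<n. state_of (h j) \<in> support"
  shows "AE w in IT.C n m h. (\<forall>j<n + m. state_of (w j) \<in> support) \<and> (0 < n \<longrightarrow> V n w = V n h)"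
proof (induction m)
  case 0
  from AE_return[OF h measurable_AE_C[of n 0 h, unfolded add_0_right]] good
  show ?case unfolding IT.C.simps add_0_right by blast
next
  case (Suc m)
  let ?Q = "\<lambda>w. (\<forall>j<n + Suc m. state_of (w j) \<in> support) \<and> (0 < n \<longrightarrow> V n w = V n h)"
  have Qm: "Measurable.pred (H (Suc (n + m))) ?Q"
    using measurable_AE_C[of n "Suc m" h] unfolding add_Suc_right .
  have eP: "IT.eP (n + m) \<in> IT.C n m h \<rightarrow>\<^sub>M subprob_algebra (H (Suc (n + m)))"
    using IT.measurable_eP[of "n + m"] IT.sets_C[OF h, of m] by (simp cong: measurable_cong_sets)
  have "AE w in IT.C n m h. AE w' in IT.eP (n + m) w. ?Q w'"
    using Suc AE_space[of "IT.C n m h"]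
  proof eventually_elim
    fix w assume w: "(\<forall>j<n + m. state_of (w j) \<in> support) \<and> (0 < n \<longrightarrow> V n w = V n h)"
      and "w \<in> space (IT.C n m h)"
    then have wH: "w \<in> space (H (n + m))" using IT.space_C[OF h] by simp
    have "fun_upd w (n + m) \<in> record_space \<rightarrow>\<^sub>M H (Suc (n + m))"
      using wH by (intro measurable_fun_upd[where J="{0..<n + m}"]) auto
    then have fu: "fun_upd w (n + m) \<in> K (n + m) w \<rightarrow>\<^sub>M H (Suc (n + m))"
      using IT.sets_P[OF wH] by (simp cong: measurable_cong_sets)
    have "AE z in K (n + m) w. ?Q (w(n + m := z))"
      using AE_K_support[OF wH conjunct1[OF w]]
    proof eventually_elim
      fix z assume z: "state_of z \<in> support"
      have "V n (w(n + m := z)) = V n w" by (rule V_cong) simp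
      moreover have "state_of ((w(n + m := z)) j) \<in> support" if "j < n + Suc m" for j
        using w z that by (cases "j = n + m") auto
      ultimately show "?Q (w(n + m := z))" using w by simp
    qed
    then show "AE w' in IT.eP (n + m) w. ?Q w'"
      unfolding IT.eP_def AE_distr_iff[OF fu Qm[unfolded pred_def]] .
  qed
  then show ?case unfolding IT.C.simps AE_bind[OF eP Qm] .
qed

section \<open>Comparison with the chain with frozen variances\<close>

lemma V_drift:
  assumes "2 \<le> n" and "\<forall>j<n + m. state_of (w j) \<in> support" and "\<And>l. n \<le> l \<Longrightarrow> \<eta> l \<le> e"
  shows "\<bar>V n w i - V (n + m) w i\<bar> \<le> real m * e"
  using assms(2)
proof (induction m)
  case (Suc m)
  have "\<bar>V (Suc (n + m)) w i - V (n + m) w i\<bar> \<le> \<eta> (n + m)"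
    by (rule V_diff) (use Suc.prems assms in auto)
  also have "\<dots> \<le> e" by (rule assms) simp
  finally show ?case using Suc by (simp add: distrib_right)
qed simp

lemma frozen_comparison:
  assumes h: "h \<in> space (H n)" and good: "\<forall>j<n. state_of (h j) \<in> support" and n: "2 \<le> n"
    and e: "\<And>l. n \<le> l \<Longrightarrow> \<eta> l \<le> e" "0 \<le> e" and m: "m \<le> N"
    and G: "G \<in> borel_measurable borel" "\<And>x. G x \<le> 1"
  shows "(\<integral>\<^sup>+w. G (state_of (w (n + m - 1))) \<partial>IT.C n m h) \<le>
    (\<integral>\<^sup>+y. G y \<partial>kernel_power borel (mwg_kernel (selection_prob a (V n h)) (V n h)) m (state_of (h (n - 1)))) +
     ennreal (real m * (2 * (real N * e / lo)))"
  using m G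
proof (induction m arbitrary: G)
  case 0
  have "(\<lambda>w. G (state_of (w (n - 1)))) \<in> borel_measurable (H n)"
    using measurable_compose[OF measurable_state_component[of "n - 1" n] 0(2)] n by simp
  then show ?case using h n 0 by (simp add: nn_integral_return)
next
  case (Suc m)
  let ?v = "V n h"
  let ?P = "mwg_kernel (selection_prob a ?v) ?v"
  let ?\<delta> = "2 * (real N * e / lo)"
  have n0: "0 < n" "0 < n + m" using n by auto
  have pv: "prob_vector (selection_prob a ?v)" by (rule prob_vector_selection[OF n0(1)])
  have P: "?P \<in> borel \<rightarrow>\<^sub>M prob_algebra borel" by (rule measurable_mwg_kernel[OF pv V_pos[OF n0(1)]])
  define PG where "PG = mwg_op (selection_prob a ?v) ?v G"
  have PGm: "PG \<in> borel_measurable borel" unfolding PG_def by (rule measurable_mwg_op[OF Suc.prems(2)])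
  have PG1: "PG x \<le> 1" for x unfolding PG_def by (rule mwg_op_le_1[OF Suc.prems(2,3) pv V_pos[OF n0(1)]])
  have PG_eq: "(\<integral>\<^sup>+z. G z \<partial>?P y) = PG y" for y
    unfolding PG_def mwg_op_def nn_integral_mwg_kernel[OF Suc.prems(2) pv V_pos[OF n0(1)]]
    by (rule nn_integral_mwg_step_state[OF Suc.prems(2) V_pos[OF n0(1)]])
  interpret C: prob_space "IT.C n m h" by (rule IT.prob_space_C[OF h])
  have Gm: "(\<lambda>w. G (state_of (w (n + m)))) \<in> borel_measurable (H (Suc (n + m)))"
    by (rule measurable_compose[OF measurable_state_component Suc.prems(2)]) simp
  have eP: "IT.eP (n + m) \<in> IT.C n m h \<rightarrow>\<^sub>M subprob_algebra (H (Suc (n + m)))"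
    using IT.measurable_eP[of "n + m"] IT.sets_C[OF h, of m] by (simp cong: measurable_cong_sets)
  have "(\<integral>\<^sup>+w. G (state_of (w (n + Suc m - 1))) \<partial>IT.C n (Suc m) h) =
      (\<integral>\<^sup>+w. (\<integral>\<^sup>+w'. G (state_of (w' (n + m))) \<partial>IT.eP (n + m) w) \<partial>IT.C n m h)"
    using nn_integral_bind[OF Gm eP] by simp
  also have "\<dots> \<le> (\<integral>\<^sup>+w. PG (state_of (w (n + m - 1))) + ennreal ?\<delta> \<partial>IT.C n m h)"
  proof (rule nn_integral_mono_AE)
    show "AE w in IT.C n m h. (\<integral>\<^sup>+w'. G (state_of (w' (n + m))) \<partial>IT.eP (n + m) w) \<le>
      PG (state_of (w (n + m - 1))) + ennreal ?\<delta>"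
      using AE_C[OF h good, of m] AE_space[of "IT.C n m h"]
    proof eventually_elim
      fix w assume w: "(\<forall>j<n + m. state_of (w j) \<in> support) \<and> (0 < n \<longrightarrow> V n w = V n h)"
        and "w \<in> space (IT.C n m h)"
      then have wH: "w \<in> space (H (n + m))" using IT.space_C[OF h] by simp
      let ?w = "V (n + m) w"
      have Vw: "V n w = ?v" using w n0 by simp
      have "(\<integral>\<^sup>+w'. G (state_of (w' (n + m))) \<partial>IT.eP (n + m) w) = (\<integral>\<^sup>+z. G (state_of z) \<partial>K (n + m) w)"
        using IT.nn_integral_eP[OF wH Gm] by simp
      also have "\<dots> = mwg_op (selection_prob a ?w) ?w G (state_of (w (n + m - 1)))"
        using n unfolding mwg_op_def adaptive_mwg_def
        by (simp add: nn_integral_mwg_step_state[OF Suc.prems(2) V_pos[OF n0(2)]])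
      also have "\<dots> \<le> PG (state_of (w (n + m - 1))) + ennreal (2 * ((real N * e) / lo))"
        unfolding PG_def
      proof (rule mwg_op_perturb[OF a_nonzero Suc.prems(2,3) lo(1)])
        fix i
        show "lo \<le> ?v i" using V_bounds[OF n0(1) good] by blast
        show "lo \<le> ?w i" using V_bounds[OF n0(2), of w] w by blast
        have "\<bar>?v i - ?w i\<bar> \<le> real m * e" using V_drift[OF n, of m w e i] w e(1) Vw by auto
        also have "\<dots> \<le> real N * e" using Suc.prems(1) e(2) by (intro mult_right_mono) auto
        finally show "\<bar>?v i - ?w i\<bar> \<le> real N * e" .
      qed (use e in auto)
      finally show "(\<integral>\<^sup>+w'. G (state_of (w' (n + m))) \<partial>IT.eP (n + m) w) \<le>
        PG (state_of (w (n + m - 1))) + ennreal ?\<delta>" .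
    qed
  qed
  also have "\<dots> = (\<integral>\<^sup>+w. PG (state_of (w (n + m - 1))) \<partial>IT.C n m h) + ennreal ?\<delta>"
  proof -
    have "(\<lambda>w. PG (state_of (w (n + m - 1)))) \<in> borel_measurable (IT.C n m h)"
      using measurable_compose[OF measurable_state_component[of "n + m - 1" "n + m"] PGm] n IT.sets_C[OF h, of m]
      by (simp cong: measurable_cong_sets)
    then show ?thesis by (simp add: nn_integral_add C.emeasure_space_1)
  qed
  also have "\<dots> \<le> ((\<integral>\<^sup>+y. PG y \<partial>kernel_power borel ?P m (state_of (h (n - 1)))) + ennreal (real m * ?\<delta>)) + ennreal ?\<delta>"
    by (intro add_right_mono Suc.IH PGm PG1) (use Suc.prems in auto)
  also have "\<dots> = (\<integral>\<^sup>+y. PG y \<partial>kernel_power borel ?P m (state_of (h (n - 1)))) + (ennreal (real m * ?\<delta>) + ennreal ?\<delta>)"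
    by (simp add: add.assoc)
  also have "ennreal (real m * ?\<delta>) + ennreal ?\<delta> = ennreal (real (Suc m) * ?\<delta>)"
  proof -
    have "ennreal (real m * d) + ennreal d = ennreal (real (Suc m) * d)" if "0 \<le> d" for d
      using that by (simp add: ennreal_plus[symmetric] distrib_right add.commute del: ennreal_plus)
    moreover have "0 \<le> ?\<delta>" using e lo by simp
    ultimately show ?thesis by blast
  qed
  also have "(\<integral>\<^sup>+y. PG y \<partial>kernel_power borel ?P m (state_of (h (n - 1)))) =
      (\<integral>\<^sup>+y. G y \<partial>kernel_power borel ?P (Suc m) (state_of (h (n - 1))))"
    unfolding PG_eq[symmetric] by (rule nn_integral_kernel_power_Suc[OF P refl _ Suc.prems(2), symmetric]) simp
  finally show ?case .
qed

lemma prob_space_law_at: "prob_space (law_at K n)"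
  and sets_law_at: "sets (law_at K n) = sets borel"
proof -
  have "(\<lambda>h. state_of (h n)) \<in> IT.C 0 (Suc n) (\<lambda>_. undefined) \<rightarrow>\<^sub>M borel"
    using measurable_state_component[of n "Suc n"] IT.sets_C[OF undefined_in_H, of "Suc n"]
    by (simp cong: measurable_cong_sets)
  then show "prob_space (law_at K n)"
    unfolding law_at_def by (intro prob_space.prob_space_distr IT.prob_space_C undefined_in_H)
qed (simp add: law_at_def)

lemma tv_dist_law_at_le:
  assumes r: "0 \<le> r"
    and sue: "\<forall>\<sigma>2 x u k. (\<forall>i. lo \<le> \<sigma>2 i \<and> \<sigma>2 i \<le> hi) \<longrightarrow> x \<in> support \<longrightarrow> u \<in> borel_measurable borel \<longrightarrow>
      (\<forall>z. 0 \<le> u z \<and> u z \<le> (1::real)) \<longrightarrow>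
      (\<integral>\<^sup>+z. u z \<partial>kernel_power borel (mwg_kernel (selection_prob a \<sigma>2) \<sigma>2) (k * N0) x) \<le>
        (\<integral>\<^sup>+z. u z \<partial>product_target g C) + ennreal (r ^ k)"
    and n: "2 \<le> n" and e: "\<And>l. n \<le> l \<Longrightarrow> \<eta> l \<le> e" "0 \<le> e" and N: "N = k * N0"
  shows "tv_dist (law_at K (n + N - 1)) (product_target g C) \<le> r ^ k + real N * (2 * (real N * e / lo))"
proof (rule tv_dist_le[OF prob_space_law_at prob_space_product_target])
  show "sets (law_at K (n + N - 1)) = sets (product_target g C)" by (simp add: sets_law_at)
  fix A assume "A \<in> sets (law_at K (n + N - 1))"
  then have A[measurable]: "A \<in> sets borel" by (simp add: sets_law_at)
  let ?\<delta> = "real N * (2 * (real N * e / lo))"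
  let ?u = "indicator A :: real^'d \<Rightarrow> real"
  have \<delta>: "0 \<le> ?\<delta>" using e lo by simp
  interpret L: prob_space "law_at K (n + N - 1)" by (rule prob_space_law_at)
  interpret \<pi>: prob_space "product_target g C" by (rule prob_space_product_target)
  interpret C: prob_space "IT.C 0 n (\<lambda>_. undefined)" by (rule IT.prob_space_C[OF undefined_in_H])
  \<comment> \<open>The state with index \<open>n + N - 1\<close> is the last of
    \<open>n + N\<close> records, since records are counted from 0.\<close>
  have S: "Suc (n + N - 1) = n + N" using n by simp
  have um: "(\<lambda>x. ennreal (?u x)) \<in> borel_measurable borel" by simp
  have good0: "AE h in IT.C 0 n (\<lambda>_. undefined). \<forall>j<n. state_of (h j) \<in> support"
  proof -
    have "\<forall>j<0. state_of ((\<lambda>_. undefined :: 'd mwg_record) (j::nat)) \<in> support" by simp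
    from AE_C[OF undefined_in_H this, of n] show ?thesis by eventually_elim simp
  qed
  have u1: "ennreal (?u x) \<le> 1" for x by (cases "x \<in> A") auto
  have c: "(\<lambda>h. state_of (h (n + N - 1))) \<in> borel_measurable (H (n + N))"
    by (rule measurable_state_component) (use n in simp)
  have um': "(\<lambda>h. ennreal (?u (state_of (h (n + N - 1))))) \<in> borel_measurable (H (n + N))"
    by (rule measurable_compose[OF c um])
  have "emeasure (law_at K (n + N - 1)) A = (\<integral>\<^sup>+x. ennreal (?u x) \<partial>law_at K (n + N - 1))"
    by (simp add: sets_law_at ennreal_indicator)
  also have "\<dots> = (\<integral>\<^sup>+h. ennreal (?u (state_of (h (n + N - 1)))) \<partial>IT.C 0 (n + N) (\<lambda>_. undefined))"
    unfolding law_at_def S using c IT.sets_C[OF undefined_in_H, of "n + N"]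
    by (subst nn_integral_distr) (auto cong: measurable_cong_sets)
  also have "IT.C 0 (n + N) (\<lambda>_. undefined) = IT.C 0 n (\<lambda>_. undefined) \<bind> IT.C (0 + n) N"
    by (rule IT.split_C[OF undefined_in_H, symmetric])
  also have "(\<integral>\<^sup>+h. ennreal (?u (state_of (h (n + N - 1)))) \<partial>(IT.C 0 n (\<lambda>_. undefined) \<bind> IT.C (0 + n) N)) =
    (\<integral>\<^sup>+h. (\<integral>\<^sup>+w. ennreal (?u (state_of (w (n + N - 1)))) \<partial>IT.C n N h) \<partial>IT.C 0 n (\<lambda>_. undefined))"
  proof -
    have "IT.C (0 + n) N \<in> IT.C 0 n (\<lambda>_. undefined) \<rightarrow>\<^sub>M subprob_algebra (H (n + N))"
      using IT.measurable_C[of n N] IT.sets_C[OF undefined_in_H, of n] by (simp cong: measurable_cong_sets)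
    from nn_integral_bind[OF um' this] show ?thesis by simp
  qed
  also have "\<dots> \<le> (\<integral>\<^sup>+h. emeasure (product_target g C) A + ennreal (r ^ k) + ennreal ?\<delta> \<partial>IT.C 0 n (\<lambda>_. undefined))"
  proof (rule nn_integral_mono_AE)
    show "AE h in IT.C 0 n (\<lambda>_. undefined). (\<integral>\<^sup>+w. ennreal (?u (state_of (w (n + N - 1)))) \<partial>IT.C n N h) \<le>
      emeasure (product_target g C) A + ennreal (r ^ k) + ennreal ?\<delta>"
      using good0 AE_space[of "IT.C 0 n (\<lambda>_. undefined)"]
    proof eventually_elim
      fix h assume "\<forall>j<n. state_of (h j) \<in> support"
        and "h \<in> space (IT.C 0 n (\<lambda>_. undefined))"
      then have h: "h \<in> space (H n)" and good: "\<forall>j<n. state_of (h j) \<in> support"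
        using IT.space_C[OF undefined_in_H, of n] by auto
      have n0: "0 < n" using n by simp
      have "(\<integral>\<^sup>+w. ennreal (?u (state_of (w (n + N - 1)))) \<partial>IT.C n N h) \<le>
        (\<integral>\<^sup>+y. ennreal (?u y) \<partial>kernel_power borel (mwg_kernel (selection_prob a (V n h)) (V n h)) N (state_of (h (n - 1)))) +
        ennreal ?\<delta>"
        by (rule frozen_comparison[OF h good n e order_refl um u1])
      also have "(\<integral>\<^sup>+y. ennreal (?u y) \<partial>kernel_power borel (mwg_kernel (selection_prob a (V n h)) (V n h)) N (state_of (h (n - 1)))) \<le>
          (\<integral>\<^sup>+z. ennreal (?u z) \<partial>product_target g C) + ennreal (r ^ k)"
      proof -
        have "\<forall>i. lo \<le> V n h i \<and> V n h i \<le> hi" using V_bounds[OF n0 good] by blast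
        moreover have "state_of (h (n - 1)) \<in> support" using good n by simp
        moreover have "?u \<in> borel_measurable borel" by simp
        moreover have "\<forall>z. 0 \<le> ?u z \<and> ?u z \<le> 1" by (simp split: split_indicator)
        ultimately show ?thesis unfolding N using sue by blast
      qed
      also have "(\<integral>\<^sup>+z. ennreal (?u z) \<partial>product_target g C) = emeasure (product_target g C) A"
        by (simp add: ennreal_indicator)
      finally show "(\<integral>\<^sup>+w. ennreal (?u (state_of (w (n + N - 1)))) \<partial>IT.C n N h) \<le>
        emeasure (product_target g C) A + ennreal (r ^ k) + ennreal ?\<delta>"
        by (simp add: add_right_mono)
    qed
  qed
  also have "\<dots> = emeasure (product_target g C) A + ennreal (r ^ k) + ennreal ?\<delta>"
    by (simp add: C.emeasure_space_1)
  finally have "ennreal (measure (law_at K (n + N - 1)) A) \<le>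
      ennreal (measure (product_target g C) A) + ennreal (r ^ k) + ennreal ?\<delta>"
    by (simp only: L.emeasure_eq_measure \<pi>.emeasure_eq_measure)
  also have "\<dots> = ennreal (measure (product_target g C) A + (r ^ k + ?\<delta>))"
    using r \<delta> by (simp add: ennreal_plus[symmetric] add.assoc del: ennreal_plus)
  finally show "measure (law_at K (n + N - 1)) A \<le> measure (product_target g C) A + (r ^ k + ?\<delta>)"
    using r \<delta> by (subst (asm) ennreal_le_iff) auto
qed

theorem tv_dist_tendsto_0: "(\<lambda>n. tv_dist (law_at K n) (product_target g C)) \<longlonglongrightarrow> 0"
proof (rule LIMSEQ_I)
  fix \<epsilon> :: real assume \<epsilon>: "0 < \<epsilon>"
  obtain N0 r where r: "0 \<le> r" "r < 1" and sue: "\<forall>\<sigma>2 x u k. (\<forall>i. lo \<le> \<sigma>2 i \<and> \<sigma>2 i \<le> hi) \<longrightarrow> x \<in> support \<longrightarrow> u \<in> borel_measurable borel \<longrightarrow>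
      (\<forall>z. 0 \<le> u z \<and> u z \<le> (1::real)) \<longrightarrow>
      (\<integral>\<^sup>+z. u z \<partial>kernel_power borel (mwg_kernel (selection_prob a \<sigma>2) \<sigma>2) (k * N0) x) \<le>
        (\<integral>\<^sup>+z. u z \<partial>product_target g C) + ennreal (r ^ k)"
    by (rule simultaneous_uniform_ergodicity[OF a_nonzero lo]) (rule that)
  \<comment> \<open>The window length \<open>N\<close> is fixed here by the rate alone; only then is
    the drift \<open>e\<close> chosen in terms of \<open>N\<close>.\<close>
  obtain k where k: "r ^ k < \<epsilon> / 2" using real_arch_pow_inv[of "\<epsilon> / 2" r] \<epsilon> r by auto
  define N where "N = k * N0"
  \<comment> \<open>\<open>e * Q\<close> bounds the cost of freezing over the whole window; the
    \<open>+ 1\<close> keeps \<open>Q\<close> positive when \<open>N = 0\<close>.\<close>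
  define Q where "Q = 2 * ((real N)\<^sup>2 + 1) / lo"
  define e where "e = \<epsilon> / 4 / Q"
  have q: "0 < Q" unfolding Q_def using lo by (intro divide_pos_pos mult_pos_pos add_nonneg_pos) auto
  then have e: "0 < e" unfolding e_def using \<epsilon> by (intro divide_pos_pos[OF _ q]) simp
  have "real N * (2 * (real N * e / lo)) = e * (2 * (real N)\<^sup>2 / lo)" by (simp add: power2_eq_square)
  also have "\<dots> \<le> e * Q"
    unfolding Q_def using e lo by (intro mult_left_mono divide_right_mono) auto
  also have "\<dots> = \<epsilon> / 4" unfolding e_def using q by simp
  finally have eN: "real N * (2 * (real N * e / lo)) \<le> \<epsilon> / 4" .
  have "eventually (\<lambda>n. \<eta> n < e) sequentially" using \<eta> e by (rule order_tendstoD)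
  then obtain n0 where n0: "\<And>l. n0 \<le> l \<Longrightarrow> \<eta> l < e" by (auto simp: eventually_sequentially)
  show "\<exists>no. \<forall>n\<ge>no. norm (tv_dist (law_at K n) (product_target g C) - 0) < \<epsilon>"
  proof (intro exI allI impI)
    fix t assume t: "n0 + N + 2 \<le> t"
    \<comment> \<open>The window is placed so that it ends at the given time \<open>t\<close>: its
      start moves along with \<open>t\<close>, its length does not.\<close>
    define n where "n = t + 1 - N"
    have n: "2 \<le> n" "n0 \<le> n" "n + N - 1 = t" using t by (auto simp: n_def)
    have "tv_dist (law_at K (n + N - 1)) (product_target g C) \<le> r ^ k + real N * (2 * (real N * e / lo))"
      by (rule tv_dist_law_at_le[OF r(1) sue n(1) _ _ N_def]) (use n0 n e in \<open>auto intro: less_imp_le\<close>)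
    also have "\<dots> < \<epsilon>" using k eN \<epsilon> by linarith
    finally show "norm (tv_dist (law_at K t) (product_target g C) - 0) < \<epsilon>"
      using tv_dist_nonneg[OF prob_space_law_at prob_space_product_target, of t] n(3) by simp
  qed
qed

end

section \<open>The HST rule\<close>

context
  fixes x :: "nat \<Rightarrow> real"
begin

definition ssq :: "nat \<Rightarrow> real" where
  "ssq n = (\<Sum>j<n. (x j - (\<Sum>k<n. x k) / real n)\<^sup>2)"

lemma sample_variance_ssq: "sample_variance n x = ssq n / (real n - 1)"
  by (simp add: sample_variance_def ssq_def)

lemma ssq_nonneg: "0 \<le> ssq n"
  unfolding ssq_def by (intro sum_nonneg) simp

lemma ssq_alt:
  assumes "0 < n"
  shows "ssq n = (\<Sum>j<n. (x j)\<^sup>2) - (\<Sum>j<n. x j)\<^sup>2 / real n"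
proof -
  let ?S = "\<Sum>j<n. x j"
  have "ssq n = (\<Sum>j<n. (x j)\<^sup>2 - 2 * (?S / real n) * x j + (?S / real n)\<^sup>2)"
    unfolding ssq_def by (intro sum.cong) (auto simp: power2_diff)
  also have "\<dots> = (\<Sum>j<n. (x j)\<^sup>2) - 2 * (?S / real n) * ?S + real n * (?S / real n)\<^sup>2"
    by (simp add: sum.distrib sum_subtractf sum_distrib_left)
  also have "\<dots> = (\<Sum>j<n. (x j)\<^sup>2) - ?S\<^sup>2 / real n"
    using assms by (simp add: power2_eq_square field_simps)
  finally show ?thesis .
qed

text \<open>Welford's recursion: a new observation raises the sum of squares by less than its
  squared distance from the old mean. This increment is bounded for bounded data, uniformly in
  \<open>n\<close>.\<close>

lemma ssq_Suc:
  assumes "0 < n"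
  shows "ssq (Suc n) = ssq n + real n / (real n + 1) * (x n - (\<Sum>k<n. x k) / real n)\<^sup>2"
proof -
  define S where "S = (\<Sum>j<n. x j)"
  define m where "m = real n"
  have m: "0 < m" "real (Suc n) = m + 1" using assms by (auto simp: m_def)
  have "(x n)\<^sup>2 - (S + x n)\<^sup>2 / (m + 1) + S\<^sup>2 / m = m / (m + 1) * (x n - S / m)\<^sup>2"
    using m(1) by (simp add: divide_simps power2_eq_square) (simp add: algebra_simps)
  then show ?thesis
    unfolding ssq_alt[OF assms] ssq_alt[OF zero_less_Suc] m(2)
    by (simp add: S_def[symmetric] m_def[symmetric])
qed

lemma abs_diff_mean_le:
  assumes "\<And>j. j < n \<Longrightarrow> \<bar>x j\<bar> \<le> B" "0 < n" "\<bar>y\<bar> \<le> B"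
  shows "(y - (\<Sum>k<n. x k) / real n)\<^sup>2 \<le> 4 * B\<^sup>2"
proof -
  have "\<bar>\<Sum>k<n. x k\<bar> \<le> (\<Sum>k<n. \<bar>x k\<bar>)" by (rule sum_abs)
  also have "\<dots> \<le> (\<Sum>k<n. B)" by (rule sum_mono) (use assms in auto)
  finally have "\<bar>(\<Sum>k<n. x k) / real n\<bar> \<le> B" using assms(2) by (simp add: field_simps)
  then have "\<bar>y - (\<Sum>k<n. x k) / real n\<bar> \<le> \<bar>2 * B\<bar>" using assms(3) by linarith
  then have "(y - (\<Sum>k<n. x k) / real n)\<^sup>2 \<le> (2 * B)\<^sup>2" by (simp add: abs_le_square_iff)
  then show ?thesis by (simp add: power_mult_distrib)
qed

lemma ssq_le:
  assumes "\<And>j. j < n \<Longrightarrow> \<bar>x j\<bar> \<le> B"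
  shows "ssq n \<le> real n * (4 * B\<^sup>2)"
proof -
  have "ssq n \<le> (\<Sum>j<n. 4 * B\<^sup>2)"
    unfolding ssq_def by (intro sum_mono abs_diff_mean_le) (use assms in auto)
  then show ?thesis by simp
qed

lemma sample_variance_nonneg: "0 < n \<Longrightarrow> 0 \<le> sample_variance n x"
  unfolding sample_variance_ssq using ssq_nonneg by (intro divide_nonneg_nonneg) auto

lemma sample_variance_le:
  assumes x: "\<And>j. j < n \<Longrightarrow> \<bar>x j\<bar> \<le> B" and n: "0 < n"
  shows "sample_variance n x \<le> 8 * B\<^sup>2"
proof (cases "n = 1")
  case True
  then show ?thesis by (simp add: sample_variance_def)
next
  case False
  then have n2: "2 \<le> real n" using n by linarith
  have "ssq n \<le> real n * (4 * B\<^sup>2)" by (rule ssq_le[OF x])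
  \<comment> \<open>From two observations on, \<open>n \<le> 2 * (n - 1)\<close>; this replaces the
    divisor at the price of a factor 2.\<close>
  also have "\<dots> \<le> (2 * (real n - 1)) * (4 * B\<^sup>2)" using n2 by (intro mult_right_mono) auto
  finally show ?thesis unfolding sample_variance_ssq using n2 by (simp add: field_simps)
qed

text \<open>Two effects of opposite sign: the new observation adds at most
  \<open>4 * B\<^sup>2 / n\<close>, and the larger divisor removes the old sample variance divided
  by \<open>n\<close>, at most \<open>8 * B\<^sup>2 / n\<close>. The divisor \<open>n - 1\<close>
  must be nonzero, hence \<open>2 \<le> n\<close>.\<close>

lemma sample_variance_diff:
  assumes x: "\<And>j. j < Suc n \<Longrightarrow> \<bar>x j\<bar> \<le> B" and n: "2 \<le> n"
  shows "\<bar>sample_variance (Suc n) x - sample_variance n x\<bar> \<le> 12 * B\<^sup>2 / real n"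
proof -
  define d where "d = real n / (real n + 1) * (x n - (\<Sum>k<n. x k) / real n)\<^sup>2"
  have n2: "2 \<le> real n" using n by simp
  have "d \<le> 1 * (4 * B\<^sup>2)"
    unfolding d_def using n by (intro mult_mono abs_diff_mean_le) (use x in auto)
  then have "d / real n \<le> 4 * B\<^sup>2 / real n" by (intro divide_right_mono) auto
  moreover have "0 \<le> d" unfolding d_def by (intro mult_nonneg_nonneg) auto
  ultimately have d: "0 \<le> d / real n" "d / real n \<le> 4 * B\<^sup>2 / real n" by auto
  have q: "0 \<le> ssq n / (real n * (real n - 1))" using n2 ssq_nonneg by (intro divide_nonneg_nonneg mult_nonneg_nonneg) auto
  have "ssq n / (real n * (real n - 1)) = sample_variance n x / real n"
    by (simp add: sample_variance_ssq)
  also have "\<dots> \<le> 8 * B\<^sup>2 / real n"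
    using x n by (intro divide_right_mono sample_variance_le) auto
  finally have q2: "ssq n / (real n * (real n - 1)) \<le> 8 * B\<^sup>2 / real n" .
  have "ssq (Suc n) = ssq n + d" unfolding d_def by (rule ssq_Suc) (use n in simp)
  then have "sample_variance (Suc n) x - sample_variance n x = d / real n - ssq n / (real n * (real n - 1))"
    unfolding sample_variance_ssq using n2 by (simp add: divide_simps) (simp add: algebra_simps)
  also have "\<bar>\<dots>\<bar> \<le> d / real n + ssq n / (real n * (real n - 1))" using d(1) q by linarith
  also have "\<dots> \<le> 4 * B\<^sup>2 / real n + 8 * B\<^sup>2 / real n" using d(2) q2 by linarith
  also have "\<dots> = 12 * B\<^sup>2 / real n" by (simp add: add_divide_distrib[symmetric])
  finally show ?thesis .
qed

end

lemma measurable_sample_variance: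
  assumes "\<And>j. j < n \<Longrightarrow> (\<lambda>h. f h j) \<in> borel_measurable M"
  shows "(\<lambda>h. sample_variance n (f h)) \<in> borel_measurable M"
proof -
  have [measurable]: "(\<lambda>h. \<Sum>k<n. f h k) \<in> borel_measurable M"
    by (intro borel_measurable_sum) (use assms in auto)
  have "(\<lambda>h. \<Sum>j<n. (f h j - (\<Sum>k<n. f h k) / real n)\<^sup>2) \<in> borel_measurable M"
  proof (intro borel_measurable_sum)
    fix j assume "j \<in> {..<n}"
    then have [measurable]: "(\<lambda>h. f h j) \<in> borel_measurable M" by (intro assms) simp
    show "(\<lambda>h. (f h j - (\<Sum>k<n. f h k) / real n)\<^sup>2) \<in> borel_measurable M" by measurable
  qed
  then show ?thesis unfolding sample_variance_def by measurable
qed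

context ergodic_mwg_target
begin

lemma support_bounded:
  obtains B where "\<And>x i. x \<in> support \<Longrightarrow> \<bar>x $ i\<bar> \<le> B"
proof -
  have "\<exists>z. 0 < g z"
  proof (rule ccontr)
    assume "\<not> ?thesis"
    then have "g z = 0" for z using g_nonneg[of z] by (simp add: less_le)
    then show False using g_density by simp
  qed
  then obtain z where z: "0 < g z" ..
  define B where "B = Max (range (\<lambda>i. (D + \<bar>z\<bar>) / C i))"
  show thesis
  proof (rule that)
    fix x i assume "x \<in> support"
    then have "\<bar>C i * x $ i - z\<bar> \<le> D" by (intro bounded_support z) (simp add: support_def)
    then have "\<bar>C i * x $ i\<bar> \<le> D + \<bar>z\<bar>" by linarith
    then have "\<bar>x $ i\<bar> \<le> (D + \<bar>z\<bar>) / C i" using C_pos[of i] by (simp add: abs_mult field_simps)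
    also have "\<dots> \<le> B" unfolding B_def by (rule Max_ge) auto
    finally show "\<bar>x $ i\<bar> \<le> B" .
  qed
qed

lemma hst_adaptive_run:
  assumes a: "\<forall>i. a i \<noteq> 0" and \<alpha>0: "prob_vector \<alpha>0" and x0: "x0 \<in> support"
  shows "\<exists>lo hi \<eta>. adaptive_run g C D a hst_variance \<alpha>0 x0 lo hi \<eta>"
proof -
  obtain B where B: "\<And>x i. x \<in> support \<Longrightarrow> \<bar>(x::real^'d) $ i\<bar> \<le> B" using support_bounded by blast
  define c where "c = (2.4::real)\<^sup>2"
  have c: "0 < c" by (simp add: c_def)
  define \<eta> where "\<eta> n = c * (12 * B\<^sup>2 / real n)" for n
  have V: "hst_variance n h i = c * (sample_variance n (\<lambda>j. state_of (h j) $ i) + 0.05)" for n and h :: "'d history" and i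
    by (simp add: hst_variance_def c_def)
  \<comment> \<open>The offset 0.05 alone provides the lower end of the interval, since a sample
    variance may be arbitrarily small; the upper end comes from the bounded support.\<close>
  have "adaptive_run g C D a hst_variance \<alpha>0 x0 (c * 0.05) (c * (8 * B\<^sup>2 + 0.05)) \<eta>"
  proof unfold_locales
    fix n i assume n: "0 < (n::nat)"
    have "(\<lambda>h :: 'd history. state_of (h j) $ i) \<in> borel_measurable (PiM {0..<n} (\<lambda>_. record_space))" if "j < n" for j
      by (intro measurable_vec_nth measurable_state_component that)
    from measurable_sample_variance[OF this]
    show "(\<lambda>h. hst_variance n h i) \<in> borel_measurable (PiM {0..<n} (\<lambda>_. record_space))"
      unfolding V by measurable
  next
    fix n :: nat and h :: "'d history" and i assume "0 < n"
    then have "0 \<le> sample_variance n (\<lambda>j. state_of (h j) $ i)" by (rule sample_variance_nonneg)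
    then show "0 < hst_variance n h i" unfolding V using c by (intro mult_pos_pos) auto
  next
    fix n :: nat and h h' :: "'d history" assume "\<And>j. j < n \<Longrightarrow> h j = h' j"
    then show "hst_variance n h = hst_variance n h'"
      by (simp add: fun_eq_iff hst_variance_def sample_variance_def)
  next
    fix n :: nat and h :: "'d history" and i assume n: "0 < n" and h: "\<forall>j<n. state_of (h j) \<in> support"
    have "0 \<le> sample_variance n (\<lambda>j. state_of (h j) $ i)" by (rule sample_variance_nonneg[OF n])
    moreover have "sample_variance n (\<lambda>j. state_of (h j) $ i) \<le> 8 * B\<^sup>2"
      by (rule sample_variance_le[OF _ n]) (use h B in blast)
    ultimately show "c * 0.05 \<le> hst_variance n h i \<and> hst_variance n h i \<le> c * (8 * B\<^sup>2 + 0.05)"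
      unfolding V using c by (auto intro!: mult_left_mono)
  next
    fix n :: nat and h :: "'d history" and i assume n: "2 \<le> n" and h: "\<forall>j<Suc n. state_of (h j) \<in> support"
    have "\<bar>sample_variance (Suc n) (\<lambda>j. state_of (h j) $ i) - sample_variance n (\<lambda>j. state_of (h j) $ i)\<bar> \<le> 12 * B\<^sup>2 / real n"
      by (rule sample_variance_diff[OF _ n]) (use h B in blast)
    then show "\<bar>hst_variance (Suc n) h i - hst_variance n h i\<bar> \<le> \<eta> n"
      unfolding V \<eta>_def right_diff_distrib[symmetric] abs_mult using c by (intro mult_mono) auto
  next
    have "(\<lambda>n. c * (12 * B\<^sup>2 / real n)) \<longlonglongrightarrow> c * 0"
      by (intro tendsto_mult tendsto_const lim_const_over_n)
    then show "\<eta> \<longlonglongrightarrow> 0" unfolding \<eta>_def[abs_def] by simp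
  qed (use a \<alpha>0 x0 c in \<open>auto intro!: mult_left_mono\<close>)
  then show ?thesis by blast
qed

end

section \<open>The RR rule\<close>

lemma rr_log_variance_bounds:
  assumes "0 < M" "ls0 i \<in> {-M..M}"
  shows "rr_log_variance \<delta> M ls0 h b i \<in> {-M..M}"
  using assms by (cases b) (auto simp: Let_def)

text \<open>The current value already lies in [-M, M], so truncating the update cannot enlarge the
  step. The absolute value allows for either sign of \<open>\<delta>\<close>.\<close>

lemma rr_log_variance_diff:
  assumes "0 < M" "ls0 i \<in> {-M..M}"
  shows "\<bar>rr_log_variance \<delta> M ls0 h (Suc b) i - rr_log_variance \<delta> M ls0 h b i\<bar> \<le> \<bar>\<delta> (Suc b)\<bar>"
proof -
  have "rr_log_variance \<delta> M ls0 h b i \<in> {-M..M}" by (rule rr_log_variance_bounds) (use assms in auto)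
  then show ?thesis by (auto simp: Let_def)
qed

lemma rr_log_variance_cong:
  assumes "\<And>j. 0 < j \<Longrightarrow> j \<le> 50 * b \<Longrightarrow> h j = h' j"
  shows "rr_log_variance \<delta> M ls0 h b i = rr_log_variance \<delta> M ls0 h' b i"
  using assms
proof (induction b)
  case (Suc b)
  have "h j = h' j" if "j \<in> batch (Suc b)" for j using that by (intro Suc.prems) (auto simp: batch_def)
  then have "n_proposals h i (Suc b) = n_proposals h' i (Suc b)" "n_accepted h i (Suc b) = n_accepted h' i (Suc b)"
    unfolding n_proposals_def n_accepted_def by (auto intro!: arg_cong[where f=card])
  moreover have "rr_log_variance \<delta> M ls0 h b i = rr_log_variance \<delta> M ls0 h' b i"
    by (intro Suc.IH Suc.prems) auto
  ultimately show ?case unfolding rr_log_variance.simps acceptance_rate_def by (simp only:)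
qed simp

lemma measurable_card_batch:
  assumes "\<And>j. j \<in> batch b \<Longrightarrow> Measurable.pred M (\<lambda>h. P h j)"
  shows "(\<lambda>h. real (card {j \<in> batch b. P h j})) \<in> borel_measurable M"
proof -
  have fin: "finite (batch b)" by (simp add: batch_def)
  have "real (card {j \<in> batch b. P h j}) = (\<Sum>j\<in>batch b. if P h j then 1 else 0)" for h
    using fin by (simp add: sum.If_cases Int_def)
  moreover have "(\<lambda>h. \<Sum>j\<in>batch b. if P h j then 1 else 0 :: real) \<in> borel_measurable M"
    using assms by (intro borel_measurable_sum measurable_If) auto
  ultimately show ?thesis by simp
qed

lemma measurable_rr_log_variance:
  fixes ls0 :: "'d::finite \<Rightarrow> real"
  assumes "50 * b < n"
  shows "(\<lambda>h. rr_log_variance \<delta> M ls0 h b i) \<in> borel_measurable (PiM {0..<n} (\<lambda>_. record_space))"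
  using assms
proof (induction b)
  case (Suc b)
  let ?H = "PiM {0..<n} (\<lambda>_. record_space :: 'd mwg_record measure)"
  have comp: "(\<lambda>h. h j) \<in> ?H \<rightarrow>\<^sub>M record_space" if "j \<in> batch (Suc b)" for j
    using that Suc.prems by (intro measurable_component_singleton) (auto simp: batch_def)
  have co: "Measurable.pred record_space (\<lambda>z :: 'd mwg_record. coord_of z = i)"
    "Measurable.pred record_space (\<lambda>z :: 'd mwg_record. coord_of z = i \<and> accepted z)"
    unfolding record_space_def by measurable
  have [measurable]: "(\<lambda>h. real (n_proposals h i (Suc b))) \<in> borel_measurable ?H"
    "(\<lambda>h. real (n_accepted h i (Suc b))) \<in> borel_measurable ?H"
    unfolding n_proposals_def n_accepted_def
    by (intro measurable_card_batch measurable_compose[OF comp co(1)] measurable_compose[OF comp co(2)]; assumption)+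
  have [measurable]: "(\<lambda>h. acceptance_rate h i (Suc b)) \<in> borel_measurable ?H"
    unfolding acceptance_rate_def by measurable
  have [measurable]: "(\<lambda>h. rr_log_variance \<delta> M ls0 h b i) \<in> borel_measurable ?H"
    by (rule Suc.IH) (use Suc.prems in simp)
  \<comment> \<open>Restates the test through the real-valued count, whose measurability has just
    been shown.\<close>
  have "n_proposals h i (Suc b) = 0 \<longleftrightarrow> real (n_proposals h i (Suc b)) = 0" for h :: "'d history" by simp
  then show ?case
    unfolding rr_log_variance.simps Let_def by (simp only:) measurable
qed simp

lemma exp_diff_le:
  fixes x y :: real
  assumes "x \<le> M" "y \<le> M"
  shows "\<bar>exp x - exp y\<bar> \<le> exp M * \<bar>x - y\<bar>"
proof -
  have *: "exp x - exp y \<le> exp M * \<bar>x - y\<bar>" if "x \<le> M" "y \<le> x" for x y :: real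
  proof -
    have "exp x - exp y = exp x * (1 - exp (y - x))" by (simp add: right_diff_distrib exp_diff)
    also have "1 - exp (y - x) \<le> x - y" using exp_ge_add_one_self[of "y - x"] by linarith
    then have "exp x * (1 - exp (y - x)) \<le> exp x * (x - y)" by (intro mult_left_mono) auto
    also have "\<dots> \<le> exp M * \<bar>x - y\<bar>" using that by (intro mult_mono) auto
    finally show ?thesis .
  qed
  show ?thesis
  proof (cases "y \<le> x")
    case True
    then have "exp y \<le> exp x" by simp
    then show ?thesis using *[OF assms(1) True] by simp
  next
    case False
    then have "exp x \<le> exp y" by simp
    then show ?thesis using *[OF assms(2), of x] False by (simp add: abs_minus_commute)
  qed
qed

lemma bigo_powr_neg_tendsto_0:
  assumes "\<delta> \<in> O(\<lambda>n. real n powr (- 1 / 2))"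
  shows "\<delta> \<longlonglongrightarrow> (0::real)"
proof -
  obtain c where c: "eventually (\<lambda>n. norm (\<delta> n) \<le> c * norm (real n powr (- 1 / 2))) sequentially"
    using assms by (auto elim: landau_o.bigE)
  have "(\<lambda>n. real n powr (- 1 / 2)) \<longlonglongrightarrow> 0"
    by (rule tendsto_neg_powr[OF _ filterlim_real_sequentially]) simp
  then have "(\<lambda>n. c * norm (real n powr (- 1 / 2))) \<longlonglongrightarrow> c * norm (0::real)"
    by (intro tendsto_intros)
  then show ?thesis by (intro Lim_null_comparison[OF c]) simp
qed

lemma (in ergodic_mwg_target) rr_adaptive_run:
  assumes a: "\<forall>i. a i \<noteq> 0" and \<alpha>0: "prob_vector \<alpha>0" and x0: "x0 \<in> support"
    and \<delta>: "\<delta> \<longlonglongrightarrow> 0" and M: "0 < M" and ls0: "\<forall>i. ls0 i \<in> {-M..M}"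
  shows "\<exists>lo hi \<eta>. adaptive_run g C D a (rr_variance \<delta> M ls0) \<alpha>0 x0 lo hi \<eta>"
proof -
  \<comment> \<open>Iterations \<open>n\<close> and \<open>n + 1\<close> use the log variances after
    \<open>(n - 1) div 50\<close> and \<open>n div 50\<close> batches. These differ only if 50
    divides \<open>n\<close>, and then by the update that follows batch \<open>n div 50\<close>. The
    factor \<open>exp M\<close> is the Lipschitz constant of the exponential below
    \<open>M\<close>.\<close>
  define \<eta> where "\<eta> n = exp M * \<bar>\<delta> (n div 50)\<bar>" for n
  have lsM: "rr_log_variance \<delta> M ls0 h b i \<in> {-M..M}" for h b i
    by (rule rr_log_variance_bounds[OF M]) (use ls0 in blast)
  have "adaptive_run g C D a (rr_variance \<delta> M ls0) \<alpha>0 x0 (exp (- M)) (exp M) \<eta>"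
  proof unfold_locales
    fix n i assume n: "0 < (n::nat)"
    have [measurable]: "(\<lambda>h. rr_log_variance \<delta> M ls0 h ((n - 1) div 50) i) \<in>
        borel_measurable (PiM {0..<n} (\<lambda>_. record_space))"
      by (rule measurable_rr_log_variance) (use n in linarith)
    show "(\<lambda>h. rr_variance \<delta> M ls0 n h i) \<in> borel_measurable (PiM {0..<n} (\<lambda>_. record_space))"
      unfolding rr_variance_def by measurable
  next
    fix n :: nat and h h' :: "'d history" assume h: "\<And>j. j < n \<Longrightarrow> h j = h' j"
    have "rr_log_variance \<delta> M ls0 h ((n - 1) div 50) i = rr_log_variance \<delta> M ls0 h' ((n - 1) div 50) i" for i
    proof (rule rr_log_variance_cong)
      fix j assume "0 < j" "j \<le> 50 * ((n - 1) div 50)"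
      then have "j < n" by linarith
      then show "h j = h' j" by (rule h)
    qed
    then show "rr_variance \<delta> M ls0 n h = rr_variance \<delta> M ls0 n h'"
      by (simp add: fun_eq_iff rr_variance_def)
  next
    fix n :: nat and h :: "'d history" and i
    show "exp (- M) \<le> rr_variance \<delta> M ls0 n h i \<and> rr_variance \<delta> M ls0 n h i \<le> exp M"
      using lsM[of h "(n - 1) div 50" i] by (simp add: rr_variance_def)
  next
    fix n :: nat and h :: "'d history" and i assume n: "2 \<le> n"
    let ?l = "\<lambda>b. rr_log_variance \<delta> M ls0 h b i"
    have "\<bar>?l (n div 50) - ?l ((n - 1) div 50)\<bar> \<le> \<bar>\<delta> (n div 50)\<bar>"
    proof (cases "n div 50 = (n - 1) div 50")
      case False
      then have eq: "n div 50 = Suc ((n - 1) div 50)" using n by linarith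
      show ?thesis unfolding eq by (rule rr_log_variance_diff[OF M]) (use ls0 in blast)
    qed simp
    then have "exp M * \<bar>?l (n div 50) - ?l ((n - 1) div 50)\<bar> \<le> \<eta> n" unfolding \<eta>_def by (intro mult_left_mono) auto
    moreover have "\<bar>exp (?l (n div 50)) - exp (?l ((n - 1) div 50))\<bar> \<le> exp M * \<bar>?l (n div 50) - ?l ((n - 1) div 50)\<bar>"
      by (rule exp_diff_le) (use lsM in auto)
    ultimately show "\<bar>rr_variance \<delta> M ls0 (Suc n) h i - rr_variance \<delta> M ls0 n h i\<bar> \<le> \<eta> n"
      by (simp add: rr_variance_def)
  next
    have "filterlim (\<lambda>n. n div 50) sequentially (sequentially :: nat filter)"
      unfolding filterlim_at_top
    proof
      fix Z :: nat
      show "eventually (\<lambda>n. Z \<le> n div 50) sequentially"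
        by (rule eventually_sequentiallyI[of "50 * Z"]) linarith
    qed
    from tendsto_rabs[OF filterlim_compose[OF \<delta> this]]
    have "(\<lambda>n. exp M * \<bar>\<delta> (n div 50)\<bar>) \<longlonglongrightarrow> exp M * \<bar>0\<bar>" by (intro tendsto_mult tendsto_const)
    then show "\<eta> \<longlonglongrightarrow> 0" unfolding \<eta>_def[abs_def] by simp
  qed (use a \<alpha>0 x0 M in \<open>auto simp: rr_variance_def\<close>)
  then show ?thesis by blast
qed

theorem theorem7p3:
  fixes g :: "real \<Rightarrow> real" and C a :: "'d::finite \<Rightarrow> real"
  assumes g_measurable: "g \<in> borel_measurable borel"
    and g_nonneg: "\<And>z. 0 \<le> g z"
    and g_density: "(\<integral>\<^sup>+ z. ennreal (g z) \<partial>lborel) = 1"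
    and C_pos: "\<And>i. 0 < C i"
    and second_moment: "integrable (density lborel g) (\<lambda>z. z\<^sup>2)"
    and rwm_ergodic: "uniformly_ergodic {z. 0 < g z} (rwm_kernel g) (density lborel g)"
    and a_nonzero: "\<And>i. a i \<noteq> 0"
  shows
    "(AE x0 in product_target g C. \<forall>\<alpha>0. prob_vector \<alpha>0 \<longrightarrow>
        (\<lambda>n. tv_dist (law_at (HST_kernel g C a \<alpha>0 x0) n) (product_target g C)) \<longlonglongrightarrow> 0) \<and>
     (\<forall>\<delta> M ls0. \<delta> \<in> O(\<lambda>n. real n powr (- 1 / 2)) \<longrightarrow> 0 < M \<longrightarrow> (\<forall>i. ls0 i \<in> {- M..M}) \<longrightarrow>
       (AE x0 in product_target g C. \<forall>\<alpha>0. prob_vector \<alpha>0 \<longrightarrow>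
          (\<lambda>n. tv_dist (law_at (RR_kernel g C a \<delta> M ls0 \<alpha>0 x0) n) (product_target g C)) \<longlonglongrightarrow> 0))"
proof -
  obtain D where "0 \<le> D" "\<And>x y. 0 < g x \<Longrightarrow> 0 < g y \<Longrightarrow> \<bar>x - y\<bar> \<le> D"
    using uniformly_ergodic_imp_bounded_support[OF g_measurable g_nonneg g_density rwm_ergodic] by blast
  then interpret ergodic_mwg_target g C D
    by unfold_locales (use g_measurable g_nonneg g_density C_pos rwm_ergodic in auto)
  have a: "\<forall>i. a i \<noteq> 0" using a_nonzero by blast
  have hst: "(\<lambda>n. tv_dist (law_at (HST_kernel g C a \<alpha>0 x0) n) (product_target g C)) \<longlonglongrightarrow> 0"
    if "x0 \<in> support" "prob_vector \<alpha>0" for x0 \<alpha>0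
    using hst_adaptive_run[OF a that(2,1)] adaptive_run.tv_dist_tendsto_0 unfolding HST_kernel_def by blast
  have rr: "(\<lambda>n. tv_dist (law_at (RR_kernel g C a \<delta> M ls0 \<alpha>0 x0) n) (product_target g C)) \<longlonglongrightarrow> 0"
    if "\<delta> \<in> O(\<lambda>n. real n powr (- 1 / 2))" "0 < M" "\<forall>i. ls0 i \<in> {- M..M}" "x0 \<in> support" "prob_vector \<alpha>0"
    for \<delta> M ls0 x0 \<alpha>0
    using rr_adaptive_run[OF a that(5,4) bigo_powr_neg_tendsto_0[OF that(1)] that(2,3)]
      adaptive_run.tv_dist_tendsto_0 unfolding RR_kernel_def by blast
  \<comment> \<open>The exceptional set of starting states is the complement of the support. It is
    the same for all \<open>\<alpha>0\<close>, so the quantifier over initial selection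
    probabilities may stand inside \<open>AE\<close>.\<close>
  show ?thesis
    using AE_support by (auto intro: hst rr elim!: eventually_mono)
qed

end
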